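(* Let $\kappa$ be a consistent positive definite kernel on $X$, let $\mathbf A=(A_i)_{i\in I}$ be an $(I^+,I^-)$-condenser, and let $\mathbf a$, $\mathbf g$ be as in the context. Assume that either $I^-=\varnothing$, or both $\sum_{i\in I}a_i\,g_{i,\inf}^{-1}<\infty$ and $\sup_{x\in A^+,\,y\in A^-}\kappa(x,y)<\infty$. Assume also that there is $\mu\in\mathcal E(\mathbf A)$ with $\langle g_i,\mu^i\rangle=a_i$ for all $i\in I$. Then the semimetric space $\mathcal E(\mathbf A,\le\mathbf a,\mathbf g)$ is complete. In more detail, if $(\mu_s)_{s\in S}$ is a strong Cauchy net in $\mathcal E(\mathbf A,\le\mathbf a,\mathbf g)$ and $\mu$ is an $\mathbf A$-vague cluster point of it (such a $\mu$ exists), then $\mu\in\mathcal E(\mathbf A,\le\mathbf a,\mathbf g)$ and $$\lim_{s\in S}\|\mu_s-\mu\|^2=0.$$ Assume, in addition, that $\kappa$ is strictly positive definite and that all $A_i$, $i\in I$, are mutually disjoint. If moreover a net $(\mu_s)_{s\in S}\subset\mathcal E(\mathbf A,\le\mathbf a,\mathbf g)$ converges strongly to $\mu_0\in\mathcal E(\mathbf A)$, then $\mu_0\in\mathcal E(\mathbf A,\le\mathbf a,\mathbf g)$ and $\mu_s\to\mu_0$ $\mathbf A$-vaguely.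
   Context: Let $X$ be a locally compact Hausdorff space and $\mathfrak M$ the space of real-valued (signed) Radon measures on $X$ with the vague topology (pointwise convergence on continuous real functions with compact support). For a locally compact space $Y$, $\Phi(Y)$ is the set of lower semicontinuous $\psi:Y\to(-\infty,\infty]$, with $\psi\ge0$ required unless $Y$ is compact. Write $\langle u,\nu\rangle:=\int u\,d\nu$. A kernel is an element $\kappa\in\Phi(X\times X)$; $\kappa(\nu,\nu_1):=\int\kappa\,d(\nu\otimes\nu_1)$ whenever well defined. $\kappa$ is positive definite if it is symmetric and $\kappa(\nu,\nu)\ge0$ for every $\nu\in\mathfrak M$ for which it is defined. Then $\mathcal E:=\{\nu\in\mathfrak M:-\infty<\kappa(\nu,\nu)<\infty\}$ is a pre-Hilbert space with scalar product $\kappa(\nu,\nu_1)$ and seminorm $\|\nu\|:=\sqrt{\kappa(\nu,\nu)}$ (strong topology); $\kappa$ is strictly positive definite if this seminorm is a norm. $\mathfrak M^+(E)$ is the set of nonnegative measures supported by the closed set $E$; $\mathcal E^+:=\mathfrak M^+(X)\cap\mathcal E$. $\kappa$ is consistent if every strong Cauchy net in $\mathcal E^+$ converges strongly to each of its vague cluster points (equivalently: every strongly bounded, vaguely convergent net in $\mathcal E^+$ converges to its vague limit weakly, i.e. after pairing $\kappa(\cdot,\mu)$ with each $\mu\in\mathcal E$). $I^+$, $I^-$ are disjoint countable (finite or infinite) sets of indices in $\mathbb N$, $I^-$ possibly empty, $I=I^+\cup I^-$; $\alpha_i=+1$ for $i\in I^+$ and $\alpha_i=-1$ for $i\in I^-$.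 An $(I^+,I^-)$-condenser is a family $\mathbf A=(A_i)_{i\in I}$ of nonempty closed sets in $X$ such that every compact set meets at most finitely many $A_i$ and $A_i\cap A_j=\varnothing$ for $i\in I^+$, $j\in I^-$. $A^\pm:=\bigcup_{i\in I^\pm}A_i$. $\mathfrak M(\mathbf A):=\prod_{i\in I}\mathfrak M^+(A_i)$ consists of vector measures $\mu=(\mu^i)_{i\in I}$; the $\mathbf A$-vague topology is the product of the vague topologies. Put $\kappa(\mu,\mu_1):=\sum_{i,j\in I}\alpha_i\alpha_j\kappa(\mu^i,\mu_1^j)$. $\mathcal E(\mathbf A)$ is the set of $\mu\in\mathfrak M(\mathbf A)$ with $\kappa(\mu,\mu)$ finite (absolute convergence), with the semimetric $\|\mu_1-\mu_2\|:=\bigl[\sum_{i,j\in I}\alpha_i\alpha_j\kappa(\mu_1^i-\mu_2^i,\mu_1^j-\mu_2^j)\bigr]^{1/2}$, whose topology is called strong. $\mathbf g=(g_i)_{i\in I}$ with $g_i:A_i\to(0,\infty)$ continuous; $\mathbf a=(a_i)_{i\in I}$ with $a_i>0$; $g_{i,\inf}:=\inf_{A_i}g_i$. $\mathcal E(\mathbf A,\le\mathbf a,\mathbf g)$ is the set of $\mu\in\mathcal E(\mathbf A)$ with $\langle g_i,\mu^i\rangle\le a_i$ for all $i\in I$, with the induced semimetric and (strong) topology. Completeness means that every strong Cauchy net in it converges strongly to an element of it. *)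

theory Defs
  imports "HOL-Analysis.Analysis"
begin

text \<open>A net is a map on a subset \<open>S\<close> of a type, directed by a preorder \<open>le\<close>; its limits are taken
  along the filter generated by the tails of \<open>S\<close>.\<close>

definition directed_set :: "'s set \<Rightarrow> ('s \<Rightarrow> 's \<Rightarrow> bool) \<Rightarrow> bool" where
  "directed_set S le \<longleftrightarrow>
     S \<noteq> {} \<and>
     (\<forall>s\<in>S. le s s) \<and>
     (\<forall>s\<in>S. \<forall>t\<in>S. \<forall>u\<in>S. le s t \<longrightarrow> le t u \<longrightarrow> le s u) \<and>
     (\<forall>s\<in>S. \<forall>t\<in>S. \<exists>u\<in>S. le s u \<and> le t u)"

definition net_filter :: "'s set \<Rightarrow> ('s \<Rightarrow> 's \<Rightarrow> bool) \<Rightarrow> 's filter" where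
  "net_filter S le = (INF s\<in>S. principal {t \<in> S. le s t})"

definition Cauchy_net ::
  "('b \<Rightarrow> 'b \<Rightarrow> real) \<Rightarrow> 's set \<Rightarrow> ('s \<Rightarrow> 's \<Rightarrow> bool) \<Rightarrow> ('s \<Rightarrow> 'b) \<Rightarrow> bool" where
  "Cauchy_net d S le x \<longleftrightarrow>
     (\<forall>e>0. \<exists>s0\<in>S. \<forall>s\<in>S. \<forall>t\<in>S. le s0 s \<longrightarrow> le s0 t \<longrightarrow> d (x s) (x t) < e)"

definition net_cluster_point ::
  "'b topology \<Rightarrow> 's set \<Rightarrow> ('s \<Rightarrow> 's \<Rightarrow> bool) \<Rightarrow> ('s \<Rightarrow> 'b) \<Rightarrow> 'b \<Rightarrow> bool" where
  "net_cluster_point T S le x l \<longleftrightarrow>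
     l \<in> topspace T \<and>
     (\<forall>U. openin T U \<longrightarrow> l \<in> U \<longrightarrow> (\<forall>s\<in>S. \<exists>t\<in>S. le s t \<and> x t \<in> U))"

lemma eventually_net_filter:
  assumes "directed_set S le"
  shows "eventually P (net_filter S le) \<longleftrightarrow> (\<exists>s0\<in>S. \<forall>t\<in>S. le s0 t \<longrightarrow> P t)"
proof -
  have "eventually P (net_filter S le) \<longleftrightarrow>
      (\<exists>s0\<in>S. eventually P (principal {t \<in> S. le s0 t}))"
    unfolding net_filter_def
  proof (rule eventually_INF_base)
    show "S \<noteq> {}" using assms by (simp add: directed_set_def)
  next
    fix a b assume ab: "a \<in> S" "b \<in> S"
    then obtain u where u: "u \<in> S" "le a u" "le b u"
      using assms unfolding directed_set_def by blast
    have "{t \<in> S. le u t} \<subseteq> {t \<in> S. le a t} \<inter> {t \<in> S. le b t}"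
      using assms ab u unfolding directed_set_def by blast
    then show "\<exists>x\<in>S. principal {t \<in> S. le x t}
        \<le> inf (principal {t \<in> S. le a t}) (principal {t \<in> S. le b t})"
      using u(1) by auto
  qed
  then show ?thesis by (auto simp: eventually_principal)
qed

text \<open>Radon measures are taken in Bourbaki's sense: linear functionals on the space \<open>Cc\<close> of
  continuous functions with compact support that are continuous on the functions supported in
  any fixed compact set. A signed Radon measure need not have finite total variation.
  So that equality of functionals is equality of measures (and pointwise subtraction
  is subtraction of measures), functionals take the value 0 outside \<open>Cc\<close>.\<close>

definition Cc :: "('b::topological_space \<Rightarrow> real) set" where
  "Cc = {f. continuous_on UNIV f \<and> compact (closure {y. f y \<noteq> 0})}"

type_synonym 'b functional = "('b \<Rightarrow> real) \<Rightarrow> real"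

definition radon :: "'b::topological_space functional set" where
  "radon = {\<nu>.
     (\<forall>f. f \<notin> Cc \<longrightarrow> \<nu> f = 0) \<and>
     (\<forall>f\<in>Cc. \<forall>h\<in>Cc. \<nu> (\<lambda>y. f y + h y) = \<nu> f + \<nu> h) \<and>
     (\<forall>f\<in>Cc. \<forall>c. \<nu> (\<lambda>y. c * f y) = c * \<nu> f) \<and>
     (\<forall>K. compact K \<longrightarrow> (\<exists>M. \<forall>f\<in>Cc. \<forall>c.
        (\<forall>y. y \<notin> K \<longrightarrow> f y = 0) \<longrightarrow> (\<forall>y. \<bar>f y\<bar> \<le> c) \<longrightarrow> \<bar>\<nu> f\<bar> \<le> M * c))}"

definition vague_topology :: "'b::topological_space functional topology" where
  "vague_topology =
     pullback_topology radon (\<lambda>\<nu>. restrict \<nu> Cc) (product_topology (\<lambda>_. euclideanreal) Cc)"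

text \<open>\<open>radon_plus E\<close> consists of the nonnegative measures supported by \<open>E\<close>, i.e. with zero
  restriction to the complement of \<open>E\<close>.\<close>

definition radon_plus :: "'b::topological_space set \<Rightarrow> 'b functional set" where
  "radon_plus E = {\<nu> \<in> radon.
     (\<forall>f\<in>Cc. (\<forall>y. 0 \<le> f y) \<longrightarrow> 0 \<le> \<nu> f) \<and>
     (\<forall>f\<in>Cc. closure {y. f y \<noteq> 0} \<inter> E = {} \<longrightarrow> \<nu> f = 0)}"

definition pos_part :: "'b::topological_space functional \<Rightarrow> 'b functional" where
  "pos_part \<nu> = (\<lambda>f.
     let p = (\<lambda>u. Sup {\<nu> h | h. h \<in> Cc \<and> (\<forall>y. 0 \<le> h y \<and> h y \<le> u y)})
     in if f \<in> Cc then p (\<lambda>y. max (f y) 0) - p (\<lambda>y. max (- f y) 0) else 0)"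

definition neg_part :: "'b::topological_space functional \<Rightarrow> 'b functional" where
  "neg_part \<nu> = pos_part (\<lambda>f. - \<nu> f)"

definition tensor ::
  "'b::topological_space functional \<Rightarrow> 'c::topological_space functional \<Rightarrow> ('b \<times> 'c) functional" where
  "tensor \<nu> \<nu>1 = (\<lambda>F. if F \<in> Cc then \<nu> (\<lambda>x. \<nu>1 (\<lambda>y. F (x, y))) else 0)"

definition Phi :: "('b::topological_space \<Rightarrow> ereal) set" where
  "Phi = {\<psi>. (\<forall>c. open {y. c < \<psi> y}) \<and> (\<forall>y. \<psi> y \<noteq> -\<infinity>) \<and>
              (compact (UNIV :: 'b set) \<or> (\<forall>y. 0 \<le> \<psi> y))}"

text \<open>Bourbaki's integral of a function in \<open>Phi\<close> with respect to a nonnegative measure. When the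
  space is not compact, restricting to nonnegative \<open>f\<close> gives the same supremum, since then
  \<open>\<psi> \<ge> 0\<close>.\<close>

definition integral_plus :: "'b::topological_space functional \<Rightarrow> ('b \<Rightarrow> ereal) \<Rightarrow> ereal" where
  "integral_plus \<nu> \<psi> = (SUP f \<in> {f \<in> Cc. \<forall>y. ereal (f y) \<le> \<psi> y}. ereal (\<nu> f))"

text \<open>The integral of a function in \<open>Phi\<close> with respect to a signed measure. Only meaningful
  where it is defined: note that \<open>\<infinity> - \<infinity> = \<infinity>\<close> in \<open>ereal\<close>.\<close>

definition integral_defined :: "'b::topological_space functional \<Rightarrow> ('b \<Rightarrow> ereal) \<Rightarrow> bool" where
  "integral_defined \<nu> \<psi> \<longleftrightarrow>
     \<not> (integral_plus (pos_part \<nu>) \<psi> = \<infinity> \<and> integral_plus (neg_part \<nu>) \<psi> = \<infinity>)"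

definition integral_signed :: "'b::topological_space functional \<Rightarrow> ('b \<Rightarrow> ereal) \<Rightarrow> ereal" where
  "integral_signed \<nu> \<psi> = integral_plus (pos_part \<nu>) \<psi> - integral_plus (neg_part \<nu>) \<psi>"

text \<open>Bourbaki's upper integral of a nonnegative function with respect to a nonnegative measure.
  It is the integral when the function is measurable; functions given on a closed set
  carrying the measure are extended by 0 (see \<open>integral_on\<close>).\<close>

definition upper_integral :: "'b::topological_space functional \<Rightarrow> ('b \<Rightarrow> ereal) \<Rightarrow> ereal" where
  "upper_integral \<nu> h = (INF \<psi> \<in> {\<psi> \<in> Phi. \<forall>y. h y \<le> \<psi> y}. integral_plus \<nu> \<psi>)"

definition integral_on ::
  "'b::topological_space set \<Rightarrow> ('b \<Rightarrow> real) \<Rightarrow> 'b functional \<Rightarrow> ereal" where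
  "integral_on E u \<nu> = upper_integral \<nu> (\<lambda>y. if y \<in> E then ereal (u y) else 0)"

definition mutual_defined ::
  "('a::topological_space \<times> 'a \<Rightarrow> ereal) \<Rightarrow> 'a functional \<Rightarrow> 'a functional \<Rightarrow> bool" where
  "mutual_defined \<kappa> \<nu> \<nu>1 \<longleftrightarrow> integral_defined (tensor \<nu> \<nu>1) \<kappa>"

definition mutual ::
  "('a::topological_space \<times> 'a \<Rightarrow> ereal) \<Rightarrow> 'a functional \<Rightarrow> 'a functional \<Rightarrow> ereal" where
  "mutual \<kappa> \<nu> \<nu>1 = integral_signed (tensor \<nu> \<nu>1) \<kappa>"

definition positive_definite :: "('a::topological_space \<times> 'a \<Rightarrow> ereal) \<Rightarrow> bool" where
  "positive_definite \<kappa> \<longleftrightarrow>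
     (\<forall>x y. \<kappa> (x, y) = \<kappa> (y, x)) \<and>
     (\<forall>\<nu>\<in>radon. mutual_defined \<kappa> \<nu> \<nu> \<longrightarrow> 0 \<le> mutual \<kappa> \<nu> \<nu>)"

definition energy_space :: "('a::topological_space \<times> 'a \<Rightarrow> ereal) \<Rightarrow> 'a functional set" where
  "energy_space \<kappa> = {\<nu> \<in> radon. mutual_defined \<kappa> \<nu> \<nu> \<and> -\<infinity> < mutual \<kappa> \<nu> \<nu> \<and> mutual \<kappa> \<nu> \<nu> < \<infinity>}"

definition energy_plus :: "('a::topological_space \<times> 'a \<Rightarrow> ereal) \<Rightarrow> 'a functional set" where
  "energy_plus \<kappa> = radon_plus UNIV \<inter> energy_space \<kappa>"

definition energy_norm :: "('a::topological_space \<times> 'a \<Rightarrow> ereal) \<Rightarrow> 'a functional \<Rightarrow> real" where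
  "energy_norm \<kappa> \<nu> = sqrt (real_of_ereal (mutual \<kappa> \<nu> \<nu>))"

definition energy_dist ::
  "('a::topological_space \<times> 'a \<Rightarrow> ereal) \<Rightarrow> 'a functional \<Rightarrow> 'a functional \<Rightarrow> real" where
  "energy_dist \<kappa> \<nu> \<nu>1 = energy_norm \<kappa> (\<nu> - \<nu>1)"

definition strictly_positive_definite :: "('a::topological_space \<times> 'a \<Rightarrow> ereal) \<Rightarrow> bool" where
  "strictly_positive_definite \<kappa> \<longleftrightarrow>
     positive_definite \<kappa> \<and> (\<forall>\<nu>\<in>energy_space \<kappa>. energy_norm \<kappa> \<nu> = 0 \<longrightarrow> \<nu> = (\<lambda>_. 0))"

text \<open>A definition cannot quantify over the index types of nets. The index type used here is large
  enough to represent every net of measures up to its tails; that nothing is lost is proved in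
  \<open>consistent_net\<close> below.\<close>

definition consistent :: "('a::topological_space \<times> 'a \<Rightarrow> ereal) \<Rightarrow> bool" where
  "consistent \<kappa> \<longleftrightarrow>
     (\<forall>(S :: ('a functional \<times> 'a functional set) set) le x \<nu>.
        directed_set S le \<longrightarrow> x \<in> S \<rightarrow> energy_plus \<kappa> \<longrightarrow>
        Cauchy_net (energy_dist \<kappa>) S le x \<longrightarrow>
        net_cluster_point vague_topology S le x \<nu> \<longrightarrow>
        \<nu> \<in> energy_space \<kappa> \<and> ((\<lambda>s. energy_dist \<kappa> (x s) \<nu>) \<longlongrightarrow> 0) (net_filter S le))"

lemma consistent_net:
  fixes \<kappa> :: "'a::topological_space \<times> 'a \<Rightarrow> ereal" and S :: "'s set"
  assumes "consistent \<kappa>" and dir: "directed_set S le" and xS: "x \<in> S \<rightarrow> energy_plus \<kappa>"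
    and cau: "Cauchy_net (energy_dist \<kappa>) S le x"
    and clu: "net_cluster_point vague_topology S le x \<nu>"
  shows "\<nu> \<in> energy_space \<kappa> \<and> ((\<lambda>s. energy_dist \<kappa> (x s) \<nu>) \<longlongrightarrow> 0) (net_filter S le)"
proof -
  define B where "B s = x ` {t \<in> S. le s t}" for s
  define D where "D = {(m, C). \<exists>s\<in>S. C = B s \<and> m \<in> C}"
  define r where "r = (\<lambda>(p :: 'a functional \<times> 'a functional set)
      (q :: 'a functional \<times> 'a functional set). snd q \<subseteq> snd p)"
  have refl: "le t t" if "t \<in> S" for t
    using dir that unfolding directed_set_def by blast
  have trans: "le s u" if "s \<in> S" "t \<in> S" "u \<in> S" "le s t" "le t u" for s t u
    using dir that unfolding directed_set_def by blast
  have ne: "S \<noteq> {}"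
    using dir unfolding directed_set_def by blast
  have self: "(x t, B t) \<in> D" if "t \<in> S" for t
    using that refl[OF that] unfolding D_def B_def by blast
  have anti: "B t \<subseteq> B s" if "s \<in> S" "t \<in> S" "le s t" for s t
    using trans[OF that(1,2) _ that(3)] unfolding B_def by blast
  have dirD: "directed_set D r"
    unfolding directed_set_def
  proof (intro conjI ballI impI)
    show "D \<noteq> {}" using self ne by blast
  next
    fix p q assume "p \<in> D" "q \<in> D"
    then obtain s t where st: "s \<in> S" "snd p = B s" "t \<in> S" "snd q = B t"
      unfolding D_def by auto
    then obtain u where u: "u \<in> S" "le s u" "le t u"
      using dir unfolding directed_set_def by blast
    have "r p (x u, B u)" "r q (x u, B u)"
      using anti[OF st(1) u(1,2)] anti[OF st(3) u(1,3)] st(2,4) by (simp_all add: r_def)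
    then show "\<exists>w\<in>D. r p w \<and> r q w"
      using self[OF u(1)] by blast
  qed (auto simp: r_def)
  have fstD: "fst \<in> D \<rightarrow> energy_plus \<kappa>"
    using xS unfolding D_def B_def by auto
  have cauD: "Cauchy_net (energy_dist \<kappa>) D r fst"
    unfolding Cauchy_net_def
  proof (intro allI impI)
    fix e :: real assume "e > 0"
    then obtain s0 where s0: "s0 \<in> S"
      "\<And>s t. s \<in> S \<Longrightarrow> t \<in> S \<Longrightarrow> le s0 s \<Longrightarrow> le s0 t \<Longrightarrow> energy_dist \<kappa> (x s) (x t) < e"
      using cau unfolding Cauchy_net_def by blast
    have *: "\<exists>s\<in>S. le s0 s \<and> fst p = x s" if "p \<in> D" "r (x s0, B s0) p" for p
    proof -
      have "fst p \<in> snd p" using that(1) unfolding D_def by auto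
      also have "snd p \<subseteq> B s0" using that(2) by (simp add: r_def)
      finally show ?thesis unfolding B_def by blast
    qed
    show "\<exists>p0\<in>D. \<forall>p\<in>D. \<forall>q\<in>D. r p0 p \<longrightarrow> r p0 q \<longrightarrow> energy_dist \<kappa> (fst p) (fst q) < e"
    proof (intro bexI[of _ "(x s0, B s0)"] ballI impI)
      fix p q assume "p \<in> D" "q \<in> D" "r (x s0, B s0) p" "r (x s0, B s0) q"
      then obtain s t where "s \<in> S" "le s0 s" "fst p = x s" "t \<in> S" "le s0 t" "fst q = x t"
        using *[of p] *[of q] by blast
      then show "energy_dist \<kappa> (fst p) (fst q) < e"
        using s0(2)[of s t] by simp
    qed (rule self[OF s0(1)])
  qed
  have cluD: "net_cluster_point vague_topology D r fst \<nu>"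
    unfolding net_cluster_point_def
  proof (intro conjI allI impI ballI)
    show "\<nu> \<in> topspace vague_topology" using clu unfolding net_cluster_point_def by blast
  next
    fix U p assume U: "openin vague_topology U" "\<nu> \<in> U" and "p \<in> D"
    then obtain s where s: "s \<in> S" "snd p = B s" unfolding D_def by auto
    then obtain t where t: "t \<in> S" "le s t" "x t \<in> U"
      using clu U unfolding net_cluster_point_def by blast
    have "r p (x t, B t)" "fst (x t, B t) \<in> U"
      using anti[OF s(1) t(1,2)] s(2) t(3) by (simp_all add: r_def)
    then show "\<exists>q\<in>D. r p q \<and> fst q \<in> U"
      using self[OF t(1)] by blast
  qed
  have res: "\<nu> \<in> energy_space \<kappa>"
    "((\<lambda>p. energy_dist \<kappa> (fst p) \<nu>) \<longlongrightarrow> 0) (net_filter D r)"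
    using assms(1) dirD fstD cauD cluD unfolding consistent_def by blast+
  have "((\<lambda>s. energy_dist \<kappa> (x s) \<nu>) \<longlongrightarrow> 0) (net_filter S le)"
    unfolding tendsto_iff
  proof (intro allI impI)
    fix e :: real assume "e > 0"
    then obtain p0 where p0: "p0 \<in> D"
      "\<And>q. q \<in> D \<Longrightarrow> r p0 q \<Longrightarrow> dist (energy_dist \<kappa> (fst q) \<nu>) 0 < e"
      using res(2) unfolding tendsto_iff eventually_net_filter[OF dirD] by blast
    then obtain s0 where s0: "s0 \<in> S" "snd p0 = B s0" unfolding D_def by auto
    have "dist (energy_dist \<kappa> (x t) \<nu>) 0 < e" if "t \<in> S" "le s0 t" for t
      using p0(2)[OF self[OF that(1)]] anti[OF s0(1) that] s0(2) by (simp add: r_def)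
    then show "\<forall>\<^sub>F s in net_filter S le. dist (energy_dist \<kappa> (x s) \<nu>) 0 < e"
      unfolding eventually_net_filter[OF dir] using s0(1) by blast
  qed
  with res(1) show ?thesis by blast
qed

definition condenser :: "nat set \<Rightarrow> nat set \<Rightarrow> (nat \<Rightarrow> 'a::topological_space set) \<Rightarrow> bool" where
  "condenser Ipos Ineg A \<longleftrightarrow>
     Ipos \<inter> Ineg = {} \<and>
     (\<forall>i\<in>Ipos \<union> Ineg. closed (A i) \<and> A i \<noteq> {}) \<and>
     (\<forall>K. compact K \<longrightarrow> finite {i \<in> Ipos \<union> Ineg. A i \<inter> K \<noteq> {}}) \<and>
     (\<forall>i\<in>Ipos. \<forall>j\<in>Ineg. A i \<inter> A j = {})"

definition csign :: "nat set \<Rightarrow> nat \<Rightarrow> real" where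
  "csign Ineg i = (if i \<in> Ineg then - 1 else 1)"

definition vector_measures ::
  "nat set \<Rightarrow> nat set \<Rightarrow> (nat \<Rightarrow> 'a::topological_space set) \<Rightarrow> (nat \<Rightarrow> 'a functional) set" where
  "vector_measures Ipos Ineg A = (\<Pi>\<^sub>E i\<in>Ipos \<union> Ineg. radon_plus (A i))"

definition vector_vague_topology ::
  "nat set \<Rightarrow> nat set \<Rightarrow> (nat \<Rightarrow> 'a::topological_space set) \<Rightarrow> (nat \<Rightarrow> 'a functional) topology" where
  "vector_vague_topology Ipos Ineg A =
     product_topology (\<lambda>i. subtopology vague_topology (radon_plus (A i))) (Ipos \<union> Ineg)"

text \<open>Finite energy includes absolute convergence of the double series, in particular finiteness
  of each of its terms.\<close>

definition vector_energy_space ::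
  "('a::topological_space \<times> 'a \<Rightarrow> ereal) \<Rightarrow> nat set \<Rightarrow> nat set \<Rightarrow> (nat \<Rightarrow> 'a set) \<Rightarrow>
     (nat \<Rightarrow> 'a functional) set" where
  "vector_energy_space \<kappa> Ipos Ineg A = {\<mu> \<in> vector_measures Ipos Ineg A.
     (\<forall>i\<in>Ipos \<union> Ineg. \<forall>j\<in>Ipos \<union> Ineg. mutual_defined \<kappa> (\<mu> i) (\<mu> j) \<and> \<bar>mutual \<kappa> (\<mu> i) (\<mu> j)\<bar> < \<infinity>) \<and>
     (\<lambda>(i, j). \<bar>csign Ineg i * csign Ineg j * real_of_ereal (mutual \<kappa> (\<mu> i) (\<mu> j))\<bar>)
       summable_on (Ipos \<union> Ineg) \<times> (Ipos \<union> Ineg)}"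

definition vector_dist ::
  "('a::topological_space \<times> 'a \<Rightarrow> ereal) \<Rightarrow> nat set \<Rightarrow> nat set \<Rightarrow>
     (nat \<Rightarrow> 'a functional) \<Rightarrow> (nat \<Rightarrow> 'a functional) \<Rightarrow> real" where
  "vector_dist \<kappa> Ipos Ineg \<mu>1 \<mu>2 = sqrt (\<Sum>\<^sub>\<infinity>(i, j)\<in>(Ipos \<union> Ineg) \<times> (Ipos \<union> Ineg).
     csign Ineg i * csign Ineg j * real_of_ereal (mutual \<kappa> (\<mu>1 i - \<mu>2 i) (\<mu>1 j - \<mu>2 j)))"

definition vector_energy_le ::
  "('a::topological_space \<times> 'a \<Rightarrow> ereal) \<Rightarrow> nat set \<Rightarrow> nat set \<Rightarrow> (nat \<Rightarrow> 'a set) \<Rightarrow>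
     (nat \<Rightarrow> real) \<Rightarrow> (nat \<Rightarrow> 'a \<Rightarrow> real) \<Rightarrow> (nat \<Rightarrow> 'a functional) set" where
  "vector_energy_le \<kappa> Ipos Ineg A a g = {\<mu> \<in> vector_energy_space \<kappa> Ipos Ineg A.
     \<forall>i\<in>Ipos \<union> Ineg. integral_on (A i) (g i) (\<mu> i) \<le> ereal (a i)}"

end

(* Proof idea. A positive integral of a lower semicontinuous kernel is a supremum over a directed set
   of test functions, hence additive in the measure, and positive definiteness forces the mutual
   energy of two positive measures of finite energy to be finite. So the vector measure mu is
   represented, isometrically, by R mu = P - N, where P and N are the locally finite sums of
   its positive and of its negative components. Along a strong Cauchy net P and N stay strongly bounded,
   because the mass condition and the bound on the kernel control the mutual energy of P and N.
   Consistency, applied to nearly norm-minimal convex combinations, shows that R mu_s converges to R mu for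
   every vague cluster point mu, and such points exist by Tychonoff's theorem. If the kernel is strictly
   positive definite and the plates are disjoint, R is injective, so the cluster point is unique. *)

theory Submission
  imports Defs
begin

section \<open>Continuous functions with compact support\<close>

text \<open>The form controls differences only: the squared norm of P - N is the sum of the squared
  norms of P and N minus the two cross energies, so along a Cauchy net P and N could a priori grow
  together and cancel. The cross energies are therefore bounded outright: if there are negative
  plates, P and N have total mass at most L, a bound for the sum of a_i / g_{i,inf}, and the kernel
  is at most M between plates of opposite sign, which gives M * L^2. A kernel with negative values
  would spoil the exchange of double series and suprema. It occurs only on a compact space, where
  local finiteness leaves finitely many plates; for all other kernels the terms are nonnegative
  before the signs are attached. On arbitrary signed measures bilinearity would involve Jordan
  decompositions, which depend nonlinearly on the measure. The form is therefore used on differences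
  of positive measures of finite energy, where bilinearity follows from additivity on the cone. The
  constraints are rephrased as inequalities on test functions, so that they survive vague
  limits.\<close>

lemma CcI:
  fixes f :: "'b::t2_space \<Rightarrow> real"
  assumes "continuous_on UNIV f" "compact K" "\<And>y. y \<notin> K \<Longrightarrow> f y = 0"
  shows "f \<in> Cc"
proof -
  have "closure {y. f y \<noteq> 0} \<subseteq> K"
    using assms(2,3) by (intro closure_minimal compact_imp_closed) auto
  then have "closure {y. f y \<noteq> 0} = K \<inter> closure {y. f y \<noteq> 0}" by blast
  then have "compact (closure {y. f y \<noteq> 0})"
    using assms(2) by (metis closed_closure compact_Int_closed)
  then show ?thesis using assms(1) by (simp add: Cc_def)
qed

lemma Cc_continuous: "f \<in> Cc \<Longrightarrow> continuous_on UNIV f"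
  and Cc_compact_support: "f \<in> Cc \<Longrightarrow> compact (closure {y. f y \<noteq> 0})"
  by (auto simp: Cc_def)

abbreviation "supp f \<equiv> closure {y. f y \<noteq> 0}"

lemma zero_off_support: "y \<notin> supp f \<Longrightarrow> f y = 0"
  using closure_subset[of "{y. f y \<noteq> 0}"] by blast

lemma Cc_compose2:
  fixes f h :: "'b::t2_space \<Rightarrow> real"
  assumes "f \<in> Cc" "h \<in> Cc" "continuous_on UNIV (\<lambda>y. F (f y) (h y))" "F 0 0 = 0"
  shows "(\<lambda>y. F (f y) (h y)) \<in> Cc"
proof (rule CcI[OF assms(3)])
  show "compact (supp f \<union> supp h)"
    using assms(1,2) by (intro compact_Un Cc_compact_support)
  show "F (f y) (h y) = 0" if "y \<notin> supp f \<union> supp h" for y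
    using that zero_off_support[of y f] zero_off_support[of y h] assms(4) by simp
qed

lemma Cc_zero: "(\<lambda>_. 0) \<in> (Cc :: ('b::t2_space \<Rightarrow> real) set)"
  by (rule CcI[of _ "{}"]) auto

lemma Cc_add: "f \<in> Cc \<Longrightarrow> h \<in> Cc \<Longrightarrow> (\<lambda>y. f y + h y) \<in> Cc"
  and Cc_diff: "f \<in> Cc \<Longrightarrow> h \<in> Cc \<Longrightarrow> (\<lambda>y. f y - h y) \<in> Cc"
  and Cc_max: "f \<in> Cc \<Longrightarrow> h \<in> Cc \<Longrightarrow> (\<lambda>y. max (f y) (h y)) \<in> Cc"
  and Cc_min: "f \<in> Cc \<Longrightarrow> h \<in> Cc \<Longrightarrow> (\<lambda>y. min (f y) (h y)) \<in> Cc"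
  for f h :: "'b::t2_space \<Rightarrow> real"
  using Cc_compose2[of f h "(+)"] Cc_compose2[of f h "(-)"]
    Cc_compose2[of f h max] Cc_compose2[of f h min]
  by (simp_all add: Cc_continuous continuous_on_add continuous_on_diff continuous_on_max
      continuous_on_min)

lemma Cc_mult_left:
  fixes f :: "'b::t2_space \<Rightarrow> real"
  assumes "f \<in> Cc" "continuous_on UNIV u"
  shows "(\<lambda>y. u y * f y) \<in> Cc"
proof (rule CcI[OF _ Cc_compact_support[OF assms(1)]])
  show "continuous_on UNIV (\<lambda>y. u y * f y)"
    using assms Cc_continuous by (intro continuous_on_mult) auto
  show "u y * f y = 0" if "y \<notin> supp f" for y
    using zero_off_support[OF that] by simp
qed

lemma Cc_cmult: "f \<in> Cc \<Longrightarrow> (\<lambda>y. c * f y) \<in> Cc" for f :: "'b::t2_space \<Rightarrow> real"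
  by (rule Cc_mult_left) auto

lemma Cc_uminus: "f \<in> Cc \<Longrightarrow> (\<lambda>y. - f y) \<in> Cc" for f :: "'b::t2_space \<Rightarrow> real"
  using Cc_cmult[of f "-1"] by simp

lemma Cc_max_zero: "f \<in> Cc \<Longrightarrow> (\<lambda>y. max (f y) 0) \<in> Cc" for f :: "'b::t2_space \<Rightarrow> real"
  using Cc_max[OF _ Cc_zero, of f] by simp

text \<open>Lowering \<open>f\<close> by a constant may destroy compact support; cutting off at zero
  restores it, because \<open>0 \<le> e\<close> makes the result vanish wherever \<open>f\<close>
  does.\<close>

lemma Cc_pos_minus:
  fixes f :: "'b::t2_space \<Rightarrow> real"
  assumes "f \<in> Cc" "0 \<le> e"
  shows "(\<lambda>y. max (f y - e) 0) \<in> Cc"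
proof (rule CcI[OF _ Cc_compact_support[OF assms(1)]])
  show "continuous_on UNIV (\<lambda>y. max (f y - e) 0)"
    using assms Cc_continuous by (intro continuous_intros) auto
  show "max (f y - e) 0 = 0" if "y \<notin> supp f" for y
    using zero_off_support[OF that] assms(2) by simp
qed

lemma Cc_bounded:
  assumes "f \<in> (Cc :: ('b::t2_space \<Rightarrow> real) set)"
  obtains c where "c > 0" "\<And>y. \<bar>f y\<bar> \<le> c"
proof -
  have "bounded (f ` supp f)"
    using assms Cc_continuous Cc_compact_support
    by (metis compact_continuous_image compact_imp_bounded continuous_on_subset subset_UNIV)
  then obtain c where c: "c > 0" "\<And>y. y \<in> supp f \<Longrightarrow> \<bar>f y\<bar> \<le> c"
    unfolding bounded_pos by auto
  then have "\<bar>f y\<bar> \<le> c" for y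
    using zero_off_support[of y f] by (cases "y \<in> supp f") auto
  with c(1) show ?thesis using that by blast
qed

text \<open>The cutoff equals 1 on an open neighbourhood \<open>W\<close> of \<open>K\<close>, not
  merely on \<open>K\<close>: multiplying by it changes a function only on a closed set disjoint
  from \<open>K\<close>, which is the form in which \<open>radon_plus\<close> tests
  supports.\<close>

lemma Urysohn_Cc:
  fixes K U :: "'b::t2_space set"
  assumes lc: "locally_compact_space (euclidean :: 'b topology)"
    and K: "compact K" and U: "open U" "K \<subseteq> U"
  shows "\<exists>\<eta> W. \<eta> \<in> Cc \<and> (\<forall>y. 0 \<le> \<eta> y \<and> \<eta> y \<le> 1) \<and> supp \<eta> \<subseteq> U \<and>
    open W \<and> K \<subseteq> W \<and> (\<forall>y\<in>W. \<eta> y = 1)"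
proof -
  have H: "Hausdorff_space (euclidean :: 'b topology)"
    unfolding Hausdorff_space_def using hausdorff[where 'a='b] by (force simp: disjnt_def)
  then obtain V L where VL: "open V" "compact L" "K \<subseteq> V" "V \<subseteq> L"
    using lc K locally_compact_space_compact_closed_compact[of "euclidean :: 'b topology"]
    by auto
  have cr: "completely_regular_space (euclidean :: 'b topology)"
    using lc H by (simp add: locally_compact_regular_imp_completely_regular_space)
  have "closedin euclidean (- (V \<inter> U))" "disjnt K (- (V \<inter> U))"
    using VL U by (auto simp: disjnt_def open_Int)
  \<comment> \<open>The values 2 and -1 leave room on both sides of [0, 1]: after clamping, the open
    set \<open>{y. 1 < f y}\<close> serves as \<open>W\<close>, and the closed set
    \<open>{y. 0 \<le> f y}\<close> contains the support while staying inside
    \<open>U\<close>.\<close>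
  with K obtain f :: "'b \<Rightarrow> real"
    where "continuous_map euclidean euclideanreal f" "f ` (- (V \<inter> U)) \<subseteq> {-1}" "f ` K \<subseteq> {2}"
    by (meson Urysohn_completely_regular_compact_closed_alt[OF cr] compactin_euclidean_iff)
  then have f: "continuous_on UNIV f" "f ` K \<subseteq> {2}" "f ` (- (V \<inter> U)) \<subseteq> {-1}"
    by simp_all
  define \<eta> where "\<eta> = (\<lambda>y. max 0 (min 1 (f y)))"
  have f0: "{y. 0 \<le> f y} \<subseteq> V \<inter> U"
  proof
    fix y assume "y \<in> {y. 0 \<le> f y}"
    then have "f y \<noteq> -1" by auto
    then show "y \<in> V \<inter> U" using f(3) by blast
  qed
  have "closed {y. 0 \<le> f y}" using f(1) by (intro closed_Collect_le continuous_intros)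
  then have cl: "supp \<eta> \<subseteq> {y. 0 \<le> f y}"
    by (intro closure_minimal) (auto simp: \<eta>_def)
  show ?thesis
  proof (intro exI conjI)
    show "\<eta> \<in> Cc"
    proof (rule CcI[OF _ VL(2)])
      show "continuous_on UNIV \<eta>" unfolding \<eta>_def using f(1) by (intro continuous_intros)
      show "\<eta> y = 0" if "y \<notin> L" for y
        using that f0 VL(4) zero_off_support[of y \<eta>] cl by auto
    qed
    show "supp \<eta> \<subseteq> U" using cl f0 by auto
    show "open {y. 1 < f y}" using f(1) by (intro open_Collect_less continuous_intros)
    show "K \<subseteq> {y. 1 < f y}" using f(2) by auto
  qed (auto simp: \<eta>_def)
qed

section \<open>Linear and positive functionals\<close>

text \<open>The algebraic half of \<open>radon\<close>, without continuity on compact sets. Tensor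
  products are studied at this level; for positive functionals on a locally compact space the
  continuity is automatic (\<open>Cc_positive_radon\<close>).\<close>

definition Cc_linear :: "'b::topological_space functional \<Rightarrow> bool" where
  "Cc_linear T \<longleftrightarrow> (\<forall>f. f \<notin> Cc \<longrightarrow> T f = 0) \<and>
     (\<forall>f\<in>Cc. \<forall>h\<in>Cc. T (\<lambda>y. f y + h y) = T f + T h) \<and>
     (\<forall>f\<in>Cc. \<forall>c. T (\<lambda>y. c * f y) = c * T f)"

definition Cc_positive :: "'b::topological_space functional \<Rightarrow> bool" where
  "Cc_positive T \<longleftrightarrow> Cc_linear T \<and> (\<forall>f\<in>Cc. (\<forall>y. 0 \<le> f y) \<longrightarrow> 0 \<le> T f)"

lemma Cc_linear_off: "Cc_linear T \<Longrightarrow> f \<notin> Cc \<Longrightarrow> T f = 0"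
  and Cc_linear_add: "Cc_linear T \<Longrightarrow> f \<in> Cc \<Longrightarrow> h \<in> Cc \<Longrightarrow> T (\<lambda>y. f y + h y) = T f + T h"
  and Cc_linear_cmult: "Cc_linear T \<Longrightarrow> f \<in> Cc \<Longrightarrow> T (\<lambda>y. c * f y) = c * T f"
  by (auto simp: Cc_linear_def)

lemma Cc_linear_diff:
  fixes f :: "'b::t2_space \<Rightarrow> real"
  assumes "Cc_linear T" "f \<in> Cc" "h \<in> Cc"
  shows "T (\<lambda>y. f y - h y) = T f - T h"
  using Cc_linear_add[OF assms(1,2) Cc_cmult[OF assms(3), of "-1"]]
    Cc_linear_cmult[OF assms(1,3), of "-1"] by simp

lemma Cc_linear_zero: "Cc_linear T \<Longrightarrow> T (\<lambda>_. 0) = 0"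
  for T :: "'b::t2_space functional"
  using Cc_linear_cmult[OF _ Cc_zero, of T 0] by simp

lemma Cc_linear_uminus: "Cc_linear T \<Longrightarrow> f \<in> Cc \<Longrightarrow> T (\<lambda>y. - f y) = - T f"
  using Cc_linear_cmult[of T f "-1"] by simp

lemma Cc_linear_comb:
  assumes "Cc_linear T" "Cc_linear T'"
  shows "Cc_linear (\<lambda>f. c * T f + d * T' f)"
  using assms by (auto simp: Cc_linear_def algebra_simps)

lemma Cc_positive_linear: "Cc_positive T \<Longrightarrow> Cc_linear T"
  and Cc_positive_nonneg: "Cc_positive T \<Longrightarrow> (\<And>y. 0 \<le> f y) \<Longrightarrow> 0 \<le> T f"
  unfolding Cc_positive_def Cc_linear_def by (blast, metis order_refl)

lemma Cc_positive_mono: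
  fixes f :: "'b::t2_space \<Rightarrow> real"
  assumes "Cc_positive T" "f \<in> Cc" "h \<in> Cc" "\<And>y. f y \<le> h y"
  shows "T f \<le> T h"
  using Cc_linear_diff[OF Cc_positive_linear[OF assms(1)] assms(3,2)]
    Cc_positive_nonneg[OF assms(1), of "\<lambda>y. h y - f y"] assms(4) by simp

text \<open>Monotonicity detached from linearity: this is what additivity of
  \<open>integral_plus\<close> rests on, and it is easily verified for the Jordan parts of a
  functional.\<close>

definition Cc_mono :: "'b::topological_space functional \<Rightarrow> bool" where
  "Cc_mono T \<longleftrightarrow> (\<forall>f\<in>Cc. \<forall>h\<in>Cc. (\<forall>y. f y \<le> h y) \<longrightarrow> T f \<le> T h)"

lemma Cc_positive_imp_mono: "Cc_positive T \<Longrightarrow> Cc_mono T" for T :: "'b::t2_space functional"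
  by (simp add: Cc_mono_def Cc_positive_mono)

lemma Cc_positive_comb:
  assumes "Cc_positive T" "Cc_positive T'" "0 \<le> c" "0 \<le> d"
  shows "Cc_positive (\<lambda>f. c * T f + d * T' f)"
  using assms Cc_linear_comb[of T T' c d] by (auto simp: Cc_positive_def)

lemma Cc_positive_zero: "Cc_positive (\<lambda>_. 0)"
  by (auto simp: Cc_positive_def Cc_linear_def)

lemma radon_linear: "\<nu> \<in> radon \<Longrightarrow> Cc_linear \<nu>"
  by (auto simp: radon_def Cc_linear_def)

lemma radon_bound:
  assumes "\<nu> \<in> radon" "compact K"
  obtains M where "M > 0"
    "\<And>f c. f \<in> Cc \<Longrightarrow> (\<And>y. y \<notin> K \<Longrightarrow> f y = 0) \<Longrightarrow> (\<And>y. \<bar>f y\<bar> \<le> c) \<Longrightarrow> \<bar>\<nu> f\<bar> \<le> M * c"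
proof -
  have "\<exists>M. \<forall>f\<in>Cc. \<forall>c. (\<forall>y. y \<notin> K \<longrightarrow> f y = 0) \<longrightarrow> (\<forall>y. \<bar>f y\<bar> \<le> c) \<longrightarrow> \<bar>\<nu> f\<bar> \<le> M * c"
    using assms by (simp add: radon_def)
  then obtain M where M: "\<forall>f\<in>Cc. \<forall>c. (\<forall>y. y \<notin> K \<longrightarrow> f y = 0) \<longrightarrow> (\<forall>y. \<bar>f y\<bar> \<le> c) \<longrightarrow> \<bar>\<nu> f\<bar> \<le> M * c" ..
  show ?thesis
  proof
    show "\<bar>M\<bar> + 1 > 0" by simp
    fix f c assume f: "f \<in> Cc" "\<And>y. y \<notin> K \<Longrightarrow> f y = 0" "\<And>y. \<bar>f y\<bar> \<le> c"
    have "0 \<le> c" using f(3)[of undefined] by linarith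
    then have "M * c \<le> (\<bar>M\<bar> + 1) * c" by (intro mult_right_mono) auto
    moreover have "\<bar>\<nu> f\<bar> \<le> M * c" using M f by simp
    ultimately show "\<bar>\<nu> f\<bar> \<le> (\<bar>M\<bar> + 1) * c" by linarith
  qed
qed

lemma radon_comb:
  assumes "\<mu> \<in> radon" "\<nu> \<in> radon"
  shows "(\<lambda>f. c * \<mu> f + d * \<nu> f) \<in> radon"
proof -
  have "Cc_linear (\<lambda>f. c * \<mu> f + d * \<nu> f)"
    using assms by (intro Cc_linear_comb radon_linear)
  moreover have "\<exists>M. \<forall>f\<in>Cc. \<forall>e. (\<forall>y. y \<notin> K \<longrightarrow> f y = 0) \<longrightarrow> (\<forall>y. \<bar>f y\<bar> \<le> e) \<longrightarrow>
      \<bar>c * \<mu> f + d * \<nu> f\<bar> \<le> M * e" if K: "compact K" for K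
  proof -
    obtain M where M: "\<And>f c. f \<in> Cc \<Longrightarrow> (\<And>y. y \<notin> K \<Longrightarrow> f y = 0) \<Longrightarrow> (\<And>y. \<bar>f y\<bar> \<le> c) \<Longrightarrow> \<bar>\<mu> f\<bar> \<le> M * c"
      using radon_bound[OF assms(1) K] by metis
    obtain N where N: "\<And>f c. f \<in> Cc \<Longrightarrow> (\<And>y. y \<notin> K \<Longrightarrow> f y = 0) \<Longrightarrow> (\<And>y. \<bar>f y\<bar> \<le> c) \<Longrightarrow> \<bar>\<nu> f\<bar> \<le> N * c"
      using radon_bound[OF assms(2) K] by metis
    have "\<bar>c * \<mu> f + d * \<nu> f\<bar> \<le> (\<bar>c\<bar> * M + \<bar>d\<bar> * N) * e"
      if "f \<in> Cc" "\<forall>y. y \<notin> K \<longrightarrow> f y = 0" "\<forall>y. \<bar>f y\<bar> \<le> e" for f e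
    proof -
      have "\<bar>c * \<mu> f + d * \<nu> f\<bar> \<le> \<bar>c\<bar> * \<bar>\<mu> f\<bar> + \<bar>d\<bar> * \<bar>\<nu> f\<bar>"
        by (metis abs_mult abs_triangle_ineq)
      also have "\<dots> \<le> \<bar>c\<bar> * (M * e) + \<bar>d\<bar> * (N * e)"
        using that by (intro add_mono mult_left_mono M N) auto
      finally show ?thesis by (simp add: algebra_simps)
    qed
    then show ?thesis by blast
  qed
  ultimately show ?thesis by (simp add: radon_def Cc_linear_def)
qed

lemma radon_diff: "\<mu> \<in> radon \<Longrightarrow> \<nu> \<in> radon \<Longrightarrow> (\<lambda>f. \<mu> f - \<nu> f) \<in> radon"
  using radon_comb[of \<mu> \<nu> 1 "-1"] by simp

section \<open>Positive Radon measures\<close>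

lemma radon_plus_positive: "\<nu> \<in> radon_plus E \<Longrightarrow> Cc_positive \<nu>"
  by (auto simp: radon_plus_def Cc_positive_def radon_linear)

lemma radon_plus_radon: "\<nu> \<in> radon_plus E \<Longrightarrow> \<nu> \<in> radon"
  by (auto simp: radon_plus_def)

lemma radon_plus_off_support:
  "\<nu> \<in> radon_plus E \<Longrightarrow> f \<in> Cc \<Longrightarrow> supp f \<inter> E = {} \<Longrightarrow> \<nu> f = 0"
  by (auto simp: radon_plus_def)

lemma radon_plusI:
  assumes "\<nu> \<in> radon" "Cc_positive \<nu>"
    "\<And>f. f \<in> Cc \<Longrightarrow> supp f \<inter> E = {} \<Longrightarrow> \<nu> f = 0"
  shows "\<nu> \<in> radon_plus E"
  using assms by (auto simp: radon_plus_def Cc_positive_def)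

abbreviation positive_radon ("\<M>") where "\<M> \<equiv> radon_plus UNIV"

text \<open>A function whose support misses the whole space is zero, so for \<open>E = UNIV\<close>
  the support clause only asks for the value 0 at the zero function, which is linearity.\<close>

lemma radon_plus_UNIV_iff: "\<nu> \<in> \<M> \<longleftrightarrow> \<nu> \<in> radon \<and> Cc_positive \<nu>"
  for \<nu> :: "'b::t2_space functional"
proof -
  have "\<nu> f = 0" if "Cc_positive \<nu>" "f \<in> Cc" "supp f = {}" for f
  proof -
    have "f y = 0" for y using that(3) zero_off_support[of y f] by simp
    then have "f = (\<lambda>_. 0)" by blast
    then show ?thesis using that(1) Cc_linear_zero Cc_positive_linear by auto
  qed
  then show ?thesis
    using radon_plusI[of \<nu> UNIV] radon_plus_radon radon_plus_positive by auto
qed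

lemma radon_plus_subset_UNIV: "\<nu> \<in> radon_plus E \<Longrightarrow> \<nu> \<in> \<M>"
  for \<nu> :: "'b::t2_space functional"
  using radon_plus_UNIV_iff radon_plus_radon radon_plus_positive by blast

lemma radon_plus_comb:
  fixes \<mu> \<nu> :: "'b::t2_space functional"
  assumes "\<mu> \<in> \<M>" "\<nu> \<in> \<M>" "0 \<le> c" "0 \<le> d"
  shows "(\<lambda>f. c * \<mu> f + d * \<nu> f) \<in> \<M>"
  using assms by (auto simp: radon_plus_UNIV_iff intro!: radon_comb Cc_positive_comb)

text \<open>Positivity forces continuity: if \<open>\<phi>\<close> is a cutoff equal to 1 on
  \<open>K\<close>, a function vanishing off \<open>K\<close> and bounded by \<open>c\<close> lies
  between \<open>- c * \<phi>\<close> and \<open>c * \<phi>\<close>, so \<open>T \<phi>\<close> is a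
  constant that serves for \<open>K\<close>.\<close>

lemma Cc_positive_radon:
  fixes T :: "'b::t2_space functional"
  assumes lc: "locally_compact_space (euclidean :: 'b topology)" and T: "Cc_positive T"
  shows "T \<in> radon"
proof -
  have "\<exists>M. \<forall>f\<in>Cc. \<forall>c. (\<forall>y. y \<notin> K \<longrightarrow> f y = 0) \<longrightarrow> (\<forall>y. \<bar>f y\<bar> \<le> c) \<longrightarrow> \<bar>T f\<bar> \<le> M * c"
    if K: "compact K" for K
  proof -
    obtain \<phi> W where \<phi>: "\<phi> \<in> Cc" "\<forall>y. 0 \<le> \<phi> y \<and> \<phi> y \<le> 1" "K \<subseteq> W" "\<forall>y\<in>W. \<phi> y = 1"
      using Urysohn_Cc[OF lc K open_UNIV subset_UNIV] by auto
    have "\<bar>T f\<bar> \<le> T \<phi> * c"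
      if f: "f \<in> Cc" "\<forall>y. y \<notin> K \<longrightarrow> f y = 0" "\<forall>y. \<bar>f y\<bar> \<le> c" for f c
    proof -
      have c: "0 \<le> c" using f(3)[rule_format, of undefined] by linarith
      have b: "\<bar>f y\<bar> \<le> c * \<phi> y" for y
        using f(2,3) \<phi> c by (cases "y \<in> K") (auto simp: subset_iff)
      have c\<phi>: "(\<lambda>y. c * \<phi> y) \<in> Cc" by (rule Cc_cmult[OF \<phi>(1)])
      have "T f \<le> T (\<lambda>y. c * \<phi> y)" "T (\<lambda>y. - f y) \<le> T (\<lambda>y. c * \<phi> y)"
        using b by (auto intro!: Cc_positive_mono[OF T] f(1) Cc_uminus c\<phi> simp: abs_le_iff)
      then show ?thesis
        using Cc_linear_cmult[OF Cc_positive_linear[OF T] \<phi>(1)]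
          Cc_linear_uminus[OF Cc_positive_linear[OF T] f(1)] by (simp add: mult.commute)
    qed
    then show ?thesis by blast
  qed
  then show ?thesis
    using Cc_positive_linear[OF T] by (simp add: radon_def Cc_linear_def)
qed

section \<open>The integral of a lower semicontinuous function\<close>

text \<open>A nonnegative \<open>\<psi>\<close> has the zero function as a minorant. Otherwise the
  space is compact, finitely many of the open sets where \<open>\<psi>\<close> exceeds
  \<open>- n\<close> cover it, and a constant is a minorant lying in \<open>Cc\<close>. This keeps
  the supremum in \<open>integral_plus\<close> away from -\<infinity>.\<close>

lemma Phi_minorant:
  fixes \<psi> :: "'b::t2_space \<Rightarrow> ereal"
  assumes "\<psi> \<in> Phi"
  shows "{f \<in> Cc. \<forall>y. ereal (f y) \<le> \<psi> y} \<noteq> {}"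
proof (cases "\<forall>y. 0 \<le> \<psi> y")
  case True
  then have "(\<lambda>_. 0) \<in> {f \<in> Cc. \<forall>y. ereal (f y) \<le> \<psi> y}"
    by (simp add: Cc_zero flip: zero_ereal_def)
  then show ?thesis by blast
next
  case False
  then have cpt: "compact (UNIV :: 'b set)" using assms by (auto simp: Phi_def)
  have "UNIV \<subseteq> (\<Union>n::nat. {y. ereal (- real n) < \<psi> y})"
  proof
    fix y
    have "\<psi> y \<noteq> -\<infinity>" using assms by (auto simp: Phi_def)
    then have "\<exists>n::nat. ereal (- real n) < \<psi> y"
    proof (cases "\<psi> y")
      case (real r)
      obtain n :: nat where "- r < real n" using reals_Archimedean2 by blast
      then show ?thesis using real by (intro exI[of _ n]) simp
    qed auto
    then show "y \<in> (\<Union>n::nat. {y. ereal (- real n) < \<psi> y})" by blast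
  qed
  moreover have "open {y. ereal (- real n) < \<psi> y}" for n :: nat
    using assms by (auto simp: Phi_def)
  ultimately obtain N where N: "finite N" "UNIV \<subseteq> (\<Union>n\<in>N. {y. ereal (- real n) < \<psi> y})"
    by (metis compactE_image[OF cpt, of UNIV "\<lambda>n::nat. {y. ereal (- real n) < \<psi> y}"])
  have "ereal (- real (Max N)) \<le> \<psi> y" for y
  proof -
    obtain n where n: "n \<in> N" "ereal (- real n) < \<psi> y" using N(2) by blast
    then have "- real (Max N) \<le> - real n" using N(1) by simp
    then have "ereal (- real (Max N)) \<le> ereal (- real n)" by simp
    then show ?thesis using n(2) by order
  qed
  moreover have "(\<lambda>_. - real (Max N)) \<in> (Cc :: ('b \<Rightarrow> real) set)"
    by (rule CcI[OF _ cpt]) auto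
  ultimately show ?thesis by blast
qed

lemma integral_plus_not_MInf:
  fixes \<psi> :: "'b::t2_space \<Rightarrow> ereal"
  assumes "\<psi> \<in> Phi"
  shows "integral_plus T \<psi> \<noteq> -\<infinity>"
proof -
  obtain f where f: "f \<in> {f \<in> Cc. \<forall>y. ereal (f y) \<le> \<psi> y}"
    using Phi_minorant[OF assms] by blast
  have "ereal (T f) \<le> integral_plus T \<psi>"
    unfolding integral_plus_def by (rule SUP_upper[OF f])
  then show ?thesis by auto
qed

lemma integral_plus_upper:
  "f \<in> Cc \<Longrightarrow> (\<And>y. ereal (f y) \<le> \<psi> y) \<Longrightarrow> ereal (T f) \<le> integral_plus T \<psi>"
  unfolding integral_plus_def by (rule SUP_upper) simp

lemma integral_plus_least:
  assumes "\<And>f. f \<in> Cc \<Longrightarrow> (\<And>y. ereal (f y) \<le> \<psi> y) \<Longrightarrow> ereal (T f) \<le> u"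
  shows "integral_plus T \<psi> \<le> u"
  unfolding integral_plus_def using assms by (intro SUP_least) simp

lemma integral_plus_add:
  fixes \<psi> :: "'b::t2_space \<Rightarrow> ereal"
  assumes \<psi>: "\<psi> \<in> Phi" and T: "Cc_mono T1" "Cc_mono T2"
  shows "integral_plus (\<lambda>f. T1 f + T2 f) \<psi> = integral_plus T1 \<psi> + integral_plus T2 \<psi>"
    (is "?l = _")
proof (rule antisym)
  show "?l \<le> integral_plus T1 \<psi> + integral_plus T2 \<psi>"
  proof (rule integral_plus_least)
    fix f assume "f \<in> Cc" "\<And>y. ereal (f y) \<le> \<psi> y"
    then have "ereal (T1 f) \<le> integral_plus T1 \<psi>" "ereal (T2 f) \<le> integral_plus T2 \<psi>"
      by (auto intro: integral_plus_upper)
    then show "ereal (T1 f + T2 f) \<le> integral_plus T1 \<psi> + integral_plus T2 \<psi>"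
      using add_mono by fastforce
  qed
  let ?D = "{f \<in> Cc. \<forall>y. ereal (f y) \<le> \<psi> y}"
  \<comment> \<open>The sum becomes an iterated supremum over two independent minorants, legitimate
    since neither integral is -\<infinity>; by monotonicity the pointwise maximum, again a minorant,
    can replace both.\<close>
  have "integral_plus T1 \<psi> + integral_plus T2 \<psi>
      = (SUP f\<in>?D. ereal (T1 f) + integral_plus T2 \<psi>)"
    unfolding integral_plus_def[of T1] using Phi_minorant[OF \<psi>] integral_plus_not_MInf[OF \<psi>]
    by (intro SUP_ereal_add_left[symmetric]) auto
  also have "\<dots> = (SUP f\<in>?D. SUP h\<in>?D. ereal (T1 f) + ereal (T2 h))"
    unfolding integral_plus_def using Phi_minorant[OF \<psi>]
    by (intro SUP_cong refl SUP_ereal_add_right[symmetric]) auto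
  also have "\<dots> \<le> ?l"
  proof (intro SUP_least)
    fix f h assume fh: "f \<in> ?D" "h \<in> ?D"
    have m: "(\<lambda>y. max (f y) (h y)) \<in> Cc" using fh by (intro Cc_max) auto
    have "T1 f \<le> T1 (\<lambda>y. max (f y) (h y))" "T2 h \<le> T2 (\<lambda>y. max (f y) (h y))"
      using fh m T unfolding Cc_mono_def by auto
    then have "ereal (T1 f) + ereal (T2 h)
        \<le> ereal (T1 (\<lambda>y. max (f y) (h y)) + T2 (\<lambda>y. max (f y) (h y)))" by simp
    also have "\<dots> \<le> ?l"
      using m fh by (intro integral_plus_upper[where T="\<lambda>f. T1 f + T2 f"]) (auto simp: max_def)
    finally show "ereal (T1 f) + ereal (T2 h) \<le> ?l" .
  qed
  finally show "integral_plus T1 \<psi> + integral_plus T2 \<psi> \<le> ?l" .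
qed

lemma integral_plus_cmult:
  fixes \<psi> :: "'b::t2_space \<Rightarrow> ereal"
  assumes \<psi>: "\<psi> \<in> Phi" and c: "0 \<le> c"
  shows "integral_plus (\<lambda>f. c * T f) \<psi> = ereal c * integral_plus T \<psi>"
\<comment> \<open>For \<open>c = 0\<close> the integral may be infinite, and the product follows the
  convention 0 * \<infinity> = 0 of \<open>ereal\<close>; for positive \<open>c\<close> one
  divides.\<close>
proof (cases "c = 0")
  case True
  then show ?thesis using Phi_minorant[OF \<psi>] by (simp add: integral_plus_def flip: zero_ereal_def)
next
  case False
  with c have c: "c > 0" by simp
  show ?thesis
  proof (rule antisym)
    show "integral_plus (\<lambda>f. c * T f) \<psi> \<le> ereal c * integral_plus T \<psi>"
    proof (rule integral_plus_least)
      fix f assume "f \<in> Cc" "\<And>y. ereal (f y) \<le> \<psi> y"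
      then have "ereal (T f) \<le> integral_plus T \<psi>" by (rule integral_plus_upper)
      then have "ereal c * ereal (T f) \<le> ereal c * integral_plus T \<psi>"
        using c by (intro ereal_mult_left_mono) auto
      then show "ereal (c * T f) \<le> ereal c * integral_plus T \<psi>" by simp
    qed
    have "integral_plus T \<psi> \<le> integral_plus (\<lambda>f. c * T f) \<psi> / ereal c"
    proof (rule integral_plus_least)
      fix f assume "f \<in> Cc" "\<And>y. ereal (f y) \<le> \<psi> y"
      then have "ereal (c * T f) \<le> integral_plus (\<lambda>f. c * T f) \<psi>"
        by (rule integral_plus_upper[where T="\<lambda>f. c * T f"])
      then show "ereal (T f) \<le> integral_plus (\<lambda>f. c * T f) \<psi> / ereal c"
        using c by (subst ereal_le_divide_pos) auto
    qed
    then show "ereal c * integral_plus T \<psi> \<le> integral_plus (\<lambda>f. c * T f) \<psi>"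
      using c by (subst (asm) ereal_le_divide_pos) auto
  qed
qed

lemma integral_plus_zero:
  fixes \<psi> :: "'b::t2_space \<Rightarrow> ereal"
  assumes "\<psi> \<in> Phi"
  shows "integral_plus (\<lambda>_. 0) \<psi> = 0"
  using integral_plus_cmult[OF assms, of 0 "\<lambda>_. 0"] by (simp flip: zero_ereal_def)

section \<open>Jordan decomposition of a difference of positive functionals\<close>

context
  fixes Tp Tn T :: "'b::t2_space functional"
  assumes Tp: "Cc_positive Tp" and Tn: "Cc_positive Tn" and T: "T = (\<lambda>f. Tp f - Tn f)"
begin

text \<open>F. Riesz's formula for the positive part, on nonnegative \<open>u\<close>. The
  domination by \<open>Tp\<close> bounds the set by \<open>Tp u\<close>, so the real
  \<open>Sup\<close> is a genuine supremum there.\<close>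

private definition "p u = Sup {T h | h. h \<in> Cc \<and> (\<forall>y. 0 \<le> h y \<and> h y \<le> u y)}"

private lemma linT: "Cc_linear T"
  using Cc_linear_comb[OF Cc_positive_linear[OF Tp] Cc_positive_linear[OF Tn], of 1 "-1"]
  by (simp add: T)

private lemma T_le:
  assumes "u \<in> Cc" "h \<in> Cc" "\<And>y. 0 \<le> h y" "\<And>y. h y \<le> u y"
  shows "T h \<le> Tp u"
  using Cc_positive_mono[OF Tp assms(2,1,4)] Cc_positive_nonneg[OF Tn, of h] assms(3)
  by (simp add: T)

private lemma p_upper:
  assumes "u \<in> Cc" "h \<in> Cc" "\<And>y. 0 \<le> h y" "\<And>y. h y \<le> u y"
  shows "T h \<le> p u"
  unfolding p_def
proof (rule cSup_upper)
  show "bdd_above {T h | h. h \<in> Cc \<and> (\<forall>y. 0 \<le> h y \<and> h y \<le> u y)}"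
    by (rule bdd_aboveI[of _ "Tp u"]) (use T_le[OF assms(1)] in auto)
qed (use assms in auto)

private lemma p_least:
  assumes "\<And>y. 0 \<le> u y"
    and "\<And>h. h \<in> Cc \<Longrightarrow> (\<And>y. 0 \<le> h y) \<Longrightarrow> (\<And>y. h y \<le> u y) \<Longrightarrow> T h \<le> c"
  shows "p u \<le> c"
  unfolding p_def
proof (rule cSup_least)
  have "T (\<lambda>_. 0) \<in> {T h | h. h \<in> Cc \<and> (\<forall>y. 0 \<le> h y \<and> h y \<le> u y)}"
    using assms(1) Cc_zero by auto
  then show "{T h | h. h \<in> Cc \<and> (\<forall>y. 0 \<le> h y \<and> h y \<le> u y)} \<noteq> {}" by blast
qed (use assms(2) in auto)

private lemma p_add:
  assumes u: "u \<in> Cc" "\<And>y. 0 \<le> u y" and v: "v \<in> Cc" "\<And>y. 0 \<le> v y"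
  shows "p (\<lambda>y. u y + v y) = p u + p v"
proof (rule antisym)
  show "p (\<lambda>y. u y + v y) \<le> p u + p v"
  proof (rule p_least)
    fix h assume h: "h \<in> Cc" "\<And>y. 0 \<le> h y" "\<And>y. h y \<le> u y + v y"
    \<comment> \<open>The Riesz decomposition property: a function below \<open>u + v\<close> splits
      into a part below \<open>u\<close> and a remainder below \<open>v\<close>, both in
      \<open>Cc\<close>.\<close>
    let ?a = "\<lambda>y. min (h y) (u y)" and ?b = "\<lambda>y. h y - min (h y) (u y)"
    have ab: "?a \<in> Cc" "?b \<in> Cc" using h(1) u(1) by (auto intro: Cc_min Cc_diff)
    have "T h = T ?a + T ?b" using Cc_linear_add[OF linT ab] by simp
    moreover have "T ?a \<le> p u" using h u by (intro p_upper ab) auto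
    moreover have "T ?b \<le> p v"
    proof (rule p_upper[OF v(1) ab(2)])
      show "?b y \<le> v y" for y using h(3)[of y] v(2)[of y] by (auto simp: min_def)
    qed simp
    ultimately show "T h \<le> p u + p v" by simp
  qed (use u v in simp)
  have "p u \<le> p (\<lambda>y. u y + v y) - p v"
  proof (rule p_least[OF u(2)])
    fix h assume h: "h \<in> Cc" "\<And>y. 0 \<le> h y" "\<And>y. h y \<le> u y"
    have "p v \<le> p (\<lambda>y. u y + v y) - T h"
    proof (rule p_least[OF v(2)])
      fix k assume k: "k \<in> Cc" "\<And>y. 0 \<le> k y" "\<And>y. k y \<le> v y"
      have "T (\<lambda>y. h y + k y) \<le> p (\<lambda>y. u y + v y)"
        using h k by (intro p_upper Cc_add u(1) v(1)) (auto intro: add_mono)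
      then show "T k \<le> p (\<lambda>y. u y + v y) - T h"
        using Cc_linear_add[OF linT h(1) k(1)] by simp
    qed
    then show "T h \<le> p (\<lambda>y. u y + v y) - p v" by simp
  qed
  then show "p u + p v \<le> p (\<lambda>y. u y + v y)" by simp
qed

private lemma p_zero: "p (\<lambda>_. 0) = 0"
  using p_add[OF Cc_zero _ Cc_zero] by simp

text \<open>\<open>pos_part\<close> is defined through the decomposition of a function into its own
  positive and negative parts. Any other decomposition \<open>u - v\<close> gives the same value:
  moving the subtracted terms to the other side yields two equal sums of nonnegative functions, on
  which \<open>p\<close> is additive.\<close>

private lemma pos_part_diff:
  assumes u: "u \<in> Cc" "\<And>y. 0 \<le> u y" and v: "v \<in> Cc" "\<And>y. 0 \<le> v y"
  shows "pos_part T (\<lambda>y. u y - v y) = p u - p v"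
proof -
  let ?f = "\<lambda>y. u y - v y"
  have f: "?f \<in> Cc" "(\<lambda>y. - ?f y) \<in> Cc" using u v by (auto intro: Cc_diff)
  let ?a = "\<lambda>y. max (?f y) 0" and ?b = "\<lambda>y. max (- ?f y) 0"
  have ab: "?a \<in> Cc" "?b \<in> Cc" using Cc_max_zero[OF f(1)] Cc_max_zero[OF f(2)] by auto
  have eq: "(\<lambda>y. ?a y + v y) = (\<lambda>y. ?b y + u y)" by (auto simp: max_def)
  have "p ?a + p v = p ?b + p u"
    using p_add[OF ab(1) _ v] p_add[OF ab(2) _ u] unfolding eq by simp
  moreover have "pos_part T ?f = p ?a - p ?b" using f(1) by (simp add: pos_part_def p_def)
  ultimately show ?thesis by simp
qed

private lemma pos_part_nonneg: "u \<in> Cc \<Longrightarrow> (\<And>y. 0 \<le> u y) \<Longrightarrow> pos_part T u = p u"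
  using pos_part_diff[OF _ _ Cc_zero, of u] p_zero by simp

text \<open>The positive part of a sum is not the sum of positive parts, but the summed positive and
  summed negative parts still decompose \<open>f + h\<close>, and \<open>pos_part_diff\<close>
  accepts every decomposition.\<close>

lemma pos_part_add:
  assumes fh: "f \<in> Cc" "h \<in> Cc"
  shows "pos_part T (\<lambda>y. f y + h y) = pos_part T f + pos_part T h"
proof -
  let ?P = "\<lambda>f y. max (f y) (0::real)" and ?N = "\<lambda>f y. max (- f y) (0::real)"
  have c: "?P f \<in> Cc" "?N f \<in> Cc" "?P h \<in> Cc" "?N h \<in> Cc"
    using fh by (auto intro: Cc_max_zero Cc_uminus)
  have "pos_part T (\<lambda>y. (?P f y + ?P h y) - (?N f y + ?N h y))
      = p (\<lambda>y. ?P f y + ?P h y) - p (\<lambda>y. ?N f y + ?N h y)"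
    by (rule pos_part_diff) (auto intro: Cc_add c)
  also have "(\<lambda>y. (?P f y + ?P h y) - (?N f y + ?N h y)) = (\<lambda>y. f y + h y)"
    by (auto simp: max_def)
  also have "p (\<lambda>y. ?P f y + ?P h y) - p (\<lambda>y. ?N f y + ?N h y)
      = (p (?P f) - p (?N f)) + (p (?P h) - p (?N h))"
    using p_add[OF c(1) _ c(3)] p_add[OF c(2) _ c(4)] by simp
  also have "\<dots> = pos_part T f + pos_part T h" using fh by (simp add: pos_part_def p_def)
  finally show ?thesis .
qed

text \<open>Applied to the nonnegative difference of the two functions, the claims amount to
  \<open>0 \<le> p u\<close> and \<open>p u \<le> Tp u\<close>. The second functional is the excess
  of \<open>Tp\<close> over the positive part, which cancels in
  \<open>integral_signed_diff\<close>.\<close>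

lemma pos_part_mono: "Cc_mono (pos_part T)" "Cc_mono (\<lambda>f. Tp f - pos_part T f)"
proof -
  have "pos_part T f \<le> pos_part T h \<and> Tp f - pos_part T f \<le> Tp h - pos_part T h"
    if fh: "f \<in> Cc" "h \<in> Cc" "\<forall>y. f y \<le> h y" for f h
  proof -
    let ?u = "\<lambda>y. h y - f y"
    have u: "?u \<in> Cc" "\<And>y. 0 \<le> ?u y" using fh by (auto intro: Cc_diff)
    have "0 \<le> p ?u" using p_upper[OF u(1) Cc_zero _ u(2)] Cc_linear_zero[OF linT] by simp
    moreover have "p ?u \<le> Tp h - Tp f"
      using T_le[OF u(1)] Cc_linear_diff[OF Cc_positive_linear[OF Tp] fh(2,1)] u(2) by (intro p_least) auto
    moreover have "pos_part T h = pos_part T f + p ?u"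
      using pos_part_add[OF fh(1) u(1)] pos_part_nonneg[OF u] by simp
    ultimately show ?thesis by simp
  qed
  then show "Cc_mono (pos_part T)" "Cc_mono (\<lambda>f. Tp f - pos_part T f)"
    by (simp_all add: Cc_mono_def)
qed

lemma pos_part_nonneg_upper:
  assumes "u \<in> Cc" "h \<in> Cc" "\<And>y. 0 \<le> h y" "\<And>y. h y \<le> u y"
  shows "T h \<le> pos_part T u"
  using p_upper[OF assms] pos_part_nonneg[OF assms(1)] assms(3,4) order_trans by metis

lemma pos_part_nonneg_least:
  assumes "u \<in> Cc" "\<And>y. 0 \<le> u y"
    and "\<And>h. h \<in> Cc \<Longrightarrow> (\<And>y. 0 \<le> h y) \<Longrightarrow> (\<And>y. h y \<le> u y) \<Longrightarrow> T h \<le> c"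
  shows "pos_part T u \<le> c"
  using p_least[of u c] pos_part_nonneg[OF assms(1,2)] assms by simp

end

text \<open>The reflection of the order interval [0, u] that sends \<open>h\<close> to
  \<open>u - h\<close> turns the values of \<open>- T\<close> into those of \<open>T\<close> lowered
  by \<open>T u\<close>, so the two suprema differ by exactly \<open>T u\<close>.\<close>

lemma neg_part_eq:
  fixes Tp Tn T :: "'b::t2_space functional"
  assumes Tp: "Cc_positive Tp" and Tn: "Cc_positive Tn" and T: "T = (\<lambda>f. Tp f - Tn f)"
  shows "neg_part T = (\<lambda>f. pos_part T f - T f)"
proof -
  define T' where "T' = (\<lambda>f. - T f)"
  have T': "T' = (\<lambda>f. Tn f - Tp f)" by (simp add: T'_def T)
  note P = Tp Tn T and N = Tn Tp T'
  have linT: "Cc_linear T"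
    using Cc_linear_comb[OF Cc_positive_linear[OF Tp] Cc_positive_linear[OF Tn], of 1 "-1"]
    by (simp add: T)
  have nn: "pos_part T' u = pos_part T u - T u" if u: "u \<in> Cc" "\<And>y. 0 \<le> u y" for u
  proof (rule antisym)
    show "pos_part T' u \<le> pos_part T u - T u"
    proof (rule pos_part_nonneg_least[OF N u])
      fix h assume h: "h \<in> Cc" "\<And>y. 0 \<le> h y" "\<And>y. h y \<le> u y"
      have "T (\<lambda>y. u y - h y) \<le> pos_part T u"
        using h u by (intro pos_part_nonneg_upper[OF P] Cc_diff) auto
      then show "T' h \<le> pos_part T u - T u"
        using Cc_linear_diff[OF linT u(1) h(1)] by (simp add: T'_def)
    qed
    have "pos_part T u \<le> pos_part T' u + T u"
    proof (rule pos_part_nonneg_least[OF P u])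
      fix h assume h: "h \<in> Cc" "\<And>y. 0 \<le> h y" "\<And>y. h y \<le> u y"
      have "T' (\<lambda>y. u y - h y) \<le> pos_part T' u"
        using h u by (intro pos_part_nonneg_upper[OF N] Cc_diff) auto
      then show "T h \<le> pos_part T' u + T u"
        using Cc_linear_diff[OF linT u(1) h(1)] by (simp add: T'_def)
    qed
    then show "pos_part T u - T u \<le> pos_part T' u" by simp
  qed
  have "pos_part T' f = pos_part T f - T f" for f
  proof (cases "f \<in> Cc")
    case True
    let ?a = "\<lambda>y. max (f y) 0" and ?b = "\<lambda>y. max (- f y) 0"
    have ab: "?a \<in> Cc" "?b \<in> Cc" using True by (auto intro: Cc_max_zero Cc_uminus)
    \<comment> \<open>Adding its negative part makes \<open>f\<close> nonnegative, and additivity of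
      both positive parts reduces the claim to \<open>nn\<close>.\<close>
    have "(\<lambda>y. f y + ?b y) = ?a" by (auto simp: max_def)
    then show ?thesis
      using pos_part_add[OF P True ab(2)] pos_part_add[OF N True ab(2)] nn[OF ab(1)] nn[OF ab(2)]
        Cc_linear_add[OF linT True ab(2)] by simp
  next
    case False
    then show ?thesis using Cc_linear_off[OF linT] by (simp add: pos_part_def)
  qed
  then show ?thesis by (auto simp: neg_part_def T'_def)
qed

text \<open>The Jordan decomposition of \<open>T = Tp - Tn\<close> is never computed: \<open>Tp\<close> and \<open>Tn\<close> exceed
  the positive and the negative part by the same positive functional, whose integral cancels.\<close>

lemma integral_signed_diff:
  fixes \<psi> :: "'b::t2_space \<Rightarrow> ereal"
  assumes \<psi>: "\<psi> \<in> Phi" and Tp: "Cc_positive Tp" and Tn: "Cc_positive Tn"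
    and T: "T = (\<lambda>f. Tp f - Tn f)"
    and fin: "integral_plus Tp \<psi> \<noteq> \<infinity> \<or> integral_plus Tn \<psi> \<noteq> \<infinity>"
  shows "integral_defined T \<psi>"
    "integral_signed T \<psi> = integral_plus Tp \<psi> - integral_plus Tn \<psi>"
proof -
  note P = Tp Tn T
  define R where "R = (\<lambda>f. Tp f - pos_part T f)"
  have pos: "Cc_mono R" "Cc_mono (pos_part T)"
    unfolding R_def by (rule pos_part_mono[OF P])+
  have neg: "Cc_mono (neg_part T)"
    unfolding neg_part_def by (rule pos_part_mono(1)[OF Tn Tp]) (simp add: T)
  have "Tp = (\<lambda>f. pos_part T f + R f)" "Tn = (\<lambda>f. neg_part T f + R f)"
    by (auto simp: R_def neg_part_eq[OF P]) (auto simp: T)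
  then have e: "integral_plus Tp \<psi> = integral_plus (pos_part T) \<psi> + integral_plus R \<psi>"
      "integral_plus Tn \<psi> = integral_plus (neg_part T) \<psi> + integral_plus R \<psi>"
    using integral_plus_add[OF \<psi> pos(2,1)] integral_plus_add[OF \<psi> neg pos(1)] by auto
  have n: "integral_plus L \<psi> \<noteq> -\<infinity>" for L by (rule integral_plus_not_MInf[OF \<psi>])
  show "integral_defined T \<psi>" using fin e by (auto simp: integral_defined_def)
  \<comment> \<open>Finiteness of one of the two integrals makes that of \<open>R\<close> finite, so
    it cancels in \<open>ereal\<close> even if the other integral is infinite.\<close>
  show "integral_signed T \<psi> = integral_plus Tp \<psi> - integral_plus Tn \<psi>"
    using fin n[of R] n[of "pos_part T"] n[of "neg_part T"] unfolding e integral_signed_def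
    by (cases "integral_plus (pos_part T) \<psi>"; cases "integral_plus (neg_part T) \<psi>";
        cases "integral_plus R \<psi>") auto
qed

section \<open>Products of Radon measures\<close>

lemma Cc_slice:
  fixes F :: "'b::t2_space \<times> 'c::t2_space \<Rightarrow> real"
  assumes "F \<in> Cc"
  shows "(\<lambda>y. F (x, y)) \<in> Cc"
proof (rule CcI)
  show "continuous_on UNIV (\<lambda>y. F (x, y))"
    by (rule continuous_on_compose2[OF Cc_continuous[OF assms]]) (auto intro: continuous_intros)
  show "compact (snd ` supp F)"
    by (intro compact_continuous_image Cc_compact_support assms continuous_intros)
  show "F (x, y) = 0" if "y \<notin> snd ` supp F" for y
    using that by (intro zero_off_support) force
qed

text \<open>The support of \<open>F\<close> lies over a compact projection \<open>K\<close>, so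
  continuity in \<open>x\<close> is uniform in \<open>y\<close>, and the bound \<open>M\<close> of
  \<open>\<nu>\<close> on \<open>K\<close> transfers it to the integral. The tolerance
  \<open>e / (2 * M)\<close> leads to \<open>e / 2\<close>, strictly below \<open>e\<close>.\<close>

lemma Cc_partial_integral:
  fixes F :: "'b::t2_space \<times> 'c::t2_space \<Rightarrow> real"
  assumes F: "F \<in> Cc" and \<nu>: "\<nu> \<in> radon"
  shows "(\<lambda>x. \<nu> (\<lambda>y. F (x, y))) \<in> Cc"
proof (rule CcI)
  define K where "K = snd ` supp F"
  have K: "compact K"
    unfolding K_def by (intro compact_continuous_image Cc_compact_support F continuous_intros)
  have offK: "F (x, y) = 0" if "y \<notin> K" for x y
    using that unfolding K_def by (intro zero_off_support) force
  obtain M where M: "M > 0"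
    "\<And>f c. f \<in> Cc \<Longrightarrow> (\<And>y. y \<notin> K \<Longrightarrow> f y = 0) \<Longrightarrow> (\<And>y. \<bar>f y\<bar> \<le> c) \<Longrightarrow> \<bar>\<nu> f\<bar> \<le> M * c"
    using radon_bound[OF \<nu> K] by metis
  show "continuous_on UNIV (\<lambda>x. \<nu> (\<lambda>y. F (x, y)))"
  proof (intro continuous_at_imp_continuous_on ballI)
    fix x0 :: 'b
    show "isCont (\<lambda>x. \<nu> (\<lambda>y. F (x, y))) x0"
      unfolding continuous_at tendsto_iff
    proof (intro allI impI)
      fix e :: real assume e: "e > 0"
      have "continuous_on (UNIV \<times> K) F" using Cc_continuous[OF F] continuous_on_subset by blast
      moreover have "e / (2 * M) > 0" using e M(1) by simp
      ultimately obtain X0 where X0: "x0 \<in> X0" "open X0"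
        "\<forall>x\<in>X0 \<inter> UNIV. \<forall>t\<in>K. dist (F (x, t)) (F (x0, t)) \<le> e / (2 * M)"
        using continuous_on_prod_compactE[OF _ K UNIV_I] by metis
      have "dist (\<nu> (\<lambda>y. F (x, y))) (\<nu> (\<lambda>y. F (x0, y))) < e" if x: "x \<in> X0" for x
      proof -
        have s: "(\<lambda>y. F (x, y)) \<in> Cc" "(\<lambda>y. F (x0, y)) \<in> Cc" by (rule Cc_slice[OF F])+
        have "\<bar>F (x, y) - F (x0, y)\<bar> \<le> e / (2 * M)" for y
          using X0(3) x offK e M(1) by (cases "y \<in> K") (auto simp: dist_real_def)
        then have "\<bar>\<nu> (\<lambda>y. F (x, y) - F (x0, y))\<bar> \<le> M * (e / (2 * M))"
          using offK by (intro M(2) Cc_diff s) auto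
        also have "\<dots> < e" using e M(1) by simp
        finally show ?thesis
          using Cc_linear_diff[OF radon_linear[OF \<nu>] s] by (simp add: dist_real_def)
      qed
      then show "\<forall>\<^sub>F x in at x0. dist (\<nu> (\<lambda>y. F (x, y))) (\<nu> (\<lambda>y. F (x0, y))) < e"
        using X0(1,2) eventually_at_topological by blast
    qed
  qed
  show "compact (fst ` supp F)"
    by (intro compact_continuous_image Cc_compact_support F continuous_intros)
  fix x assume "x \<notin> fst ` supp F"
  then have "F (x, y) = 0" for y by (intro zero_off_support) force
  then show "\<nu> (\<lambda>y. F (x, y)) = 0" using Cc_linear_zero[OF radon_linear[OF \<nu>]] by simp
qed

lemma tensor_linear:
  fixes \<mu> :: "'b::t2_space functional" and \<nu> :: "'c::t2_space functional"
  assumes "\<mu> \<in> radon" "\<nu> \<in> radon"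
  shows "Cc_linear (tensor \<mu> \<nu>)"
  unfolding Cc_linear_def
proof (intro conjI allI ballI impI)
  note L = radon_linear[OF assms(1)] radon_linear[OF assms(2)]
  show "tensor \<mu> \<nu> F = 0" if "F \<notin> Cc" for F using that by (simp add: tensor_def)
  show "tensor \<mu> \<nu> (\<lambda>z. F z + G z) = tensor \<mu> \<nu> F + tensor \<mu> \<nu> G" if "F \<in> Cc" "G \<in> Cc" for F G
    using that Cc_linear_add[OF L(2) Cc_slice[OF that(1)] Cc_slice[OF that(2)]]
      Cc_linear_add[OF L(1) Cc_partial_integral[OF that(1) assms(2)] Cc_partial_integral[OF that(2) assms(2)]]
    by (simp add: tensor_def Cc_add)
  show "tensor \<mu> \<nu> (\<lambda>z. c * F z) = c * tensor \<mu> \<nu> F" if "F \<in> Cc" for F c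
    using that Cc_linear_cmult[OF L(2) Cc_slice[OF that]]
      Cc_linear_cmult[OF L(1) Cc_partial_integral[OF that assms(2)]]
    by (simp add: tensor_def Cc_cmult)
qed

lemma tensor_positive:
  fixes \<mu> :: "'b::t2_space functional" and \<nu> :: "'c::t2_space functional"
  assumes "\<mu> \<in> radon_plus E" "\<nu> \<in> radon_plus E'"
  shows "Cc_positive (tensor \<mu> \<nu>)"
  unfolding Cc_positive_def
  using tensor_linear[OF radon_plus_radon[OF assms(1)] radon_plus_radon[OF assms(2)]]
    Cc_positive_nonneg[OF radon_plus_positive[OF assms(1)]]
    Cc_positive_nonneg[OF radon_plus_positive[OF assms(2)]]
  by (simp add: tensor_def)

lemma tensor_comb_left:
  "tensor (\<lambda>f. c * \<mu> f + d * \<mu>' f) \<nu> = (\<lambda>F. c * tensor \<mu> \<nu> F + d * tensor \<mu>' \<nu> F)"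
  by (auto simp: tensor_def)

lemma tensor_comb_right:
  fixes \<mu> :: "'b::t2_space functional" and \<nu> \<nu>' :: "'c::t2_space functional"
  assumes \<mu>: "Cc_linear \<mu>" and \<nu>: "\<nu> \<in> radon" "\<nu>' \<in> radon"
  shows "tensor \<mu> (\<lambda>f. c * \<nu> f + d * \<nu>' f) = (\<lambda>F. c * tensor \<mu> \<nu> F + d * tensor \<mu> \<nu>' F)"
proof
  fix F :: "'b \<times> 'c \<Rightarrow> real"
  show "tensor \<mu> (\<lambda>f. c * \<nu> f + d * \<nu>' f) F = c * tensor \<mu> \<nu> F + d * tensor \<mu> \<nu>' F"
  proof (cases "F \<in> Cc")
    case True
    note p = Cc_partial_integral[OF True \<nu>(1)] Cc_partial_integral[OF True \<nu>(2)]
    show ?thesis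
      using True Cc_linear_add[OF \<mu> Cc_cmult[OF p(1)] Cc_cmult[OF p(2)], of c d]
        Cc_linear_cmult[OF \<mu> p(1)] Cc_linear_cmult[OF \<mu> p(2)]
      by (simp add: tensor_def)
  qed (simp add: tensor_def)
qed

section \<open>The pre-Hilbert space of differences of positive measures of finite energy\<close>

locale pd_kernel =
  fixes \<kappa> :: "'a::t2_space \<times> 'a \<Rightarrow> ereal"
  assumes Phi: "\<kappa> \<in> Phi" and pd: "positive_definite \<kappa>"
begin

abbreviation energy_cone ("\<E>") where "\<E> \<equiv> energy_plus \<kappa>"

abbreviation nrm :: "'a functional \<Rightarrow> real" where "nrm \<equiv> energy_norm \<kappa>"

text \<open>For positive measures this coincides with \<open>mutual\<close> (see
  \<open>mutual_positive\<close>), but as a single supremum without a Jordan decomposition.\<close>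

definition mutual_plus :: "'a functional \<Rightarrow> 'a functional \<Rightarrow> ereal" where
  "mutual_plus \<mu> \<nu> = integral_plus (tensor \<mu> \<nu>) \<kappa>"

text \<open>\<open>real_of_ereal\<close> sends infinite values to 0, so this is the mutual energy
  only where that is finite, as for arguments in \<open>energy_diff\<close>.\<close>

definition energy_form :: "'a functional \<Rightarrow> 'a functional \<Rightarrow> real" where
  "energy_form \<sigma> \<tau> = real_of_ereal (mutual \<kappa> \<sigma> \<tau>)"

lemma mutual_plus_not_MInf: "mutual_plus \<mu> \<nu> \<noteq> -\<infinity>"
  unfolding mutual_plus_def by (rule integral_plus_not_MInf[OF Phi])

lemma integral_plus_comb:
  assumes "Cc_positive T" "Cc_positive T'" "0 \<le> c" "0 \<le> d"
  shows "integral_plus (\<lambda>F. c * T F + d * T' F) \<kappa>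
    = ereal c * integral_plus T \<kappa> + ereal d * integral_plus T' \<kappa>"
proof -
  have "Cc_positive (\<lambda>F. c * T F)" and "Cc_positive (\<lambda>F. d * T' F)"
    using Cc_positive_comb[OF assms(1) Cc_positive_zero, of c 0] assms
      Cc_positive_comb[OF assms(2) Cc_positive_zero, of d 0] by simp_all
  then have "Cc_mono (\<lambda>F. c * T F)" "Cc_mono (\<lambda>F. d * T' F)" by (auto intro: Cc_positive_imp_mono)
  from integral_plus_add[OF Phi this] show ?thesis using integral_plus_cmult[OF Phi] assms by simp
qed

lemma mutual_plus_comb_left:
  assumes "\<mu> \<in> \<M>" "\<mu>' \<in> \<M>" "\<nu> \<in> \<M>" "0 \<le> c" "0 \<le> d"
  shows "mutual_plus (\<lambda>f. c * \<mu> f + d * \<mu>' f) \<nu>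
    = ereal c * mutual_plus \<mu> \<nu> + ereal d * mutual_plus \<mu>' \<nu>"
  using assms unfolding mutual_plus_def tensor_comb_left
  by (intro integral_plus_comb tensor_positive)

lemma mutual_plus_comb_right:
  assumes "\<mu> \<in> \<M>" "\<nu> \<in> \<M>" "\<nu>' \<in> \<M>" "0 \<le> c" "0 \<le> d"
  shows "mutual_plus \<mu> (\<lambda>f. c * \<nu> f + d * \<nu>' f)
    = ereal c * mutual_plus \<mu> \<nu> + ereal d * mutual_plus \<mu> \<nu>'"
proof -
  have "Cc_linear \<mu>" "\<nu> \<in> radon" "\<nu>' \<in> radon"
    using assms by (auto intro: radon_linear radon_plus_radon)
  then have "tensor \<mu> (\<lambda>f. c * \<nu> f + d * \<nu>' f) = (\<lambda>F. c * tensor \<mu> \<nu> F + d * tensor \<mu> \<nu>' F)"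
    by (rule tensor_comb_right)
  then show ?thesis
    unfolding mutual_plus_def using assms by (simp add: integral_plus_comb tensor_positive)
qed

lemma mutual_positive:
  assumes "\<mu> \<in> \<M>" "\<nu> \<in> \<M>"
  shows "mutual_defined \<kappa> \<mu> \<nu>" "mutual \<kappa> \<mu> \<nu> = mutual_plus \<mu> \<nu>"
proof -
  have "integral_plus (\<lambda>_. 0) \<kappa> = 0" by (rule integral_plus_zero[OF Phi])
  then show "mutual_defined \<kappa> \<mu> \<nu>" "mutual \<kappa> \<mu> \<nu> = mutual_plus \<mu> \<nu>"
    using integral_signed_diff[OF Phi tensor_positive[OF assms] Cc_positive_zero]
    unfolding mutual_defined_def mutual_def mutual_plus_def by simp_all
qed

text \<open>The tensor product of two differences is \<open>PP' + NN'\<close> minus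
  \<open>PN' + NP'\<close>, a difference of positive functionals. Finiteness is asked of the first
  sum only, because \<open>mutual_plus_finite\<close> applies the lemma before the cross energies
  are known to be finite.\<close>

lemma mutual_diff:
  assumes M: "P \<in> \<M>" "N \<in> \<M>" "P' \<in> \<M>" "N' \<in> \<M>"
    and fin: "mutual_plus P P' + mutual_plus N N' \<noteq> \<infinity>"
  shows "mutual_defined \<kappa> (\<lambda>f. P f - N f) (\<lambda>f. P' f - N' f)"
    "mutual \<kappa> (\<lambda>f. P f - N f) (\<lambda>f. P' f - N' f)
       = mutual_plus P P' + mutual_plus N N' - (mutual_plus P N' + mutual_plus N P')"
proof -
  define Tp where "Tp = (\<lambda>F. 1 * tensor P P' F + 1 * tensor N N' F)"
  define Tn where "Tn = (\<lambda>F. 1 * tensor P N' F + 1 * tensor N P' F)"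
  have pos: "Cc_positive Tp" "Cc_positive Tn"
    unfolding Tp_def Tn_def
    by (intro Cc_positive_comb tensor_positive[where E=UNIV and E'=UNIV]; use M in simp)+
  have "tensor P (\<lambda>f. 1 * P' f + - 1 * N' f) = (\<lambda>F. 1 * tensor P P' F + - 1 * tensor P N' F)"
    "tensor N (\<lambda>f. 1 * P' f + - 1 * N' f) = (\<lambda>F. 1 * tensor N P' F + - 1 * tensor N N' F)"
    by (intro tensor_comb_right radon_linear radon_plus_radon[of _ UNIV] M)+
  then have T: "tensor (\<lambda>f. P f - N f) (\<lambda>f. P' f - N' f) = (\<lambda>F. Tp F - Tn F)"
    using tensor_comb_left[of 1 P "-1" N "\<lambda>f. P' f - N' f"] by (auto simp: Tp_def Tn_def)
  have i: "integral_plus Tp \<kappa> = mutual_plus P P' + mutual_plus N N'"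
    "integral_plus Tn \<kappa> = mutual_plus P N' + mutual_plus N P'"
    unfolding Tp_def Tn_def mutual_plus_def using M
    by (subst integral_plus_comb; simp add: tensor_positive flip: one_ereal_def)+
  show "mutual_defined \<kappa> (\<lambda>f. P f - N f) (\<lambda>f. P' f - N' f)"
    "mutual \<kappa> (\<lambda>f. P f - N f) (\<lambda>f. P' f - N' f)
       = mutual_plus P P' + mutual_plus N N' - (mutual_plus P N' + mutual_plus N P')"
    using integral_signed_diff[OF Phi pos T] fin
    unfolding mutual_defined_def mutual_def i by auto
qed

section \<open>The cone of positive measures of finite energy\<close>

lemma energy_plus_iff:
  "\<mu> \<in> \<E> \<longleftrightarrow> \<mu> \<in> \<M> \<and> mutual_plus \<mu> \<mu> \<noteq> \<infinity>"
  using mutual_positive[of \<mu> \<mu>] mutual_plus_not_MInf[of \<mu> \<mu>] radon_plus_radon[of \<mu> UNIV]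
  by (auto simp: energy_plus_def energy_space_def)

lemma energy_plus_radon_plus: "\<mu> \<in> \<E> \<Longrightarrow> \<mu> \<in> \<M>"
  by (simp add: energy_plus_iff)

text \<open>Were the mutual energy infinite, the energy of \<open>\<mu> - \<nu>\<close> would be
  defined and equal to -\<infinity>: the self-energies are finite, and the cross terms enter with a
  minus sign.\<close>

lemma mutual_plus_finite:
  assumes "\<mu> \<in> \<E>" "\<nu> \<in> \<E>"
  shows "mutual_plus \<mu> \<nu> \<noteq> \<infinity>"
proof
  assume inf: "mutual_plus \<mu> \<nu> = \<infinity>"
  have M: "\<mu> \<in> \<M>" "\<nu> \<in> \<M>"
    and fin: "mutual_plus \<mu> \<mu> \<noteq> \<infinity>" "mutual_plus \<nu> \<nu> \<noteq> \<infinity>"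
    using assms by (auto simp: energy_plus_iff)
  then have s: "mutual_plus \<mu> \<mu> + mutual_plus \<nu> \<nu> \<noteq> \<infinity>" by simp
  have "(\<lambda>f. \<mu> f - \<nu> f) \<in> radon" using M by (intro radon_diff radon_plus_radon)
  then have "0 \<le> mutual \<kappa> (\<lambda>f. \<mu> f - \<nu> f) (\<lambda>f. \<mu> f - \<nu> f)"
    using pd mutual_diff(1)[OF M M s] by (simp add: positive_definite_def)
  then show False
    using mutual_diff(2)[OF M M s] inf fin mutual_plus_not_MInf[of \<nu> \<mu>]
    by (cases "mutual_plus \<mu> \<mu>"; cases "mutual_plus \<nu> \<nu>"; cases "mutual_plus \<nu> \<mu>") auto
qed

lemma mutual_plus_eq:
  assumes "\<mu> \<in> \<E>" "\<nu> \<in> \<E>"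
  shows "mutual_plus \<mu> \<nu> = ereal (energy_form \<mu> \<nu>)"
  using mutual_plus_finite[OF assms] mutual_plus_not_MInf[of \<mu> \<nu>] assms
  by (cases "mutual_plus \<mu> \<nu>") (simp_all add: energy_form_def mutual_positive energy_plus_radon_plus)

lemma energy_plus_comb:
  assumes E: "\<mu> \<in> \<E>" "\<nu> \<in> \<E>" and c: "0 \<le> c" "0 \<le> d"
  shows "(\<lambda>f. c * \<mu> f + d * \<nu> f) \<in> \<E>"
proof -
  let ?s = "\<lambda>f. c * \<mu> f + d * \<nu> f"
  have M: "\<mu> \<in> \<M>" "\<nu> \<in> \<M>" using E energy_plus_radon_plus by auto
  then have s: "?s \<in> \<M>" using c by (intro radon_plus_comb)
  have "mutual_plus ?s ?s = ereal c * mutual_plus \<mu> ?s + ereal d * mutual_plus \<nu> ?s"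
    by (rule mutual_plus_comb_left[OF M s c])
  also have "\<dots> \<noteq> \<infinity>"
    using mutual_plus_comb_right[OF M(1) M c] mutual_plus_comb_right[OF M(2) M c]
    by (simp add: mutual_plus_eq E)
  finally show ?thesis using s by (simp add: energy_plus_iff)
qed

lemma energy_form_comb_left:
  assumes "\<mu> \<in> \<E>" "\<mu>' \<in> \<E>" "\<nu> \<in> \<E>" "0 \<le> c" "0 \<le> d"
  shows "energy_form (\<lambda>f. c * \<mu> f + d * \<mu>' f) \<nu> = c * energy_form \<mu> \<nu> + d * energy_form \<mu>' \<nu>"
proof -
  have "mutual_plus (\<lambda>f. c * \<mu> f + d * \<mu>' f) \<nu>
      = ereal c * mutual_plus \<mu> \<nu> + ereal d * mutual_plus \<mu>' \<nu>"
    using assms by (intro mutual_plus_comb_left energy_plus_radon_plus)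
  then show ?thesis using assms by (simp add: mutual_plus_eq energy_plus_comb)
qed

lemma energy_form_comb_right:
  assumes "\<mu> \<in> \<E>" "\<nu> \<in> \<E>" "\<nu>' \<in> \<E>" "0 \<le> c" "0 \<le> d"
  shows "energy_form \<mu> (\<lambda>f. c * \<nu> f + d * \<nu>' f) = c * energy_form \<mu> \<nu> + d * energy_form \<mu> \<nu>'"
proof -
  have "mutual_plus \<mu> (\<lambda>f. c * \<nu> f + d * \<nu>' f)
      = ereal c * mutual_plus \<mu> \<nu> + ereal d * mutual_plus \<mu> \<nu>'"
    using assms by (intro mutual_plus_comb_right energy_plus_radon_plus)
  then show ?thesis using assms by (simp add: mutual_plus_eq energy_plus_comb)
qed

lemma energy_form_diff:
  assumes E: "P \<in> \<E>" "N \<in> \<E>" "P' \<in> \<E>" "N' \<in> \<E>"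
  shows "mutual_defined \<kappa> (\<lambda>f. P f - N f) (\<lambda>f. P' f - N' f)"
    "mutual \<kappa> (\<lambda>f. P f - N f) (\<lambda>f. P' f - N' f)
      = ereal (energy_form (\<lambda>f. P f - N f) (\<lambda>f. P' f - N' f))"
    "energy_form (\<lambda>f. P f - N f) (\<lambda>f. P' f - N' f)
       = energy_form P P' + energy_form N N' - energy_form P N' - energy_form N P'"
proof -
  have M: "P \<in> \<M>" "N \<in> \<M>" "P' \<in> \<M>" "N' \<in> \<M>"
    using E energy_plus_radon_plus by auto
  have "mutual_plus P P' + mutual_plus N N' \<noteq> \<infinity>" using E by (simp add: mutual_plus_eq)
  note d = mutual_diff[OF M this]
  show "mutual_defined \<kappa> (\<lambda>f. P f - N f) (\<lambda>f. P' f - N' f)" by (rule d(1))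
  have v: "mutual \<kappa> (\<lambda>f. P f - N f) (\<lambda>f. P' f - N' f)
      = ereal (energy_form P P' + energy_form N N' - energy_form P N' - energy_form N P')"
    using d(2) E by (simp add: mutual_plus_eq algebra_simps)
  then show "energy_form (\<lambda>f. P f - N f) (\<lambda>f. P' f - N' f)
       = energy_form P P' + energy_form N N' - energy_form P N' - energy_form N P'"
    unfolding energy_form_def[of "\<lambda>f. P f - N f"] by simp
  with v show "mutual \<kappa> (\<lambda>f. P f - N f) (\<lambda>f. P' f - N' f)
      = ereal (energy_form (\<lambda>f. P f - N f) (\<lambda>f. P' f - N' f))" by simp
qed

text \<open>The linear span of the cone of positive measures of finite energy. Bilinearity is
  inherited from the cone here, and the resultants of vector measures of finite energy are elements
  of it.\<close>

definition energy_diff :: "'a functional set" where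
  "energy_diff = {\<lambda>f. P f - N f | P N. P \<in> \<E> \<and> N \<in> \<E>}"

lemma energy_diffI: "P \<in> \<E> \<Longrightarrow> N \<in> \<E> \<Longrightarrow> (\<lambda>f. P f - N f) \<in> energy_diff"
  unfolding energy_diff_def by blast

lemma energy_diffE:
  assumes "\<sigma> \<in> energy_diff"
  obtains P N where "P \<in> \<E>" "N \<in> \<E>" "\<sigma> = (\<lambda>f. P f - N f)"
  using assms unfolding energy_diff_def by blast

lemma zero_energy_plus: "(\<lambda>_. 0) \<in> \<E>"
proof -
  have "(\<lambda>_. 0) \<in> (\<M> :: 'a functional set)"
    by (auto simp: radon_plus_UNIV_iff Cc_positive_zero radon_def intro: exI[of _ 0])
  moreover have "mutual_plus (\<lambda>_. 0) (\<lambda>_. 0) = 0"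
    using integral_plus_zero[OF Phi] by (simp add: mutual_plus_def tensor_def[abs_def])
  ultimately show ?thesis by (simp add: energy_plus_iff)
qed

lemma energy_plus_subset_diff: "\<mu> \<in> \<E> \<Longrightarrow> \<mu> \<in> energy_diff"
  using energy_diffI[OF _ zero_energy_plus] by simp

lemma energy_diff_subset_energy_space: "\<sigma> \<in> energy_diff \<Longrightarrow> \<sigma> \<in> energy_space \<kappa>"
  by (erule energy_diffE)
    (simp add: energy_space_def energy_form_diff(1,2) radon_diff radon_plus_radon[OF energy_plus_radon_plus])

lemma energy_diff_add:
  assumes "\<sigma> \<in> energy_diff" "\<tau> \<in> energy_diff"
  shows "(\<lambda>f. \<sigma> f + \<tau> f) \<in> energy_diff"
proof -
  obtain P N where 1: "P \<in> \<E>" "N \<in> \<E>" "\<sigma> = (\<lambda>f. P f - N f)"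
    using assms(1) by (blast elim: energy_diffE)
  obtain P' N' where 2: "P' \<in> \<E>" "N' \<in> \<E>" "\<tau> = (\<lambda>f. P' f - N' f)"
    using assms(2) by (blast elim: energy_diffE)
  note E = 1(1,2) 2(1,2) and e = 1(3) 2(3)
  have "(\<lambda>f. P f + P' f) \<in> \<E>" "(\<lambda>f. N f + N' f) \<in> \<E>"
    using energy_plus_comb[OF E(1,3), of 1 1] energy_plus_comb[OF E(2,4), of 1 1] by simp_all
  from energy_diffI[OF this] show ?thesis unfolding e by (simp add: algebra_simps)
qed

lemma energy_diff_cmult:
  assumes "\<sigma> \<in> energy_diff"
  shows "(\<lambda>f. c * \<sigma> f) \<in> energy_diff"
proof -
  obtain P N where E: "P \<in> \<E>" "N \<in> \<E>" and e: "\<sigma> = (\<lambda>f. P f - N f)"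
    using assms by (blast elim: energy_diffE)
  have m: "(\<lambda>f. \<bar>c\<bar> * P f) \<in> \<E>" "(\<lambda>f. \<bar>c\<bar> * N f) \<in> \<E>"
    using energy_plus_comb[OF E(1) zero_energy_plus, of "\<bar>c\<bar>" 0]
      energy_plus_comb[OF E(2) zero_energy_plus, of "\<bar>c\<bar>" 0] by simp_all
  show ?thesis
    using energy_diffI[OF m] energy_diffI[OF m(2,1)] unfolding e
    by (cases "0 \<le> c") (simp_all add: algebra_simps)
qed

lemma energy_diff_diff:
  assumes "\<sigma> \<in> energy_diff" "\<tau> \<in> energy_diff"
  shows "(\<lambda>f. \<sigma> f - \<tau> f) \<in> energy_diff"
  using energy_diff_add[OF assms(1) energy_diff_cmult[OF assms(2), of "-1"]] by simp

text \<open>Additivity on the cone and compatibility with differences give linearity on the span. As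
  \<open>L\<close> is given on all functionals, no question of well-definedness arises from the
  choice of \<open>P\<close> and \<open>N\<close>; a negative scalar exchanges their roles.\<close>

lemma energy_diff_linear_extension:
  assumes comb: "\<And>\<mu> \<nu> c d. \<mu> \<in> \<E> \<Longrightarrow> \<nu> \<in> \<E> \<Longrightarrow> 0 \<le> c \<Longrightarrow> 0 \<le> d \<Longrightarrow>
      L (\<lambda>f. c * \<mu> f + d * \<nu> f) = c * L \<mu> + d * L \<nu>"
    and diff: "\<And>P N. P \<in> \<E> \<Longrightarrow> N \<in> \<E> \<Longrightarrow> L (\<lambda>f. P f - N f) = L P - (L N :: real)"
    and \<sigma>: "\<sigma> \<in> energy_diff"
  shows "\<tau> \<in> energy_diff \<Longrightarrow> L (\<lambda>f. \<sigma> f + \<tau> f) = L \<sigma> + L \<tau>" "L (\<lambda>f. c * \<sigma> f) = c * L \<sigma>"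
proof -
  obtain P N where E: "P \<in> \<E>" "N \<in> \<E>" and \<sigma>: "\<sigma> = (\<lambda>f. P f - N f)"
    using \<sigma> by (blast elim: energy_diffE)
  show "L (\<lambda>f. \<sigma> f + \<tau> f) = L \<sigma> + L \<tau>" if t: "\<tau> \<in> energy_diff"
  proof -
    obtain P' N' where E': "P' \<in> \<E>" "N' \<in> \<E>" and \<tau>: "\<tau> = (\<lambda>f. P' f - N' f)"
      using t by (blast elim: energy_diffE)
    have e: "(\<lambda>f. \<sigma> f + \<tau> f) = (\<lambda>f. (1 * P f + 1 * P' f) - (1 * N f + 1 * N' f))" by (auto simp: \<sigma> \<tau>)
    have "L (\<lambda>f. \<sigma> f + \<tau> f) = L (\<lambda>f. 1 * P f + 1 * P' f) - L (\<lambda>f. 1 * N f + 1 * N' f)"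
      unfolding e by (rule diff; rule energy_plus_comb[OF _ _ zero_le_one zero_le_one]; rule E E')
    then show ?thesis
      using comb[OF E(1) E'(1), of 1 1] comb[OF E(2) E'(2), of 1 1] diff[OF E] diff[OF E']
      by (simp add: \<sigma> \<tau>)
  qed
  have s: "(\<lambda>f. \<bar>c\<bar> * \<mu> f) \<in> \<E>" "L (\<lambda>f. \<bar>c\<bar> * \<mu> f) = \<bar>c\<bar> * L \<mu>"
    if "\<mu> \<in> \<E>" for \<mu>
    using energy_plus_comb[OF that that, of "\<bar>c\<bar>" 0] comb[OF that that, of "\<bar>c\<bar>" 0] by simp_all
  show "L (\<lambda>f. c * \<sigma> f) = c * L \<sigma>"
  proof (cases "0 \<le> c")
    case True
    then have e: "(\<lambda>f. c * \<sigma> f) = (\<lambda>f. \<bar>c\<bar> * P f - \<bar>c\<bar> * N f)" by (simp add: \<sigma> right_diff_distrib)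
    show ?thesis
      unfolding e diff[OF s(1)[OF E(1)] s(1)[OF E(2)]] s(2)[OF E(1)] s(2)[OF E(2)]
      using True diff[OF E] by (simp add: \<sigma> right_diff_distrib)
  next
    case False
    then have e: "(\<lambda>f. c * \<sigma> f) = (\<lambda>f. \<bar>c\<bar> * N f - \<bar>c\<bar> * P f)" by (simp add: \<sigma> right_diff_distrib)
    show ?thesis
      unfolding e diff[OF s(1)[OF E(2)] s(1)[OF E(1)]] s(2)[OF E(1)] s(2)[OF E(2)]
      using False diff[OF E] by (simp add: \<sigma> right_diff_distrib)
  qed
qed

text \<open>Once \<open>\<rho>\<close> is written as \<open>Q - M\<close>, the form is linear in the
  other slot on the cone, and \<open>energy_diff_linear_extension\<close> carries this to the
  span.\<close>

lemma
  assumes "\<sigma> \<in> energy_diff" "\<rho> \<in> energy_diff"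
  shows energy_form_add_left: "\<tau> \<in> energy_diff \<Longrightarrow>
      energy_form (\<lambda>f. \<sigma> f + \<tau> f) \<rho> = energy_form \<sigma> \<rho> + energy_form \<tau> \<rho>"
    and energy_form_add_right: "\<tau> \<in> energy_diff \<Longrightarrow>
      energy_form \<rho> (\<lambda>f. \<sigma> f + \<tau> f) = energy_form \<rho> \<sigma> + energy_form \<rho> \<tau>"
    and energy_form_cmult_left: "energy_form (\<lambda>f. c * \<sigma> f) \<rho> = c * energy_form \<sigma> \<rho>"
    and energy_form_cmult_right: "energy_form \<rho> (\<lambda>f. c * \<sigma> f) = c * energy_form \<rho> \<sigma>"
proof -
  obtain Q M where E: "Q \<in> \<E>" "M \<in> \<E>" and \<rho>: "\<rho> = (\<lambda>f. Q f - M f)"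
    using assms(2) by (blast elim: energy_diffE)
  have z: "energy_form (\<lambda>_. 0) \<mu> = 0" "energy_form \<mu> (\<lambda>_. 0) = 0" if "\<mu> \<in> \<E>" for \<mu>
    using energy_form_comb_left[OF that that that, of 0 0] energy_form_comb_right[OF that that that, of 0 0]
    by simp_all
  have e: "energy_form \<mu> \<rho> = energy_form \<mu> Q - energy_form \<mu> M"
    "energy_form \<rho> \<mu> = energy_form Q \<mu> - energy_form M \<mu>" if "\<mu> \<in> \<E>" for \<mu>
    using energy_form_diff(3)[OF that zero_energy_plus E] energy_form_diff(3)[OF E that zero_energy_plus] E
    by (simp_all add: \<rho> z)
  have l: "energy_form (\<lambda>f. c * \<mu> f + d * \<nu> f) \<rho> = c * energy_form \<mu> \<rho> + d * energy_form \<nu> \<rho>"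
    "energy_form \<rho> (\<lambda>f. c * \<mu> f + d * \<nu> f) = c * energy_form \<rho> \<mu> + d * energy_form \<rho> \<nu>"
    if "\<mu> \<in> \<E>" "\<nu> \<in> \<E>" "0 \<le> c" "0 \<le> d" for \<mu> \<nu> c d
    using that E by (simp_all add: e energy_plus_comb energy_form_comb_left energy_form_comb_right algebra_simps)
  have d: "energy_form (\<lambda>f. P f - N f) \<rho> = energy_form P \<rho> - energy_form N \<rho>"
    "energy_form \<rho> (\<lambda>f. P f - N f) = energy_form \<rho> P - energy_form \<rho> N"
    if "P \<in> \<E>" "N \<in> \<E>" for P N
    using energy_form_diff(3)[OF that E] energy_form_diff(3)[OF E that] by (simp_all add: e that \<rho>[symmetric])
  show "\<tau> \<in> energy_diff \<Longrightarrow> energy_form (\<lambda>f. \<sigma> f + \<tau> f) \<rho> = energy_form \<sigma> \<rho> + energy_form \<tau> \<rho>"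
    "energy_form (\<lambda>f. c * \<sigma> f) \<rho> = c * energy_form \<sigma> \<rho>"
    by (rule energy_diff_linear_extension[of "\<lambda>\<sigma>. energy_form \<sigma> \<rho>", OF l(1) d(1) assms(1)]; assumption)+
  show "\<tau> \<in> energy_diff \<Longrightarrow> energy_form \<rho> (\<lambda>f. \<sigma> f + \<tau> f) = energy_form \<rho> \<sigma> + energy_form \<rho> \<tau>"
    "energy_form \<rho> (\<lambda>f. c * \<sigma> f) = c * energy_form \<rho> \<sigma>"
    by (rule energy_diff_linear_extension[of "energy_form \<rho>", OF l(2) d(2) assms(1)]; assumption)+
qed

section \<open>The energy seminorm\<close>

lemma energy_form_nonneg:
  assumes "\<sigma> \<in> energy_diff"
  shows "0 \<le> energy_form \<sigma> \<sigma>"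
proof -
  have "\<sigma> \<in> energy_space \<kappa>" by (rule energy_diff_subset_energy_space[OF assms])
  then have "0 \<le> mutual \<kappa> \<sigma> \<sigma>" using pd by (auto simp: positive_definite_def energy_space_def)
  then show ?thesis by (simp add: energy_form_def real_of_ereal_pos)
qed

lemma energy_norm_eq: "nrm \<sigma> = sqrt (energy_form \<sigma> \<sigma>)"
  by (simp add: energy_norm_def energy_form_def)

lemma energy_norm_square: "\<sigma> \<in> energy_diff \<Longrightarrow> (nrm \<sigma>)\<^sup>2 = energy_form \<sigma> \<sigma>"
  by (simp add: energy_norm_eq energy_form_nonneg)

lemma energy_norm_nonneg: "\<sigma> \<in> energy_diff \<Longrightarrow> 0 \<le> nrm \<sigma>"
  by (simp add: energy_norm_eq energy_form_nonneg)

lemma energy_form_comb: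
  assumes "\<sigma> \<in> energy_diff" "\<tau> \<in> energy_diff"
  shows "energy_form (\<lambda>f. c * \<sigma> f + d * \<tau> f) (\<lambda>f. c * \<sigma> f + d * \<tau> f)
    = c\<^sup>2 * energy_form \<sigma> \<sigma> + c * d * (energy_form \<sigma> \<tau> + energy_form \<tau> \<sigma>) + d\<^sup>2 * energy_form \<tau> \<tau>"
proof -
  have c: "(\<lambda>f. c * \<sigma> f) \<in> energy_diff" "(\<lambda>f. d * \<tau> f) \<in> energy_diff"
    using assms energy_diff_cmult by auto
  show ?thesis
    using energy_form_add_left[OF c(1) energy_diff_add[OF c] c(2)] energy_form_add_right[OF c(1,1,2)]
      energy_form_add_right[OF c(1,2,2)] assms c
    by (simp add: energy_form_cmult_left energy_form_cmult_right power2_eq_square algebra_simps)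
qed

text \<open>The symmetrised form is estimated because that is the combination produced by expanding
  a square.\<close>

lemma energy_form_Cauchy_Schwarz:
  assumes "\<sigma> \<in> energy_diff" "\<tau> \<in> energy_diff"
  shows "energy_form \<sigma> \<tau> + energy_form \<tau> \<sigma> \<le> 2 * (nrm \<sigma> * nrm \<tau>)"
proof -
  let ?m = "nrm \<sigma>" and ?n = "nrm \<tau>" and ?s = "energy_form \<sigma> \<tau> + energy_form \<tau> \<sigma>"
  have mn: "0 \<le> ?m" "0 \<le> ?n" using assms energy_norm_nonneg by auto
  \<comment> \<open>The usual test vector takes the norms themselves as coefficients, which may
    vanish for a seminorm. Enlarging both by \<open>e\<close> makes their product cancellable; then
    \<open>e\<close> tends to 0.\<close>
  have le: "?s \<le> 2 * ((?m + e) * (?n + e))" if e: "e > 0" for e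
  proof -
    let ?c = "?n + e" and ?d = "?m + e"
    have "0 \<le> energy_form (\<lambda>f. ?c * \<sigma> f + - ?d * \<tau> f) (\<lambda>f. ?c * \<sigma> f + - ?d * \<tau> f)"
      using assms by (intro energy_form_nonneg energy_diff_add energy_diff_cmult)
    also have "\<dots> = ?c\<^sup>2 * ?m\<^sup>2 - ?c * ?d * ?s + ?d\<^sup>2 * ?n\<^sup>2"
      unfolding energy_form_comb[OF assms] energy_norm_square[OF assms(1)] energy_norm_square[OF assms(2)]
      by (simp add: power2_eq_square algebra_simps)
    also have "\<dots> \<le> ?c\<^sup>2 * ?d\<^sup>2 - ?c * ?d * ?s + ?d\<^sup>2 * ?c\<^sup>2"
      using mn e by (intro add_mono diff_mono mult_left_mono power_mono) auto
    finally have "(?c * ?d) * ?s \<le> (?c * ?d) * (2 * (?d * ?c))"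
      by (simp add: power2_eq_square algebra_simps)
    moreover have "?c * ?d > 0" using mn e by (intro mult_pos_pos) auto
    ultimately show ?thesis by (simp only: mult_le_cancel_left_pos)
  qed
  have lim: "((\<lambda>e. 2 * ((?m + e) * (?n + e))) \<longlongrightarrow> 2 * ((?m + 0) * (?n + 0))) (at_right 0)"
    by (intro tendsto_intros)
  have ev: "\<forall>\<^sub>F e in at_right 0. ?s \<le> 2 * ((?m + e) * (?n + e))"
    using eventually_at_right_less[of "0::real"] by (rule eventually_mono) (rule le)
  show ?thesis using tendsto_lowerbound[OF lim ev] by simp
qed

lemma energy_norm_triangle:
  assumes "\<sigma> \<in> energy_diff" "\<tau> \<in> energy_diff"
  shows "nrm (\<lambda>f. \<sigma> f + \<tau> f) \<le> nrm \<sigma> + nrm \<tau>"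
proof (rule power2_le_imp_le)
  have "(nrm (\<lambda>f. \<sigma> f + \<tau> f))\<^sup>2
      = energy_form \<sigma> \<sigma> + (energy_form \<sigma> \<tau> + energy_form \<tau> \<sigma>) + energy_form \<tau> \<tau>"
    using energy_form_comb[OF assms, of 1 1] energy_diff_add[OF assms] by (simp add: energy_norm_square)
  also have "\<dots> \<le> (nrm \<sigma> + nrm \<tau>)\<^sup>2"
    using energy_form_Cauchy_Schwarz[OF assms] assms
    by (simp add: energy_norm_square power2_sum)
  finally show "(nrm (\<lambda>f. \<sigma> f + \<tau> f))\<^sup>2 \<le> (nrm \<sigma> + nrm \<tau>)\<^sup>2" .
qed (simp add: assms energy_norm_nonneg)

lemma energy_norm_cmult:
  assumes "\<sigma> \<in> energy_diff"
  shows "nrm (\<lambda>f. c * \<sigma> f) = \<bar>c\<bar> * nrm \<sigma>"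
proof -
  have "energy_form (\<lambda>f. c * \<sigma> f) (\<lambda>f. c * \<sigma> f) = c\<^sup>2 * energy_form \<sigma> \<sigma>"
    using assms energy_diff_cmult[OF assms]
    by (simp add: energy_form_cmult_left energy_form_cmult_right power2_eq_square)
  then show ?thesis by (simp add: energy_norm_eq real_sqrt_mult)
qed

lemma energy_norm_minus_commute:
  assumes "\<sigma> \<in> energy_diff" "\<tau> \<in> energy_diff"
  shows "nrm (\<lambda>f. \<sigma> f - \<tau> f) = nrm (\<lambda>f. \<tau> f - \<sigma> f)"
  using energy_norm_cmult[OF energy_diff_diff[OF assms], of "-1"] by simp

lemma energy_norm_diff_triangle:
  assumes "\<sigma> \<in> energy_diff" "\<tau> \<in> energy_diff" "\<rho> \<in> energy_diff"
  shows "nrm (\<lambda>f. \<sigma> f - \<rho> f) \<le> nrm (\<lambda>f. \<sigma> f - \<tau> f) + nrm (\<lambda>f. \<tau> f - \<rho> f)"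
  using energy_norm_triangle[OF energy_diff_diff[OF assms(1,2)] energy_diff_diff[OF assms(2,3)]] by simp

text \<open>Stated with the midpoint, so that a lower bound on the midpoint of two nearly minimal
  elements becomes an upper bound on their distance.\<close>

lemma energy_norm_parallelogram:
  assumes "\<sigma> \<in> energy_diff" "\<tau> \<in> energy_diff"
  shows "(nrm (\<lambda>f. \<sigma> f - \<tau> f))\<^sup>2
    = 2 * (nrm \<sigma>)\<^sup>2 + 2 * (nrm \<tau>)\<^sup>2
      - 4 * (nrm (\<lambda>f. (\<sigma> f + \<tau> f) / 2))\<^sup>2"
proof -
  have mid: "(\<lambda>f. 1/2 * \<sigma> f + 1/2 * \<tau> f) = (\<lambda>f. (\<sigma> f + \<tau> f) / 2)" by (simp add: field_simps)
  have "(\<lambda>f. 1/2 * \<sigma> f + 1/2 * \<tau> f) \<in> energy_diff"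
    using assms by (intro energy_diff_add energy_diff_cmult)
  then have m: "(\<lambda>f. (\<sigma> f + \<tau> f) / 2) \<in> energy_diff" unfolding mid .
  show ?thesis
    using energy_form_comb[OF assms, of 1 "-1"] energy_form_comb[OF assms, of "1/2" "1/2"]
    unfolding energy_norm_square[OF energy_diff_diff[OF assms]] energy_norm_square[OF m] mid
      energy_norm_square[OF assms(1)] energy_norm_square[OF assms(2)]
    by (simp add: power2_eq_square field_simps)
qed

end

section \<open>The vague topology\<close>

lemma topspace_vague: "topspace vague_topology = radon"
  by (auto simp: vague_topology_def topspace_pullback_topology)

text \<open>A basic open set of the product topology restricts finitely many coordinates, so a vague
  neighbourhood is recognised by finitely many test functions and one common tolerance.\<close>

lemma vague_basic_neighbourhood:
  assumes "openin vague_topology U" "\<nu> \<in> U"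
  obtains F \<delta> where "finite F" "F \<subseteq> Cc" "\<delta> > 0"
    "\<And>\<nu>'. \<nu>' \<in> radon \<Longrightarrow> \<forall>f\<in>F. \<bar>\<nu>' f - \<nu> f\<bar> < \<delta> \<Longrightarrow> \<nu>' \<in> U"
proof -
  obtain V where V: "openin (product_topology (\<lambda>_. euclideanreal) Cc) V"
      and U: "U = (\<lambda>\<nu>. restrict \<nu> Cc) -` V \<inter> radon"
    using assms(1) unfolding vague_topology_def openin_pullback_topology by blast
  have "restrict \<nu> Cc \<in> V" using assms(2) U by blast
  then obtain X where X: "restrict \<nu> Cc \<in> (\<Pi>\<^sub>E f\<in>Cc. X f)" "\<And>f. open (X f)"
      "finite {f. X f \<noteq> UNIV}" "(\<Pi>\<^sub>E f\<in>Cc. X f) \<subseteq> V"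
    using product_topology_open_contains_basis[OF V] by (metis open_openin topspace_euclidean)
  define F where "F = {f. X f \<noteq> UNIV} \<inter> Cc"
  have "\<exists>d>0. \<forall>r. \<bar>r - \<nu> f\<bar> < d \<longrightarrow> r \<in> X f" if "f \<in> F" for f
  proof -
    have "\<nu> f \<in> X f" using X(1) that by (auto simp: F_def PiE_iff)
    then obtain d where "d > 0" "ball (\<nu> f) d \<subseteq> X f" using X(2) open_contains_ball by blast
    then show ?thesis by (intro exI[of _ d]) (auto simp: dist_real_def abs_minus_commute subset_iff)
  qed
  then obtain d where d: "\<And>f. f \<in> F \<Longrightarrow> d f > 0" "\<And>f r. f \<in> F \<Longrightarrow> \<bar>r - \<nu> f\<bar> < d f \<Longrightarrow> r \<in> X f"
    by metis
  have fin: "finite F" using X(3) by (simp add: F_def)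
  show ?thesis
  proof
    show "finite F" "F \<subseteq> Cc" using fin by (auto simp: F_def)
    \<comment> \<open>The inserted 1 provides a tolerance when \<open>F\<close> is empty.\<close>
    show "Min (insert 1 (d ` F)) > 0" using fin d(1) by simp
    fix \<nu>' assume \<nu>': "\<nu>' \<in> radon" "\<forall>f\<in>F. \<bar>\<nu>' f - \<nu> f\<bar> < Min (insert 1 (d ` F))"
    have "\<nu>' f \<in> X f" if "f \<in> Cc" for f
    proof (cases "f \<in> F")
      case True
      then have "Min (insert 1 (d ` F)) \<le> d f" using fin by (intro Min_le) auto
      moreover have "\<bar>\<nu>' f - \<nu> f\<bar> < Min (insert 1 (d ` F))" using \<nu>'(2) True by blast
      ultimately show ?thesis using d(2)[OF True] by simp
    qed (use that in \<open>auto simp: F_def\<close>)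
    then have "restrict \<nu>' Cc \<in> (\<Pi>\<^sub>E f\<in>Cc. X f)" by auto
    then have "restrict \<nu>' Cc \<in> V" using X(4) by blast
    then show "\<nu>' \<in> U" using U \<nu>'(1) by blast
  qed
qed

section \<open>Consistent kernels and differences of measures\<close>

text \<open>The two components are averaged simultaneously, so for \<open>(P, N)\<close> in the hull
  the difference \<open>P - N\<close> lies in the midpoint hull of the original differences. This
  transfers closeness of differences to the hull.\<close>

inductive_set mid_hull :: "(('x \<Rightarrow> real) \<times> ('y \<Rightarrow> real)) set \<Rightarrow> (('x \<Rightarrow> real) \<times> ('y \<Rightarrow> real)) set"
  for B where
  base: "p \<in> B \<Longrightarrow> p \<in> mid_hull B"
| mid: "(P, N) \<in> mid_hull B \<Longrightarrow> (P', N') \<in> mid_hull B \<Longrightarrow>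
    ((\<lambda>f. (P f + P' f) / 2), (\<lambda>f. (N f + N' f) / 2)) \<in> mid_hull B"

lemma mid_hull_mono:
  assumes "B \<subseteq> B'" shows "mid_hull B \<subseteq> mid_hull B'"
proof
  fix p assume "p \<in> mid_hull B"
  then show "p \<in> mid_hull B'"
    by induction (use assms in \<open>auto intro: mid_hull.intros\<close>)
qed

lemma abs_mean_less:
  fixes x y z d :: real
  assumes "\<bar>x - z\<bar> < d" "\<bar>y - z\<bar> < d"
  shows "\<bar>(x + y) / 2 - z\<bar> < d"
  using assms by (auto simp: abs_less_iff field_simps)

context pd_kernel
begin

abbreviation edist :: "'a functional \<Rightarrow> 'a functional \<Rightarrow> real" where "edist \<equiv> energy_dist \<kappa>"

lemma energy_dist_eq: "edist \<mu> \<nu> = nrm (\<lambda>f. \<mu> f - \<nu> f)"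
  by (simp add: energy_dist_def fun_diff_def)

text \<open>Closed balls of the seminorm are closed under midpoints; this carries distance estimates
  from a set to its midpoint hull.\<close>

lemma energy_norm_mean_diff:
  assumes V: "\<sigma> \<in> energy_diff" "\<tau> \<in> energy_diff" "\<rho> \<in> energy_diff"
    and e: "nrm (\<lambda>f. \<sigma> f - \<rho> f) \<le> e" "nrm (\<lambda>f. \<tau> f - \<rho> f) \<le> e"
  shows "nrm (\<lambda>f. (\<sigma> f + \<tau> f) / 2 - \<rho> f) \<le> e"
proof -
  note d = energy_diff_diff[OF V(1,3)] energy_diff_diff[OF V(2,3)]
  have "nrm (\<lambda>f. 1/2 * (\<sigma> f - \<rho> f) + 1/2 * (\<tau> f - \<rho> f))
      \<le> nrm (\<lambda>f. 1/2 * (\<sigma> f - \<rho> f)) + nrm (\<lambda>f. 1/2 * (\<tau> f - \<rho> f))"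
    by (intro energy_norm_triangle energy_diff_cmult d)
  also have "\<dots> \<le> e" using e unfolding energy_norm_cmult[OF d(1)] energy_norm_cmult[OF d(2)] by simp
  also have "(\<lambda>f. 1/2 * (\<sigma> f - \<rho> f) + 1/2 * (\<tau> f - \<rho> f)) = (\<lambda>f. (\<sigma> f + \<tau> f) / 2 - \<rho> f)"
    by (auto simp: field_simps)
  finally show ?thesis .
qed

lemma energy_plus_mean:
  "\<mu> \<in> \<E> \<Longrightarrow> \<nu> \<in> \<E> \<Longrightarrow> (\<lambda>f. (\<mu> f + \<nu> f) / 2) \<in> \<E>"
  using energy_plus_comb[of \<mu> \<nu> "1/2" "1/2"] by (simp add: add_divide_distrib)

text \<open>Consistency speaks about strong Cauchy nets only, whereas \<open>P\<close> and \<open>N\<close> are merely bounded.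
  As in Mazur's lemma, almost norm-minimal elements \<open>(p, n)\<close> of the convex hulls of the tails
  of \<open>(P, N)\<close> (midpoint hulls suffice) form a strong Cauchy net by the parallelogram law. It
  still converges vaguely to \<open>(P0, N0)\<close>, hence strongly, and \<open>p - n\<close> remains close to the Cauchy
  net \<open>P - N\<close>.\<close>

theorem consistent_diff_limit:
  fixes S :: "'s set"
  assumes cons: "consistent \<kappa>" and dir: "directed_set S le"
    and PN: "P \<in> S \<rightarrow> \<E>" "N \<in> S \<rightarrow> \<E>"
    and PN0: "P0 \<in> \<M>" "N0 \<in> \<M>"
    and s1: "s1 \<in> S"
    and bd: "\<And>t. t \<in> S \<Longrightarrow> le s1 t \<Longrightarrow> (nrm (P t))\<^sup>2 + (nrm (N t))\<^sup>2 \<le> C"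
    and cau: "Cauchy_net (edist) S le (\<lambda>t f. P t f - N t f)"
    and clu: "\<And>s F \<delta>. s \<in> S \<Longrightarrow> finite F \<Longrightarrow> F \<subseteq> Cc \<Longrightarrow> 0 < \<delta> \<Longrightarrow>
      \<exists>t\<in>S. le s t \<and> (\<forall>f\<in>F. \<bar>P t f - P0 f\<bar> < \<delta> \<and> \<bar>N t f - N0 f\<bar> < \<delta>)"
  shows "P0 \<in> \<E>" "N0 \<in> \<E>"
    "((\<lambda>s. edist (\<lambda>f. P s f - N s f) (\<lambda>f. P0 f - N0 f)) \<longlongrightarrow> 0) (net_filter S le)"
proof -
  have refl: "le t t" if "t \<in> S" for t
    using dir that unfolding directed_set_def by blast
  have trans: "le s u" if "s \<in> S" "t \<in> S" "u \<in> S" "le s t" "le t u" for s t u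
    using dir that unfolding directed_set_def by blast
  \<comment> \<open>An index records the start \<open>s\<close> of a tail beyond \<open>s1\<close>,
    a finite set \<open>F\<close> of test functions and a tolerance \<open>1 / (n + 1)\<close>;
    refining it shrinks both the tail and the vague neighbourhood of
    \<open>(P0, N0)\<close>.\<close>
  define D where "D = {(s, F, n::nat). s \<in> S \<and> le s1 s \<and> finite F \<and> F \<subseteq> (Cc :: ('a \<Rightarrow> real) set)}"
  define r where "r = (\<lambda>(s, F, n) (s', F', n'). le s s' \<and> F \<subseteq> (F' :: ('a \<Rightarrow> real) set) \<and> n \<le> (n'::nat))"
  define B where "B = (\<lambda>(s, F, n). {(P t, N t) | t. t \<in> S \<and> le s t \<and>
      (\<forall>f\<in>F. \<bar>P t f - P0 f\<bar> < 1 / (real n + 1) \<and> \<bar>N t f - N0 f\<bar> < 1 / (real n + 1))})"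
  define H where "H d = mid_hull (B d)" for d
  \<comment> \<open>Minimising the sum of both squared norms makes a single choice of near-minimiser
    serve both components.\<close>
  define g where "g p = (nrm (fst p))\<^sup>2 + (nrm (snd p))\<^sup>2"
    for p :: "'a functional \<times> 'a functional"
  define m where "m d = Inf (g ` H d)" for d
  have B_anti: "B d' \<subseteq> B d" if D': "d \<in> D" "d' \<in> D" and rr: "r d d'" for d d'
  proof -
    obtain s F n s' F' n' where d: "d = (s, F, n)" "d' = (s', F', n')" by (metis prod_cases3)
    have le: "1 / (real n' + 1) \<le> 1 / (real n + 1)" "F \<subseteq> F'" "le s s'" "s \<in> S" "s' \<in> S"
      using rr D' by (auto simp: d r_def D_def frac_le)
    show ?thesis
    proof
      fix p assume "p \<in> B d'"
      then obtain t where t: "p = (P t, N t)" "t \<in> S" "le s' t"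
        and near: "\<forall>f\<in>F'. \<bar>P t f - P0 f\<bar> < 1 / (real n' + 1) \<and> \<bar>N t f - N0 f\<bar> < 1 / (real n' + 1)"
        by (auto simp: B_def d)
      have "\<forall>f\<in>F. \<bar>P t f - P0 f\<bar> < 1 / (real n + 1) \<and> \<bar>N t f - N0 f\<bar> < 1 / (real n + 1)"
        using near le(1,2) by (meson order_less_le_trans subsetD)
      moreover have "le s t" using trans[OF le(4,5) t(2) le(3) t(3)] .
      ultimately show "p \<in> B d" using t by (auto simp: B_def d)
    qed
  qed
  have H_anti: "H d' \<subseteq> H d" if "d \<in> D" "d' \<in> D" "r d d'" for d d'
    unfolding H_def by (rule mid_hull_mono[OF B_anti[OF that]])
  have H_ne: "\<exists>p \<in> H d. g p \<le> C" if d: "d \<in> D" for d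
  proof -
    obtain s F n where e: "d = (s, F, n)" by (metis prod_cases3)
    have h: "s \<in> S" "le s1 s" "finite F" "F \<subseteq> Cc" using d by (auto simp: D_def e)
    obtain t where t: "t \<in> S" "le s t"
      "\<forall>f\<in>F. \<bar>P t f - P0 f\<bar> < 1 / (real n + 1) \<and> \<bar>N t f - N0 f\<bar> < 1 / (real n + 1)"
      using clu[OF h(1,3,4), of "1 / (real n + 1)"] by auto
    then have "(P t, N t) \<in> H d" by (auto simp: H_def B_def e intro: mid_hull.base)
    moreover have "g (P t, N t) \<le> C" using bd[OF t(1) trans[OF s1 h(1) t(1) h(2) t(2)]] by (simp add: g_def)
    ultimately show ?thesis by blast
  qed
  have H_plus: "fst p \<in> \<E> \<and> snd p \<in> \<E>" if "p \<in> H d" for p d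
    using that unfolding H_def
  proof induction
    case (base p)
    then show ?case using PN by (cases d) (auto simp: B_def)
  qed (auto intro: energy_plus_mean)
  have H_near: "\<bar>fst p f - P0 f\<bar> < 1 / (real n + 1) \<and> \<bar>snd p f - N0 f\<bar> < 1 / (real n + 1)"
    if "p \<in> H (s, F, n)" "f \<in> F" for p s F n f
    using that(1) unfolding H_def
  proof induction
    case (base p)
    then show ?case using that(2) by (auto simp: B_def)
  qed (auto intro: abs_mean_less)
  have g0: "0 \<le> g p" for p by (simp add: g_def)
  have bb: "bdd_below (g ` X)" for X by (rule bdd_belowI[of _ 0]) (auto simp: g0)
  have m_le: "m d \<le> g p" if "p \<in> H d" for p d
    unfolding m_def using that bb by (intro cInf_lower) auto
  have m_C: "m d \<le> C" if "d \<in> D" for d using H_ne[OF that] m_le order_trans by blast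
  have m_mono: "m d \<le> m d'" if "d \<in> D" "d' \<in> D" "r d d'" for d d'
    unfolding m_def using H_anti[OF that] H_ne[OF that(2)] bb
    by (intro cInf_superset_mono) auto
  \<comment> \<open>The infimum need not be attained; the allowed error \<open>1 / (n + 1)\<close>
    tends to 0 along the index set.\<close>
  have "\<exists>p \<in> H d. g p < m d + 1 / (real (snd (snd d)) + 1)" if "d \<in> D" for d
  proof -
    have "Inf (g ` H d) < m d + 1 / (real (snd (snd d)) + 1)" unfolding m_def[symmetric] by simp
    moreover have "g ` H d \<noteq> {}" using H_ne[OF that] by blast
    ultimately obtain y where "y \<in> g ` H d" "y < m d + 1 / (real (snd (snd d)) + 1)"
      by (meson cInf_lessD)
    then show ?thesis by (metis imageE)
  qed
  then obtain x where x: "\<And>d. d \<in> D \<Longrightarrow> x d \<in> H d"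
      "\<And>d. d \<in> D \<Longrightarrow> g (x d) < m d + 1 / (real (snd (snd d)) + 1)" by metis
  have Dne: "(s1, {}, 0) \<in> D" using s1 refl by (simp add: D_def)
  have up: "\<exists>c\<in>D. r a c \<and> r b c" if "a \<in> D" "b \<in> D" for a b
  proof -
    obtain s F n s' F' n' where ab: "a = (s, F, n)" "b = (s', F', n')" by (metis prod_cases3)
    have h: "s \<in> S" "s' \<in> S" "le s1 s" "finite F" "finite F'" "F \<subseteq> Cc" "F' \<subseteq> Cc"
      using that by (auto simp: D_def ab)
    then obtain u where u: "u \<in> S" "le s u" "le s' u" using dir unfolding directed_set_def by blast
    have "(u, F \<union> F', max n n') \<in> D" using h u trans[OF s1 h(1) u(1) h(3) u(2)] by (auto simp: D_def)
    moreover have "r a (u, F \<union> F', max n n')" "r b (u, F \<union> F', max n n')" using u by (auto simp: r_def ab)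
    ultimately show ?thesis by blast
  qed
  have dirD: "directed_set D r"
    unfolding directed_set_def
  proof (intro conjI ballI impI)
    show "D \<noteq> {}" using Dne by blast
    show "r a a" if "a \<in> D" for a using that refl by (auto simp: D_def r_def)
    show "r a c" if abc: "a \<in> D" "b \<in> D" "c \<in> D" "r a b" "r b c" for a b c
    proof -
      obtain s F n s' F' n' s'' F'' n'' where "a = (s, F, n)" "b = (s', F', n')" "c = (s'', F'', n'')"
        by (metis prod_cases3)
      then show ?thesis using abc trans[of s s' s''] by (auto simp: D_def r_def)
    qed
  qed (use up in blast)
  have rtrans: "r a c" if "a \<in> D" "b \<in> D" "c \<in> D" "r a b" "r b c" for a b c
    using dirD that unfolding directed_set_def by blast
  \<comment> \<open>Hulls shrink along \<open>D\<close>, so the infima \<open>m d\<close> increase,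
    and they stay below \<open>C\<close>; \<open>M\<close> is their limit.\<close>
  define M where "M = Sup (m ` D)"
  have m_M: "m d \<le> M" if "d \<in> D" for d
    unfolding M_def using that m_C by (intro cSup_upper bdd_aboveI[of _ C]) auto
  have close: "\<exists>d1\<in>D. \<forall>d\<in>D. \<forall>d'\<in>D. r d1 d \<longrightarrow> r d1 d' \<longrightarrow>
      edist (fst (x d)) (fst (x d')) < e \<and> edist (snd (x d)) (snd (x d')) < e"
    if e: "e > 0" for e
  proof -
    \<comment> \<open>For elements with \<open>g\<close> below \<open>M + h\<close> and midpoint
      above \<open>M - h\<close>, the parallelogram law leaves less than 4(M + h) - 4(M - h) = 8h,
      which is \<open>e\<^sup>2\<close>.\<close>
    define h where "h = e\<^sup>2 / 8"
    have h: "h > 0" using e by (simp add: h_def)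
    obtain k :: nat where k: "1 / (real k + 1) < h"
      using h reals_Archimedean[of h] by (auto simp: inverse_eq_divide add.commute)
    have "M - h < Sup (m ` D)" using h by (simp add: M_def)
    then obtain d0 where d0: "d0 \<in> D" "M - h < m d0"
      using less_cSupD[of "m ` D" "M - h"] Dne by blast
    have "(s1, {}, k) \<in> D" using s1 refl by (simp add: D_def)
    then obtain d1 where d1: "d1 \<in> D" "r d0 d1" "r (s1, {}, k) d1" using up[OF d0(1)] by blast
    have near: "x d \<in> H d1 \<and> g (x d) < M + h" if d: "d \<in> D" "r d1 d" for d
    proof -
      have "k \<le> snd (snd d)"
        using d1(3) d(2) by (auto simp: r_def split_beta)
      then have "1 / (real (snd (snd d)) + 1) \<le> 1 / (real k + 1)" by (intro frac_le) auto
      then have "g (x d) < M + h" using x(2)[OF d(1)] m_M[OF d(1)] k by linarith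
      then show ?thesis using x(1)[OF d(1)] H_anti[OF d1(1) d] by blast
    qed
    have "edist (fst (x d)) (fst (x d')) < e \<and> edist (snd (x d)) (snd (x d')) < e"
      if d: "d \<in> D" "d' \<in> D" "r d1 d" "r d1 d'" for d d'
    proof -
      obtain p n where p: "x d = (p, n)" by fastforce
      obtain p' n' where p': "x d' = (p', n')" by fastforce
      let ?q = "((\<lambda>f. (p f + p' f) / 2), (\<lambda>f. (n f + n' f) / 2))"
      have H1: "(p, n) \<in> H d1" "(p', n') \<in> H d1" "g (p, n) < M + h" "g (p', n') < M + h"
        using near[OF d(1,3)] near[OF d(2,4)] p p' by auto
      have V: "p \<in> energy_diff" "n \<in> energy_diff" "p' \<in> energy_diff" "n' \<in> energy_diff"
        using H_plus[OF H1(1)] H_plus[OF H1(2)] energy_plus_subset_diff by auto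
      have "?q \<in> H d1" using H1(1,2) unfolding H_def by (rule mid_hull.mid)
      then have "M - h < g ?q" using m_le[of ?q d1] d0(2) m_mono[OF d0(1) d1(1,2)] by simp
      moreover have "(nrm (\<lambda>f. p f - p' f))\<^sup>2 + (nrm (\<lambda>f. n f - n' f))\<^sup>2
          = 2 * g (p, n) + 2 * g (p', n') - 4 * g ?q"
        unfolding g_def fst_conv snd_conv
          energy_norm_parallelogram[OF V(1,3)] energy_norm_parallelogram[OF V(2,4)]
        by (simp add: algebra_simps)
      ultimately have "(nrm (\<lambda>f. p f - p' f))\<^sup>2 + (nrm (\<lambda>f. n f - n' f))\<^sup>2 < e\<^sup>2"
        using H1(3,4) by (simp add: h_def)
      then have "(nrm (\<lambda>f. p f - p' f))\<^sup>2 < e\<^sup>2" "(nrm (\<lambda>f. n f - n' f))\<^sup>2 < e\<^sup>2"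
        using zero_le_power2[of "nrm (\<lambda>f. p f - p' f)"]
          zero_le_power2[of "nrm (\<lambda>f. n f - n' f)"] by linarith+
      then show ?thesis
        using e by (auto simp: p p' energy_dist_eq intro: power_less_imp_less_base[of _ 2])
    qed
    then show ?thesis using d1(1) by blast
  qed
  have cauD: "Cauchy_net (edist) D r (\<lambda>d. fst (x d))"
    "Cauchy_net (edist) D r (\<lambda>d. snd (x d))"
    unfolding Cauchy_net_def using close by meson+
  have cl: "\<exists>d'\<in>D. r d d' \<and> fst (x d') \<in> U \<and> snd (x d') \<in> U'"
    if U: "openin vague_topology U" "P0 \<in> U" "openin vague_topology U'" "N0 \<in> U'" and d: "d \<in> D" for U U' d
  proof -
    obtain F e where F: "finite F" "F \<subseteq> Cc" "e > 0"
      "\<And>\<nu>. \<nu> \<in> radon \<Longrightarrow> \<forall>f\<in>F. \<bar>\<nu> f - P0 f\<bar> < e \<Longrightarrow> \<nu> \<in> U"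
      using vague_basic_neighbourhood[OF U(1,2)] by metis
    obtain F' e' where F': "finite F'" "F' \<subseteq> Cc" "e' > 0"
      "\<And>\<nu>. \<nu> \<in> radon \<Longrightarrow> \<forall>f\<in>F'. \<bar>\<nu> f - N0 f\<bar> < e' \<Longrightarrow> \<nu> \<in> U'"
      using vague_basic_neighbourhood[OF U(3,4)] by metis
    obtain k :: nat where k: "1 / (real k + 1) < min e e'"
      using F(3) F'(3) reals_Archimedean[of "min e e'"] by (auto simp: inverse_eq_divide add.commute)
    have "(s1, F \<union> F', k) \<in> D" using s1 refl F F' by (simp add: D_def)
    then obtain d' where d': "d' \<in> D" "r d d'" "r (s1, F \<union> F', k) d'" using up[OF d] by blast
    obtain s G n where e: "d' = (s, G, n)" by (metis prod_cases3)
    have G: "F \<union> F' \<subseteq> G" "k \<le> n" using d'(3) by (auto simp: r_def e)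
    then have le: "1 / (real n + 1) \<le> 1 / (real k + 1)" by (intro frac_le) auto
    have "x d' \<in> H (s, G, n)" using x(1)[OF d'(1)] e by simp
    then have nr: "\<bar>fst (x d') f - P0 f\<bar> < min e e' \<and> \<bar>snd (x d') f - N0 f\<bar> < min e e'" if "f \<in> G" for f
      using H_near[OF _ that] le k by fastforce
    have "fst (x d') \<in> radon" "snd (x d') \<in> radon"
      using H_plus[OF x(1)[OF d'(1)]] radon_plus_radon energy_plus_radon_plus by auto
    then have "fst (x d') \<in> U" "snd (x d') \<in> U'" using nr G(1) by (auto intro!: F(4) F'(4))
    then show ?thesis using d' by blast
  qed
  have radon0: "P0 \<in> radon" "N0 \<in> radon" using PN0 radon_plus_radon by auto
  \<comment> \<open>Taking the whole space as the neighbourhood of the other component separates the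
    joint statement \<open>cl\<close> into one for each component.\<close>
  have top: "openin vague_topology (radon :: 'a functional set)"
    using openin_topspace[of vague_topology] by (simp add: topspace_vague)
  have cluD: "net_cluster_point vague_topology D r (\<lambda>d. fst (x d)) P0"
    "net_cluster_point vague_topology D r (\<lambda>d. snd (x d)) N0"
    unfolding net_cluster_point_def topspace_vague
    using radon0 cl[OF _ _ top radon0(2)] cl[OF top radon0(1)] by blast+
  have xplus: "(\<lambda>d. fst (x d)) \<in> D \<rightarrow> \<E>" "(\<lambda>d. snd (x d)) \<in> D \<rightarrow> \<E>"
    using H_plus x(1) by blast+
  note lim1 = consistent_net[OF cons dirD xplus(1) cauD(1) cluD(1)]
    and lim2 = consistent_net[OF cons dirD xplus(2) cauD(2) cluD(2)]
  show E0: "P0 \<in> \<E>" "N0 \<in> \<E>"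
    using lim1 lim2 PN0 by (auto simp: energy_plus_def)
  show "((\<lambda>s. edist (\<lambda>f. P s f - N s f) (\<lambda>f. P0 f - N0 f)) \<longlongrightarrow> 0) (net_filter S le)"
    unfolding tendsto_iff
  proof (intro allI impI)
    fix e :: real assume e: "e > 0"
    \<comment> \<open>Two thirds of \<open>e\<close> pay for replacing \<open>p\<close> by
      \<open>P0\<close> and \<open>n\<close> by \<open>N0\<close>, the last third for the distance
      from \<open>p - n\<close> to the given net.\<close>
    then have "e / 3 > 0" by simp
    then obtain s0 where s0: "s0 \<in> S" "\<And>s t. s \<in> S \<Longrightarrow> t \<in> S \<Longrightarrow> le s0 s \<Longrightarrow> le s0 t \<Longrightarrow>
        edist (\<lambda>f. P s f - N s f) (\<lambda>f. P t f - N t f) < e / 3"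
      using cau unfolding Cauchy_net_def by meson
    obtain s2 where s2: "s2 \<in> S" "le s0 s2" "le s1 s2"
      using dir s0(1) s1 unfolding directed_set_def by blast
    have "\<forall>\<^sub>F d in net_filter D r. dist (edist (fst (x d)) P0) 0 < e / 3"
      "\<forall>\<^sub>F d in net_filter D r. dist (edist (snd (x d)) N0) 0 < e / 3"
      using lim1 lim2 \<open>e / 3 > 0\<close> unfolding tendsto_iff by blast+
    then have "\<forall>\<^sub>F d in net_filter D r. dist (edist (fst (x d)) P0) 0 < e / 3 \<and>
        dist (edist (snd (x d)) N0) 0 < e / 3" by (rule eventually_conj)
    then obtain d0 where d0: "d0 \<in> D" "\<And>d. d \<in> D \<Longrightarrow> r d0 d \<Longrightarrow>
        dist (edist (fst (x d)) P0) 0 < e / 3 \<and> dist (edist (snd (x d)) N0) 0 < e / 3"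
      unfolding eventually_net_filter[OF dirD] by blast
    \<comment> \<open>Without test functions an index imposes no vague condition, so this hull is
      generated by the whole tail beyond \<open>s2\<close>, where the differences are within
      \<open>e / 3\<close> of each other.\<close>
    have "(s2, {}, 0) \<in> D" using s2 by (simp add: D_def)
    then obtain d where d: "d \<in> D" "r d0 d" "r (s2, {}, 0) d" using up[OF d0(1)] by blast
    define p n where "p = fst (x d)" and "n = snd (x d)"
    have pn: "(p, n) \<in> H (s2, {}, 0)"
      using x(1)[OF d(1)] H_anti[OF \<open>(s2, {}, 0) \<in> D\<close> d(1,3)] by (auto simp: p_def n_def)
    have Ept: "p \<in> \<E>" "n \<in> \<E>" using H_plus[OF pn] by auto
    have V: "p \<in> energy_diff" "n \<in> energy_diff" "P0 \<in> energy_diff" "N0 \<in> energy_diff"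
      using Ept E0 energy_plus_subset_diff by auto
    have dn: "nrm (\<lambda>f. p f - P0 f) < e / 3" "nrm (\<lambda>f. n f - N0 f) < e / 3"
      using d0(2)[OF d(1,2)] by (auto simp: p_def n_def energy_dist_eq)
    have "nrm (\<lambda>f. (p f - P0 f) + -1 * (n f - N0 f))
        \<le> nrm (\<lambda>f. p f - P0 f) + nrm (\<lambda>f. -1 * (n f - N0 f))"
      by (intro energy_norm_triangle energy_diff_cmult energy_diff_diff V)
    also have "\<dots> < e / 3 + e / 3"
      using dn energy_norm_cmult[OF energy_diff_diff[OF V(2,4)], of "-1"] by linarith
    also have "(\<lambda>f. (p f - P0 f) + -1 * (n f - N0 f)) = (\<lambda>f. (p f - n f) - (P0 f - N0 f))" by auto
    finally have l: "nrm (\<lambda>f. (p f - n f) - (P0 f - N0 f)) < e / 3 + e / 3" .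
    have "dist (edist (\<lambda>f. P s f - N s f) (\<lambda>f. P0 f - N0 f)) 0 < e"
      if s: "s \<in> S" "le s0 s" for s
    proof -
      have Vs: "(\<lambda>f. P s f - N s f) \<in> energy_diff" using PN s by (auto intro: energy_diffI)
      \<comment> \<open>The closed ball of radius \<open>e / 3\<close> around
        \<open>P s - N s\<close> contains the differences from the tail, hence those of all pairs in
        the hull.\<close>
      have "nrm (\<lambda>f. (fst q f - snd q f) - (P s f - N s f)) \<le> e / 3"
        if "q \<in> H (s2, {}, 0)" for q
        using that unfolding H_def
      proof induction
        case (base q)
        then obtain t where t: "q = (P t, N t)" "t \<in> S" "le s2 t" by (auto simp: B_def)
        then show ?case
          using s0(2)[OF t(2) s(1) trans[OF s0(1) s2(1) t(2) s2(2) t(3)] s(2)]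
          by (simp add: energy_dist_eq)
      next
        case (mid p n p' n')
        have "p \<in> \<E>" "n \<in> \<E>" "p' \<in> \<E>" "n' \<in> \<E>"
          using mid.hyps H_plus unfolding H_def by fastforce+
        then have "nrm (\<lambda>f. ((p f - n f) + (p' f - n' f)) / 2 - (P s f - N s f)) \<le> e / 3"
          using mid.IH
          by (intro energy_norm_mean_diff energy_diffI[of p n] energy_diffI[of p' n'] Vs) auto
        moreover have "(\<lambda>f. ((p f - n f) + (p' f - n' f)) / 2 - (P s f - N s f))
            = (\<lambda>f. (p f + p' f) / 2 - (n f + n' f) / 2 - (P s f - N s f))"
          by (auto simp: field_simps)
        ultimately show ?case by simp
      qed
      from this[OF pn] have "nrm (\<lambda>f. (p f - n f) - (P s f - N s f)) \<le> e / 3" by simp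
      then have "nrm (\<lambda>f. (P s f - N s f) - (p f - n f)) \<le> e / 3"
        using energy_norm_minus_commute[OF Vs energy_diffI[OF Ept]] by simp
      then have "nrm (\<lambda>f. (P s f - N s f) - (P0 f - N0 f)) < e"
        using energy_norm_diff_triangle[OF Vs energy_diffI[OF Ept] energy_diffI[OF E0]] l by linarith
      then show ?thesis
        using energy_norm_nonneg[OF energy_diff_diff[OF Vs energy_diffI[OF E0]]]
        by (simp add: energy_dist_eq)
    qed
    then show "\<forall>\<^sub>F s in net_filter S le.
        dist (edist (\<lambda>f. P s f - N s f) (\<lambda>f. P0 f - N0 f)) 0 < e"
      unfolding eventually_net_filter[OF dir] using s0(1) by blast
  qed
qed

end

section \<open>Integrals of positive functions on closed sets\<close>

text \<open>The inequality with \<open>\<psi>\<close> is known on \<open>A\<close> only. Since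
  \<open>\<mu>\<close> is carried by \<open>A\<close>, the function may be altered away from
  \<open>A\<close>: lowered by a small \<open>d\<close> and multiplied by a cutoff near
  \<open>A \<inter> K\<close>, it becomes a minorant everywhere and loses at most
  \<open>e\<close>.\<close>

lemma radon_plus_le_integral_plus:
  fixes \<psi> :: "'b::t2_space \<Rightarrow> ereal"
  assumes lc: "locally_compact_space (euclidean :: 'b topology)"
    and \<mu>: "\<mu> \<in> radon_plus A" and A: "closed A" and \<psi>: "\<psi> \<in> Phi" "\<And>y. 0 \<le> \<psi> y"
    and f: "f \<in> Cc" "\<And>y. y \<in> A \<Longrightarrow> ereal (f y) \<le> \<psi> y"
  shows "ereal (\<mu> f) \<le> integral_plus \<mu> \<psi>"
proof (rule ereal_le_epsilon2)
  fix e :: real assume e: "0 < e"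
  note pos = radon_plus_positive[OF \<mu>] and lin = Cc_positive_linear[OF radon_plus_positive[OF \<mu>]]
  define K where "K = supp f"
  have K: "compact K" unfolding K_def by (rule Cc_compact_support[OF f(1)])
  have offK: "f y = 0" if "y \<notin> K" for y using zero_off_support[of y f] that by (simp add: K_def)
  obtain \<phi> W where \<phi>: "\<phi> \<in> Cc" "\<forall>y. 0 \<le> \<phi> y \<and> \<phi> y \<le> 1" "K \<subseteq> W" "\<forall>y\<in>W. \<phi> y = 1"
    using Urysohn_Cc[OF lc K open_UNIV subset_UNIV] by auto
  have \<mu>\<phi>: "0 \<le> \<mu> \<phi>" using \<phi>(2) by (intro Cc_positive_nonneg[OF pos]) auto
  \<comment> \<open>The \<open>+ 1\<close> keeps the denominator positive when
    \<open>\<mu> \<phi>\<close> is 0; lowering by \<open>d\<close> on the support costs at most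
    \<open>d * \<mu> \<phi>\<close>, hence at most \<open>e\<close>.\<close>
  define d where "d = e / (\<mu> \<phi> + 1)"
  have d: "0 < d" "d * \<mu> \<phi> \<le> e" using e \<mu>\<phi> by (auto simp: d_def field_simps)
  define U where "U = {y. ereal (f y - d) < \<psi> y}"
  \<comment> \<open>As \<open>\<psi>\<close> is only lower semicontinuous, the strict inequality is
    tested through intermediate real levels \<open>q\<close>, which exhibits \<open>U\<close> as a
    union of open sets.\<close>
  have "U = (\<Union>q. {y. f y - d < q} \<inter> {y. ereal q < \<psi> y})"
  proof (intro set_eqI iffI)
    fix y assume "y \<in> U"
    then obtain q where "ereal (f y - d) < ereal q" "ereal q < \<psi> y"
      unfolding U_def using ereal_dense2 by blast
    then show "y \<in> (\<Union>q. {y. f y - d < q} \<inter> {y. ereal q < \<psi> y})" by auto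
  next
    fix y assume "y \<in> (\<Union>q. {y. f y - d < q} \<inter> {y. ereal q < \<psi> y})"
    then obtain q where "ereal (f y - d) < ereal q" "ereal q < \<psi> y" by auto
    then show "y \<in> U" unfolding U_def using less_trans by blast
  qed
  moreover have "open {y. f y - d < q}" for q
    using Cc_continuous[OF f(1)] by (intro open_Collect_less continuous_intros)
  moreover have "open {y. ereal q < \<psi> y}" for q using \<psi>(1) by (auto simp: Phi_def)
  ultimately have U: "open U" by auto
  have "A \<inter> K \<subseteq> U"
  proof
    fix y assume "y \<in> A \<inter> K"
    then have "ereal (f y) \<le> \<psi> y" using f(2) by blast
    moreover have "ereal (f y - d) < ereal (f y)" using d(1) by simp
    ultimately show "y \<in> U" unfolding U_def by (metis (mono_tags) mem_Collect_eq order_less_le_trans)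
  qed
  moreover have "compact (A \<inter> K)" using K A by (metis compact_Int_closed inf_commute)
  ultimately obtain \<eta> V where \<eta>: "\<eta> \<in> Cc" "\<forall>y. 0 \<le> \<eta> y \<and> \<eta> y \<le> 1" "supp \<eta> \<subseteq> U"
      "open V" "A \<inter> K \<subseteq> V" "\<forall>y\<in>V. \<eta> y = 1"
    using Urysohn_Cc[OF lc _ U, of "A \<inter> K"] by blast
  define u where "u = (\<lambda>y. max (f y - d) 0)"
  define h where "h = (\<lambda>y. \<eta> y * u y)"
  have u: "u \<in> Cc" unfolding u_def by (rule Cc_pos_minus[OF f(1)]) (use d in simp)
  have h: "h \<in> Cc" unfolding h_def by (rule Cc_mult_left[OF u Cc_continuous[OF \<eta>(1)]])
  have "ereal (h y) \<le> \<psi> y" for y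
  proof (cases "y \<in> U")
    case True
    have "h y \<le> u y" using \<eta>(2) mult_left_le_one_le[of "u y" "\<eta> y"] by (simp add: h_def u_def)
    moreover have "ereal (u y) \<le> \<psi> y"
      using True \<psi>(2)[of y] by (auto simp: U_def u_def max_def zero_ereal_def[symmetric])
    ultimately show ?thesis using order_trans ereal_less_eq(3) by blast
  next
    case False
    then have "\<eta> y = 0" using \<eta>(3) zero_off_support[of y \<eta>] by blast
    then show ?thesis using \<psi>(2) by (simp add: h_def zero_ereal_def[symmetric])
  qed
  then have le: "ereal (\<mu> h) \<le> integral_plus \<mu> \<psi>" by (rule integral_plus_upper[OF h])
  have uh: "(\<lambda>y. u y - h y) \<in> Cc" by (rule Cc_diff[OF u h])
  have "closure {y. u y - h y \<noteq> 0} \<subseteq> K \<inter> - V"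
  proof (rule closure_minimal)
    have "u y = 0" if "y \<notin> K" for y using offK[OF that] d(1) by (simp add: u_def)
    then show "{y. u y - h y \<noteq> 0} \<subseteq> K \<inter> - V" using \<eta>(6) by (auto simp: h_def)
    show "closed (K \<inter> - V)" using K \<eta>(4) by (intro closed_Int compact_imp_closed closed_Compl)
  qed
  then have "closure {y. u y - h y \<noteq> 0} \<inter> A = {}" using \<eta>(5) by blast
  then have "\<mu> (\<lambda>y. u y - h y) = 0" by (rule radon_plus_off_support[OF \<mu> uh])
  then have \<mu>h: "\<mu> h = \<mu> u" using Cc_linear_diff[OF lin u h] by simp
  have "f y - u y \<le> d * \<phi> y" for y
    using \<phi>(2,3,4) offK[of y] d(1) by (cases "y \<in> K") (auto simp: u_def subset_iff)
  then have "\<mu> (\<lambda>y. f y - u y) \<le> \<mu> (\<lambda>y. d * \<phi> y)"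
    by (intro Cc_positive_mono[OF pos] Cc_diff f(1) u Cc_cmult \<phi>(1))
  then have "\<mu> f \<le> \<mu> h + e"
    using Cc_linear_diff[OF lin f(1) u] Cc_linear_cmult[OF lin \<phi>(1)] d(2) \<mu>h by simp
  then have "ereal (\<mu> f) \<le> ereal (\<mu> h) + ereal e" by simp
  also have "\<dots> \<le> integral_plus \<mu> \<psi> + ereal e" using le by (rule add_right_mono)
  finally show "ereal (\<mu> f) \<le> integral_plus \<mu> \<psi> + ereal e" .
qed

text \<open>Replaces the upper integral by inequalities on single test functions: each of them is a
  closed condition in the vague topology, and together they bound the evaluations.\<close>

lemma integral_on_le_iff:
  fixes \<mu> :: "'b::t2_space functional"
  assumes lc: "locally_compact_space (euclidean :: 'b topology)"
    and \<mu>: "\<mu> \<in> radon_plus A" and A: "closed A"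
    and g: "continuous_on A g" "\<And>x. x \<in> A \<Longrightarrow> 0 < g x"
  shows "integral_on A g \<mu> \<le> ereal a \<longleftrightarrow> (\<forall>f\<in>Cc. (\<forall>x\<in>A. f x \<le> g x) \<longrightarrow> \<mu> f \<le> a)"
proof
  assume le: "integral_on A g \<mu> \<le> ereal a"
  show "\<forall>f\<in>Cc. (\<forall>x\<in>A. f x \<le> g x) \<longrightarrow> \<mu> f \<le> a"
  proof (intro ballI impI)
    fix f assume f: "f \<in> Cc" "\<forall>x\<in>A. f x \<le> g x"
    have "ereal (\<mu> f) \<le> integral_on A g \<mu>"
      unfolding integral_on_def upper_integral_def
    proof (rule INF_greatest)
      fix \<psi> assume "\<psi> \<in> {\<psi> \<in> Phi. \<forall>y. (if y \<in> A then ereal (g y) else 0) \<le> \<psi> y}"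
      then have \<psi>: "\<psi> \<in> Phi" "\<And>y. (if y \<in> A then ereal (g y) else 0) \<le> \<psi> y" by auto
      have gA: "ereal (g y) \<le> \<psi> y" if "y \<in> A" for y using \<psi>(2)[of y] that by simp
      have "0 \<le> \<psi> y" for y
        using \<psi>(2)[of y] g(2)[of y] by (cases "y \<in> A") (auto intro: order_trans[of 0 "ereal (g y)"])
      moreover have "ereal (f y) \<le> \<psi> y" if "y \<in> A" for y
        using gA[OF that] f(2) that by (meson ereal_less_eq(3) order_trans)
      ultimately show "ereal (\<mu> f) \<le> integral_plus \<mu> \<psi>"
        by (intro radon_plus_le_integral_plus[OF lc \<mu> A \<psi>(1)] f(1)) auto
    qed
    then have "ereal (\<mu> f) \<le> ereal a" using le by (rule order_trans)
    then show "\<mu> f \<le> a" by simp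
  qed
next
  assume le: "\<forall>f\<in>Cc. (\<forall>x\<in>A. f x \<le> g x) \<longrightarrow> \<mu> f \<le> a"
  define \<psi> where "\<psi> = (\<lambda>x. if x \<in> A then ereal (g x) else \<infinity>)"
  have "open {y. c < \<psi> y}" for c
  proof (cases c)
    case (real r)
    obtain B where B: "closed B" "A \<inter> g -` {..r} = A \<inter> B"
      using continuous_on_closed_invariant[of A g] g(1) A closed_atMost[of r]
      by (metis closed_Int continuous_on_closed_vimage inf.left_idem inf_commute)
    then have "closed (A \<inter> g -` {..r})" using A by auto
    moreover have "{y. c < \<psi> y} = - (A \<inter> g -` {..r})" by (auto simp: \<psi>_def real not_le)
    ultimately show ?thesis by (metis open_Compl)
  next
    case MInf
    then have "{y. c < \<psi> y} = UNIV" by (auto simp: \<psi>_def)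
    then show ?thesis by simp
  qed (simp add: \<psi>_def)
  moreover have "0 \<le> \<psi> y" for y using g(2) by (auto simp: \<psi>_def less_imp_le)
  ultimately have "\<psi> \<in> Phi" by (auto simp: Phi_def \<psi>_def)
  then have "integral_on A g \<mu> \<le> integral_plus \<mu> \<psi>"
    unfolding integral_on_def upper_integral_def by (intro INF_lower) (auto simp: \<psi>_def)
  also have "\<dots> \<le> ereal a"
  proof (rule integral_plus_least)
    fix f assume f: "f \<in> Cc" "\<And>y. ereal (f y) \<le> \<psi> y"
    have "f x \<le> g x" if "x \<in> A" for x using f(2)[of x] that by (simp add: \<psi>_def)
    then show "ereal (\<mu> f) \<le> ereal a" using le f(1) by simp
  qed
  finally show "integral_on A g \<mu> \<le> ereal a" .
qed

section \<open>Vague compactness\<close>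

lemma continuous_map_vague_eval: "continuous_map vague_topology euclideanreal (\<lambda>\<nu>. \<nu> f)"
proof (cases "f \<in> Cc")
  case True
  have "continuous_map vague_topology euclideanreal ((\<lambda>\<phi>. \<phi> f) \<circ> (\<lambda>\<nu>. restrict \<nu> Cc))"
    unfolding vague_topology_def
    using True by (intro continuous_map_pullback continuous_map_product_projection)
  then show ?thesis using True by (simp add: o_def)
next
  case False
  have "continuous_map vague_topology euclideanreal (\<lambda>\<nu>. 0)" by simp
  then show ?thesis
    by (rule continuous_map_eq) (use False in \<open>auto simp: topspace_vague radon_def\<close>)
qed

text \<open>By \<open>integral_on_le_iff\<close> these are the measures on \<open>A\<close> whose
  integral of \<open>g\<close> is at most \<open>a\<close>, when \<open>A\<close> is closed and
  \<open>g\<close> is continuous and positive on it.\<close>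

definition bounded_measures ::
  "'b::topological_space set \<Rightarrow> ('b \<Rightarrow> real) \<Rightarrow> real \<Rightarrow> 'b functional set" where
  "bounded_measures A g a = {\<nu> \<in> radon_plus A. \<forall>f\<in>Cc. (\<forall>x\<in>A. f x \<le> g x) \<longrightarrow> \<nu> f \<le> a}"

text \<open>On the compact set where \<open>A\<close> meets the support of \<open>f\<close>, the
  positive function \<open>g\<close> has a minimum \<open>d > 0\<close>. With \<open>c\<close>
  bounding \<open>f\<close>, both multiples of \<open>f\<close> by \<open>d / c\<close> and
  \<open>- d / c\<close> stay below \<open>g\<close> on \<open>A\<close>, so the constraint applies
  to each.\<close>

lemma bounded_measures_eval_bound:
  fixes f :: "'b::t2_space \<Rightarrow> real"
  assumes A: "closed A" and g: "continuous_on A g" "\<And>x. x \<in> A \<Longrightarrow> 0 < g x" and f: "f \<in> Cc"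
  shows "\<exists>C. \<forall>\<nu>\<in>bounded_measures A g a. \<bar>\<nu> f\<bar> \<le> C"
proof (cases "A \<inter> supp f = {}")
  case True
  then have "\<nu> f = 0" if "\<nu> \<in> bounded_measures A g a" for \<nu>
    using that f by (auto simp: bounded_measures_def inf_commute intro: radon_plus_off_support)
  then show ?thesis by (intro exI[of _ 0]) simp
next
  case False
  let ?K = "supp f"
  have "compact (A \<inter> ?K)" using Cc_compact_support[OF f] A by (metis compact_Int_closed inf_commute)
  moreover have "continuous_on (A \<inter> ?K) g" using g(1) by (rule continuous_on_subset) simp
  ultimately obtain x0 where x0: "x0 \<in> A \<inter> ?K" "\<forall>y\<in>A \<inter> ?K. g x0 \<le> g y"
    using continuous_attains_inf[of "A \<inter> ?K" g] False by blast
  define d where "d = g x0"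
  have d: "d > 0" using g(2) x0 by (simp add: d_def)
  obtain c where c: "c > 0" "\<And>y. \<bar>f y\<bar> \<le> c" using Cc_bounded[OF f] by blast
  have "\<bar>\<nu> f\<bar> \<le> a * c / d" if \<nu>: "\<nu> \<in> bounded_measures A g a" for \<nu>
  proof -
    have lin: "Cc_linear \<nu>"
      using \<nu> Cc_positive_linear[OF radon_plus_positive] by (auto simp: bounded_measures_def)
    have le: "\<nu> (\<lambda>y. r * f y) \<le> a" if r: "\<bar>r\<bar> = d / c" for r
    proof -
      have "r * f x \<le> g x" if x: "x \<in> A" for x
      proof (cases "x \<in> ?K")
        case True
        have "r * f x \<le> \<bar>r\<bar> * \<bar>f x\<bar>" by (metis abs_ge_self abs_mult)
        also have "\<dots> \<le> d / c * c" unfolding r using c d by (intro mult_left_mono) auto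
        also have "\<dots> \<le> g x" using c True x x0(2) by (simp add: d_def)
        finally show ?thesis .
      next
        case False
        then show ?thesis using zero_off_support[OF False] g(2)[OF x] by simp
      qed
      then show ?thesis using \<nu> Cc_cmult[OF f] by (auto simp: bounded_measures_def)
    qed
    have "\<bar>d / c\<bar> = d / c" "\<bar>- (d / c)\<bar> = d / c" using d c by auto
    from le[OF this(1)] le[OF this(2)] have "d / c * \<nu> f \<le> a" "- (d / c * \<nu> f) \<le> a"
      unfolding Cc_linear_cmult[OF lin f] by auto
    then have "d / c * \<bar>\<nu> f\<bar> \<le> a" by (auto simp: abs_if)
    then show ?thesis using d c(1) by (simp add: field_simps)
  qed
  then show ?thesis by blast
qed

lemma closedin_Collect_Ball:
  assumes "\<And>i. i \<in> I \<Longrightarrow> closedin X {x \<in> topspace X. Q i x}"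
  shows "closedin X {x \<in> topspace X. \<forall>i\<in>I. Q i x}"
proof -
  have "{x \<in> topspace X. \<forall>i\<in>I. Q i x} = \<Inter> (insert (topspace X) ((\<lambda>i. {x \<in> topspace X. Q i x}) ` I))"
    by auto
  then show ?thesis using assms closedin_Inter[of "insert (topspace X) ((\<lambda>i. {x \<in> topspace X. Q i x}) ` I)" X]
    by auto
qed

text \<open>The argument of Banach and Alaoglu: uniform bounds on evaluations place the set in a
  compact cube, where it is cut out by closed conditions. A point satisfying them is linear and
  positive, hence a Radon measure by \<open>Cc_positive_radon\<close>.\<close>

lemma compactin_bounded_measures:
  fixes A :: "'b::t2_space set"
  assumes lc: "locally_compact_space (euclidean :: 'b topology)"
    and A: "closed A" and g: "continuous_on A g" "\<And>x. x \<in> A \<Longrightarrow> 0 < g x"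
  shows "compactin vague_topology (bounded_measures A g a)"
proof -
  have "\<forall>f\<in>Cc. \<exists>C. \<forall>\<nu>\<in>bounded_measures A g a. \<bar>\<nu> f\<bar> \<le> C"
    using A g by (intro ballI bounded_measures_eval_bound)
  then obtain C where C: "\<And>f \<nu>. f \<in> Cc \<Longrightarrow> \<nu> \<in> bounded_measures A g a \<Longrightarrow> \<bar>\<nu> f\<bar> \<le> C f"
    by metis
  define X where "X = product_topology (\<lambda>_. euclideanreal) (Cc :: ('b \<Rightarrow> real) set)"
  have tX: "topspace X = extensional Cc" by (simp add: X_def PiE_def)
  have proj: "continuous_map X euclideanreal (\<lambda>\<phi>. \<phi> f)" if "f \<in> Cc" for f
    unfolding X_def using that by (rule continuous_map_product_projection)
  have cl: "closedin X {\<phi> \<in> topspace X. F \<phi> \<in> B}" if "continuous_map X euclideanreal F" "closed B" for F B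
    using closedin_continuous_map_preimage[OF that(1)] that(2) by simp
  \<comment> \<open>Every clause says that a continuous expression in finitely many evaluations lies
    in a closed set of reals; the linear identities are written as vanishing differences for this
    reason.\<close>
  define Z where "Z = (\<Pi>\<^sub>E f\<in>Cc. {- C f..C f})
    \<inter> {\<phi> \<in> topspace X. \<forall>f\<in>Cc. \<forall>h\<in>Cc. \<phi> (\<lambda>y. f y + h y) - (\<phi> f + \<phi> h) \<in> {0}}
    \<inter> {\<phi> \<in> topspace X. \<forall>f\<in>Cc. \<forall>c\<in>UNIV. \<phi> (\<lambda>y. c * f y) - c * \<phi> f \<in> {0}}
    \<inter> {\<phi> \<in> topspace X. \<forall>f\<in>{f \<in> Cc. \<forall>y. 0 \<le> f y}. \<phi> f \<in> {0..}}
    \<inter> {\<phi> \<in> topspace X. \<forall>f\<in>{f \<in> Cc. supp f \<inter> A = {}}. \<phi> f \<in> {0}}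
    \<inter> {\<phi> \<in> topspace X. \<forall>f\<in>{f \<in> Cc. \<forall>x\<in>A. f x \<le> g x}. \<phi> f \<in> {..a}}"
  have "compactin X (\<Pi>\<^sub>E f\<in>Cc. {- C f..C f})"
    unfolding X_def by (subst compactin_PiE) auto
  then have Z: "compactin X Z"
    unfolding Z_def
    by (intro compact_Int_closedin closedin_Collect_Ball cl continuous_intros proj Cc_add Cc_cmult) auto
  \<comment> \<open>\<open>E\<close> undoes \<open>restrict\<close>: points of the product are
    \<open>undefined\<close> outside \<open>Cc\<close>, whereas functionals are 0 there.\<close>
  define E where "E = (\<lambda>(\<phi> :: ('b \<Rightarrow> real) \<Rightarrow> real) f. if f \<in> Cc then \<phi> f else 0)"
  have EZ: "E \<phi> \<in> bounded_measures A g a" if "\<phi> \<in> Z" for \<phi>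
  proof -
    have pos: "Cc_positive (E \<phi>)"
      using that unfolding Z_def Cc_positive_def Cc_linear_def E_def by (auto simp: Cc_add Cc_cmult)
    then have "E \<phi> \<in> radon_plus A"
      using that by (intro radon_plusI Cc_positive_radon[OF lc]) (auto simp: Z_def E_def)
    then show ?thesis using that by (auto simp: bounded_measures_def Z_def E_def)
  qed
  have "bounded_measures A g a \<subseteq> E ` Z"
  proof
    fix \<nu> assume \<nu>: "\<nu> \<in> bounded_measures A g a"
    then have lin: "Cc_linear \<nu>" and \<nu>A: "\<nu> \<in> radon_plus A"
      using Cc_positive_linear[OF radon_plus_positive] by (auto simp: bounded_measures_def)
    have "\<nu> = E (restrict \<nu> Cc)" using Cc_linear_off[OF lin] by (auto simp: E_def)
    moreover have "restrict \<nu> Cc \<in> Z"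
      using \<nu> C[OF _ \<nu>] Cc_linear_add[OF lin] Cc_linear_cmult[OF lin] radon_plus_off_support[OF \<nu>A]
        Cc_positive_nonneg[OF radon_plus_positive[OF \<nu>A]]
      by (auto simp: Z_def tX bounded_measures_def Cc_add Cc_cmult abs_le_iff minus_le_iff)
    ultimately show "\<nu> \<in> E ` Z" by blast
  qed
  with EZ have im: "bounded_measures A g a = E ` Z" by blast
  have sub: "Z \<subseteq> topspace X" by (rule compactin_subset_topspace[OF Z])
  have "continuous_map (subtopology X Z) vague_topology E"
    unfolding vague_topology_def
  proof (rule continuous_map_pullback')
    have "continuous_map (subtopology X Z) X (\<lambda>\<phi>. \<phi>)"
      by (intro continuous_map_from_subtopology) simp
    then show "continuous_map (subtopology X Z) (product_topology (\<lambda>_. euclideanreal) Cc)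
        ((\<lambda>\<nu>. restrict \<nu> Cc) \<circ> E)"
      unfolding X_def[symmetric]
      by (rule continuous_map_eq) (use sub in \<open>auto simp: tX E_def extensional_def fun_eq_iff\<close>)
    show "topspace (subtopology X Z) \<subseteq> E -` radon"
      using EZ sub by (auto simp: bounded_measures_def intro: radon_plus_radon)
  qed
  moreover have "compactin (subtopology X Z) Z" using Z by (simp add: compactin_subtopology)
  ultimately show ?thesis unfolding im by (intro image_compactin)
qed

text \<open>If no point of \<open>K\<close> is a cluster point, each has a neighbourhood that the
  net eventually avoids. Finitely many of these cover \<open>K\<close>, and by directedness some
  index lies beyond all the corresponding thresholds.\<close>

lemma compactin_net_cluster_point:
  assumes K: "compactin T K" and dir: "directed_set S le" and x: "x \<in> S \<rightarrow> K"
  shows "\<exists>l\<in>K. net_cluster_point T S le x l"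
proof (rule ccontr)
  assume no: "\<not> ?thesis"
  define \<U> where "\<U> = {U. openin T U \<and> (\<exists>s\<in>S. \<forall>t\<in>S. le s t \<longrightarrow> x t \<notin> U)}"
  have cover: "K \<subseteq> \<Union>\<U>"
  proof
    fix l assume l: "l \<in> K"
    then have "l \<in> topspace T" using compactin_subset_topspace[OF K] by blast
    moreover have "\<not> net_cluster_point T S le x l" using no l by blast
    ultimately obtain U where "openin T U" "l \<in> U" "\<exists>s\<in>S. \<forall>t\<in>S. le s t \<longrightarrow> x t \<notin> U"
      unfolding net_cluster_point_def by meson
    then show "l \<in> \<Union>\<U>" by (auto simp: \<U>_def)
  qed
  have "\<exists>\<F>. finite \<F> \<and> \<F> \<subseteq> \<U> \<and> K \<subseteq> \<Union>\<F>"
  proof (rule compactinD[OF K _ cover])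
    show "openin T U" if "U \<in> \<U>" for U using that unfolding \<U>_def by blast
  qed
  then obtain \<F> where F: "finite \<F>" "\<F> \<subseteq> \<U>" "K \<subseteq> \<Union>\<F>" by auto
  have "\<exists>s\<in>S. \<forall>t\<in>S. le s t \<longrightarrow> x t \<notin> \<Union>\<F>"
    using F(1,2)
  proof (induction \<F>)
    case empty
    have "S \<noteq> {}" using dir unfolding directed_set_def by blast
    then show ?case by auto
  next
    case (insert U \<F>)
    then obtain s where s: "s \<in> S" "\<forall>t\<in>S. le s t \<longrightarrow> x t \<notin> \<Union>\<F>" by auto
    obtain s' where s': "s' \<in> S" "\<forall>t\<in>S. le s' t \<longrightarrow> x t \<notin> U"
      using insert.prems by (auto simp: \<U>_def)
    obtain u where u: "u \<in> S" "le s u" "le s' u"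
      using dir s(1) s'(1) unfolding directed_set_def by blast
    have "le s t \<and> le s' t" if "t \<in> S" "le u t" for t
      using dir s(1) s'(1) u that unfolding directed_set_def by blast
    then have "\<forall>t\<in>S. le u t \<longrightarrow> x t \<notin> \<Union>(insert U \<F>)" using s(2) s'(2) by simp
    then show ?case by (rule bexI[OF _ u(1)])
  qed
  then obtain s where s: "s \<in> S" "\<forall>t\<in>S. le s t \<longrightarrow> x t \<notin> \<Union>\<F>" by auto
  moreover have "le s s" using dir s(1) unfolding directed_set_def by blast
  ultimately have "x s \<notin> \<Union>\<F>" by simp
  moreover have "x s \<in> K" using x s(1) by (rule funcset_mem)
  ultimately show False using F(3) by blast
qed

section \<open>Locally finite sums of measures\<close>

definition measure_family :: "('i \<Rightarrow> 'b::topological_space set) \<Rightarrow> 'i set \<Rightarrow> ('i \<Rightarrow> 'b functional) \<Rightarrow> bool" where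
  "measure_family A J \<mu> \<longleftrightarrow>
     (\<forall>K. compact K \<longrightarrow> finite {i \<in> J. A i \<inter> K \<noteq> {}}) \<and> (\<forall>i\<in>J. \<mu> i \<in> radon_plus (A i))"

text \<open>For a \<open>measure_family\<close> only finitely many terms are nonzero at any
  argument, so no convergence question is hidden in the infinite sum.\<close>

definition measure_sum :: "'i set \<Rightarrow> ('i \<Rightarrow> 'b functional) \<Rightarrow> 'b functional" where
  "measure_sum J \<mu> = (\<lambda>f. \<Sum>\<^sub>\<infinity>i\<in>J. \<mu> i f)"

lemma measure_family_finite:
  "measure_family A J \<mu> \<Longrightarrow> compact K \<Longrightarrow> finite {i \<in> J. A i \<inter> K \<noteq> {}}"
  and measure_family_radon_plus: "measure_family A J \<mu> \<Longrightarrow> i \<in> J \<Longrightarrow> \<mu> i \<in> radon_plus (A i)"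
  by (auto simp: measure_family_def)

lemma measure_family_positive: "measure_family A J \<mu> \<Longrightarrow> i \<in> J \<Longrightarrow> Cc_positive (\<mu> i)"
  and measure_family_linear: "measure_family A J \<mu> \<Longrightarrow> i \<in> J \<Longrightarrow> Cc_linear (\<mu> i)"
  and measure_family_radon_plus_UNIV: "measure_family A J \<mu> \<Longrightarrow> i \<in> J \<Longrightarrow> \<mu> i \<in> \<M>"
  for \<mu> :: "'i \<Rightarrow> 'b::t2_space functional"
  by (meson measure_family_radon_plus radon_plus_positive Cc_positive_linear radon_plus_subset_UNIV)+

lemma measure_family_subset: "measure_family A J \<mu> \<Longrightarrow> J' \<subseteq> J \<Longrightarrow> measure_family A J' \<mu>"
  unfolding measure_family_def by (blast intro: finite_subset[rotated])

text \<open>The finite set \<open>E\<close> may be larger than the set of contributing indices, so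
  that several test functions can share it.\<close>

lemma measure_sum_eq:
  assumes \<mu>: "measure_family A J \<mu>" and f: "f \<in> Cc" "\<And>y. y \<notin> K \<Longrightarrow> f y = 0" "closed K"
    and E: "finite E" "{i \<in> J. A i \<inter> K \<noteq> {}} \<subseteq> E" "E \<subseteq> J"
  shows "measure_sum J \<mu> f = (\<Sum>i\<in>E. \<mu> i f)"
proof -
  have "supp f \<subseteq> K" using f(2,3) by (intro closure_minimal) auto
  then have "\<mu> i f = 0" if "i \<in> J - E" for i
    using that E(2) f(1) by (intro radon_plus_off_support[OF measure_family_radon_plus[OF \<mu>]]) auto
  then have "measure_sum J \<mu> f = (\<Sum>\<^sub>\<infinity>i\<in>E. \<mu> i f)"
    unfolding measure_sum_def using E(3) by (intro infsum_cong_neutral) auto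
  then show ?thesis using E(1) by simp
qed

lemma measure_sum_radon_plus:
  fixes \<mu> :: "'i \<Rightarrow> 'b::t2_space functional"
  assumes lc: "locally_compact_space (euclidean :: 'b topology)" and \<mu>: "measure_family A J \<mu>"
  shows "measure_sum J \<mu> \<in> \<M>"
proof -
  \<comment> \<open>A single \<open>E\<close>, taken from the union of both supports, represents the
    sum at all the functions occurring in the linearity laws.\<close>
  have ex: "\<exists>E. finite E \<and> E \<subseteq> J \<and> measure_sum J \<mu> f = (\<Sum>i\<in>E. \<mu> i f) \<and>
      measure_sum J \<mu> h = (\<Sum>i\<in>E. \<mu> i h) \<and> measure_sum J \<mu> (\<lambda>y. f y + h y) = (\<Sum>i\<in>E. \<mu> i (\<lambda>y. f y + h y))
      \<and> measure_sum J \<mu> (\<lambda>y. c * f y) = (\<Sum>i\<in>E. \<mu> i (\<lambda>y. c * f y))"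
    if fh: "f \<in> Cc" "h \<in> Cc" for f h c
  proof -
    define K where "K = supp f \<union> supp h"
    have K: "compact K" "closed K" unfolding K_def using fh by (auto intro: Cc_compact_support)
    have off: "f y = 0" "h y = 0" if "y \<notin> K" for y
      using that zero_off_support[of y f] zero_off_support[of y h] by (auto simp: K_def)
    define E where "E = {i \<in> J. A i \<inter> K \<noteq> {}}"
    have E: "finite E" "{i \<in> J. A i \<inter> K \<noteq> {}} \<subseteq> E" "E \<subseteq> J"
      using measure_family_finite[OF \<mu> K(1)] by (auto simp: E_def)
    have "measure_sum J \<mu> f = (\<Sum>i\<in>E. \<mu> i f)" "measure_sum J \<mu> h = (\<Sum>i\<in>E. \<mu> i h)"
      "measure_sum J \<mu> (\<lambda>y. f y + h y) = (\<Sum>i\<in>E. \<mu> i (\<lambda>y. f y + h y))"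
      "measure_sum J \<mu> (\<lambda>y. c * f y) = (\<Sum>i\<in>E. \<mu> i (\<lambda>y. c * f y))"
      using off fh by (auto intro!: measure_sum_eq[OF \<mu> _ _ K(2) E] Cc_add Cc_cmult)
    then show ?thesis using E by blast
  qed
  have "Cc_positive (measure_sum J \<mu>)"
    unfolding Cc_positive_def Cc_linear_def
  proof (intro conjI allI ballI impI)
    show "measure_sum J \<mu> f = 0" if "f \<notin> Cc" for f
      unfolding measure_sum_def using Cc_linear_off[OF measure_family_linear[OF \<mu>] that]
      by (simp add: infsum_0)
  next
    fix f h :: "'b \<Rightarrow> real" assume fh: "f \<in> Cc" "h \<in> Cc"
    obtain E where E: "E \<subseteq> J" "measure_sum J \<mu> f = (\<Sum>i\<in>E. \<mu> i f)" "measure_sum J \<mu> h = (\<Sum>i\<in>E. \<mu> i h)"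
      "measure_sum J \<mu> (\<lambda>y. f y + h y) = (\<Sum>i\<in>E. \<mu> i (\<lambda>y. f y + h y))"
      using ex[OF fh, of 0] by auto
    have "\<mu> i (\<lambda>y. f y + h y) = \<mu> i f + \<mu> i h" if "i \<in> E" for i
      using that E(1) fh by (intro Cc_linear_add measure_family_linear[OF \<mu>]) auto
    then show "measure_sum J \<mu> (\<lambda>y. f y + h y) = measure_sum J \<mu> f + measure_sum J \<mu> h"
      by (simp add: E sum.distrib)
  next
    fix f :: "'b \<Rightarrow> real" and c assume f: "f \<in> Cc"
    obtain E where E: "E \<subseteq> J" "measure_sum J \<mu> f = (\<Sum>i\<in>E. \<mu> i f)"
      "measure_sum J \<mu> (\<lambda>y. c * f y) = (\<Sum>i\<in>E. \<mu> i (\<lambda>y. c * f y))"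
      using ex[OF f f, of c] by auto
    have "\<mu> i (\<lambda>y. c * f y) = c * \<mu> i f" if "i \<in> E" for i
      using that E(1) f by (intro Cc_linear_cmult measure_family_linear[OF \<mu>]) auto
    then show "measure_sum J \<mu> (\<lambda>y. c * f y) = c * measure_sum J \<mu> f"
      by (simp add: E sum_distrib_left)
  next
    fix f :: "'b \<Rightarrow> real" assume f: "f \<in> Cc" "\<forall>y. 0 \<le> f y"
    obtain E where E: "E \<subseteq> J" "measure_sum J \<mu> f = (\<Sum>i\<in>E. \<mu> i f)" using ex[OF f(1) f(1), of 0] by auto
    have "0 \<le> \<mu> i f" if "i \<in> E" for i
    proof (rule Cc_positive_nonneg[OF measure_family_positive[OF \<mu>]])
      show "i \<in> J" using that E(1) by blast
    qed (use f(2) in simp)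
    then show "0 \<le> measure_sum J \<mu> f" by (simp add: E sum_nonneg)
  qed
  then show ?thesis using Cc_positive_radon[OF lc] by (simp add: radon_plus_UNIV_iff)
qed

lemma Cc_sum:
  assumes "finite E" "\<And>j. j \<in> E \<Longrightarrow> u j \<in> Cc"
  shows "(\<lambda>y. \<Sum>j\<in>E. u j y) \<in> (Cc :: ('b::t2_space \<Rightarrow> real) set)"
  using assms by (induction E) (auto intro: Cc_zero Cc_add)

lemma Cc_linear_sum:
  fixes T :: "'b::t2_space functional"
  assumes T: "Cc_linear T" and "finite E" "\<And>j. j \<in> E \<Longrightarrow> u j \<in> Cc"
  shows "T (\<lambda>y. \<Sum>j\<in>E. u j y) = (\<Sum>j\<in>E. T (u j))"
  using assms(2,3) by (induction E) (auto simp: Cc_linear_zero[OF T] Cc_linear_add[OF T] Cc_sum)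

text \<open>The support of \<open>F\<close> lies in the product of its two compact projections, each
  of which meets only finitely many carriers; the iterated sums thus reduce to a finite rectangle of
  indices.\<close>

lemma tensor_measure_sum:
  fixes \<mu> :: "'i \<Rightarrow> 'b::t2_space functional" and \<mu>' :: "'j \<Rightarrow> 'c::t2_space functional"
  assumes \<mu>: "measure_family A J \<mu>" and \<mu>': "measure_family A' J' \<mu>'" and F: "F \<in> Cc"
    and E: "finite E" "{i \<in> J. A i \<inter> fst ` supp F \<noteq> {}} \<subseteq> E" "E \<subseteq> J"
    and E': "finite E'" "{j \<in> J'. A' j \<inter> snd ` supp F \<noteq> {}} \<subseteq> E'" "E' \<subseteq> J'"
  shows "tensor (measure_sum J \<mu>) (measure_sum J' \<mu>') F = (\<Sum>(i, j)\<in>E \<times> E'. tensor (\<mu> i) (\<mu>' j) F)"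
proof -
  let ?K = "fst ` supp F" and ?K' = "snd ` supp F"
  have K: "closed ?K" "closed ?K'"
    by (intro compact_imp_closed compact_continuous_image Cc_compact_support F continuous_intros)+
  have off: "F (x, y) = 0" if "x \<notin> ?K \<or> y \<notin> ?K'" for x y
    using that by (intro zero_off_support) force
  have 1: "measure_sum J' \<mu>' (\<lambda>y. F (x, y)) = (\<Sum>j\<in>E'. \<mu>' j (\<lambda>y. F (x, y)))" for x
    using off by (intro measure_sum_eq[OF \<mu>' Cc_slice[OF F] _ K(2) E']) auto
  define u where "u j = (\<lambda>x. \<mu>' j (\<lambda>y. F (x, y)))" for j
  have u: "u j \<in> Cc" if "j \<in> E'" for j
    unfolding u_def using that E'(3)
    by (intro Cc_partial_integral F radon_plus_radon[OF measure_family_radon_plus[OF \<mu>']]) auto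
  have "(\<Sum>j\<in>E'. u j x) = 0" if "x \<notin> ?K" for x
  proof -
    have "(\<lambda>y. F (x, y)) = (\<lambda>_. 0)" using off that by auto
    then have "u j x = 0" if "j \<in> E'" for j
      using that E'(3) Cc_linear_zero[OF measure_family_linear[OF \<mu>'], of j] by (auto simp: u_def)
    then show ?thesis by simp
  qed
  then have "measure_sum J \<mu> (\<lambda>x. \<Sum>j\<in>E'. u j x) = (\<Sum>i\<in>E. \<mu> i (\<lambda>x. \<Sum>j\<in>E'. u j x))"
    by (intro measure_sum_eq[OF \<mu> _ _ K(1) E] Cc_sum E'(1) u)
  also have "\<dots> = (\<Sum>i\<in>E. \<Sum>j\<in>E'. \<mu> i (u j))"
    using E(3) by (intro sum.cong refl Cc_linear_sum E'(1) u measure_family_linear[OF \<mu>]) auto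
  also have "\<dots> = (\<Sum>(i, j)\<in>E \<times> E'. tensor (\<mu> i) (\<mu>' j) F)"
    by (simp add: sum.cartesian_product tensor_def F u_def)
  finally show ?thesis by (simp add: tensor_def F 1 u_def)
qed

lemma tensor_family_positive:
  fixes \<mu> :: "'i \<Rightarrow> 'b::t2_space functional" and \<mu>' :: "'j \<Rightarrow> 'c::t2_space functional"
  assumes "measure_family A J \<mu>" "measure_family A' J' \<mu>'" "i \<in> J" "j \<in> J'"
  shows "Cc_positive (tensor (\<mu> i) (\<mu>' j))"
  by (rule tensor_positive[OF measure_family_radon_plus[OF assms(1,3)] measure_family_radon_plus[OF assms(2,4)]])

section \<open>Mutual energy of locally finite sums\<close>

context pd_kernel
begin

lemma integral_plus_sum:
  assumes "finite E" "\<And>p. p \<in> E \<Longrightarrow> Cc_positive (T p)"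
  shows "Cc_positive (\<lambda>F. \<Sum>p\<in>E. T p F) \<and>
    integral_plus (\<lambda>F. \<Sum>p\<in>E. T p F) \<kappa> = (\<Sum>p\<in>E. integral_plus (T p) \<kappa>)"
  using assms
proof (induction E)
  case empty
  then show ?case by (simp add: Cc_positive_zero integral_plus_zero[OF Phi])
next
  case (insert p E)
  then have T: "Cc_positive (T p)" "Cc_positive (\<lambda>F. \<Sum>p\<in>E. T p F)"
    and IH: "integral_plus (\<lambda>F. \<Sum>p\<in>E. T p F) \<kappa> = (\<Sum>p\<in>E. integral_plus (T p) \<kappa>)" by auto
  have "Cc_positive (\<lambda>F. T p F + (\<Sum>p\<in>E. T p F))"
    using Cc_positive_comb[OF T, of 1 1] by simp
  then show ?case
    using integral_plus_add[OF Phi T[THEN Cc_positive_imp_mono]] IH insert.hyps by simp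
qed

context
  fixes A :: "'i \<Rightarrow> 'a set" and J :: "'i set" and \<mu> :: "'i \<Rightarrow> 'a functional"
    and A' :: "'j \<Rightarrow> 'a set" and J' :: "'j set" and \<mu>' :: "'j \<Rightarrow> 'a functional"
  assumes \<mu>: "measure_family A J \<mu>" and \<mu>': "measure_family A' J' \<mu>'"
begin

lemma mutual_plus_measure_sum_rectangle:
  assumes "finite E" "E \<subseteq> J" "finite E'" "E' \<subseteq> J'"
  shows "Cc_positive (\<lambda>F. \<Sum>(i, j)\<in>E \<times> E'. tensor (\<mu> i) (\<mu>' j) F)"
    "integral_plus (\<lambda>F. \<Sum>(i, j)\<in>E \<times> E'. tensor (\<mu> i) (\<mu>' j) F) \<kappa>
      = (\<Sum>(i, j)\<in>E \<times> E'. mutual_plus (\<mu> i) (\<mu>' j))"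
proof -
  have "Cc_positive (tensor (\<mu> (fst p)) (\<mu>' (snd p)))" if "p \<in> E \<times> E'" for p
    using that assms by (intro tensor_family_positive[OF \<mu> \<mu>']) auto
  then have "Cc_positive (\<lambda>F. \<Sum>p\<in>E \<times> E'. tensor (\<mu> (fst p)) (\<mu>' (snd p)) F) \<and>
      integral_plus (\<lambda>F. \<Sum>p\<in>E \<times> E'. tensor (\<mu> (fst p)) (\<mu>' (snd p)) F) \<kappa>
        = (\<Sum>p\<in>E \<times> E'. integral_plus (tensor (\<mu> (fst p)) (\<mu>' (snd p))) \<kappa>)"
    using assms by (intro integral_plus_sum) auto
  then show "Cc_positive (\<lambda>F. \<Sum>(i, j)\<in>E \<times> E'. tensor (\<mu> i) (\<mu>' j) F)"
    "integral_plus (\<lambda>F. \<Sum>(i, j)\<in>E \<times> E'. tensor (\<mu> i) (\<mu>' j) F) \<kappa>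
      = (\<Sum>(i, j)\<in>E \<times> E'. mutual_plus (\<mu> i) (\<mu>' j))"
    by (simp_all add: mutual_plus_def case_prod_unfold)
qed

lemma finite_rectangle:
  assumes "F \<in> (Cc :: ('a \<times> 'a \<Rightarrow> real) set)"
  shows "finite {i \<in> J. A i \<inter> fst ` supp F \<noteq> {}}"
    "finite {j \<in> J'. A' j \<inter> snd ` supp F \<noteq> {}}"
  by (intro measure_family_finite[OF \<mu>] measure_family_finite[OF \<mu>'] compact_continuous_image
      Cc_compact_support assms continuous_intros)+

text \<open>A single minorant \<open>F\<close> of the kernel involves only a finite rectangle of
  indices, so a common bound for the rectangles passes to the supremum.\<close>

lemma mutual_plus_measure_sum_le:
  assumes le: "\<And>E E'. finite E \<Longrightarrow> E \<subseteq> J \<Longrightarrow> finite E' \<Longrightarrow> E' \<subseteq> J' \<Longrightarrow>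
    (\<Sum>(i, j)\<in>E \<times> E'. mutual_plus (\<mu> i) (\<mu>' j)) \<le> c"
  shows "mutual_plus (measure_sum J \<mu>) (measure_sum J' \<mu>') \<le> c"
  unfolding mutual_plus_def
proof (rule integral_plus_least)
  fix F assume F: "F \<in> Cc" "\<And>z. ereal (F z) \<le> \<kappa> z"
  define E E' where "E = {i \<in> J. A i \<inter> fst ` supp F \<noteq> {}}"
    and "E' = {j \<in> J'. A' j \<inter> snd ` supp F \<noteq> {}}"
  have E: "finite E" "E \<subseteq> J" "finite E'" "E' \<subseteq> J'"
    using finite_rectangle[OF F(1)] by (auto simp: E_def E'_def)
  have "tensor (measure_sum J \<mu>) (measure_sum J' \<mu>') F = (\<Sum>(i, j)\<in>E \<times> E'. tensor (\<mu> i) (\<mu>' j) F)"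
    using E by (intro tensor_measure_sum[OF \<mu> \<mu>' F(1)]) (auto simp: E_def E'_def)
  then have "ereal (tensor (measure_sum J \<mu>) (measure_sum J' \<mu>') F)
      \<le> integral_plus (\<lambda>F. \<Sum>(i, j)\<in>E \<times> E'. tensor (\<mu> i) (\<mu>' j) F) \<kappa>"
    using integral_plus_upper[OF F, of "\<lambda>F. \<Sum>(i, j)\<in>E \<times> E'. tensor (\<mu> i) (\<mu>' j) F"] by simp
  also have "\<dots> \<le> c" unfolding mutual_plus_measure_sum_rectangle(2)[OF E] by (rule le[OF E])
  finally show "ereal (tensor (measure_sum J \<mu>) (measure_sum J' \<mu>') F) \<le> c" .
qed

lemma mutual_plus_measure_sum_finite:
  assumes "finite J" "finite J'"
  shows "mutual_plus (measure_sum J \<mu>) (measure_sum J' \<mu>')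
    = (\<Sum>(i, j)\<in>J \<times> J'. mutual_plus (\<mu> i) (\<mu>' j))"
proof -
  have "tensor (measure_sum J \<mu>) (measure_sum J' \<mu>') = (\<lambda>F. \<Sum>(i, j)\<in>J \<times> J'. tensor (\<mu> i) (\<mu>' j) F)"
  proof
    fix F
    show "tensor (measure_sum J \<mu>) (measure_sum J' \<mu>') F = (\<Sum>(i, j)\<in>J \<times> J'. tensor (\<mu> i) (\<mu>' j) F)"
    proof (cases "F \<in> Cc")
      case True
      show ?thesis using assms by (intro tensor_measure_sum[OF \<mu> \<mu>' True]) auto
    qed (simp add: tensor_def case_prod_unfold)
  qed
  then show ?thesis
    unfolding mutual_plus_def[of "measure_sum J \<mu>"]
    using mutual_plus_measure_sum_rectangle(2)[of J J'] assms by simp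
qed

text \<open>For a nonnegative kernel a minorant may be replaced by its positive part. Enlarging the
  rectangle to all plates met by its support then only adds nonnegative terms.\<close>

lemma mutual_plus_measure_sum_ge:
  assumes pos: "\<And>z. 0 \<le> \<kappa> z" and E: "finite E" "E \<subseteq> J" "finite E'" "E' \<subseteq> J'"
  shows "(\<Sum>(i, j)\<in>E \<times> E'. mutual_plus (\<mu> i) (\<mu>' j)) \<le> mutual_plus (measure_sum J \<mu>) (measure_sum J' \<mu>')"
  unfolding mutual_plus_measure_sum_rectangle(2)[OF E, symmetric]
proof (rule integral_plus_least)
  fix F assume F: "F \<in> Cc" "\<And>z. ereal (F z) \<le> \<kappa> z"
  define F' where "F' = (\<lambda>z. max (F z) 0)"
  have F': "F' \<in> Cc" "\<And>z. 0 \<le> F' z" "\<And>z. F z \<le> F' z"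
    unfolding F'_def by (simp_all add: Cc_max_zero[OF F(1)])
  have F'\<kappa>: "ereal (F' z) \<le> \<kappa> z" for z
    using F(2)[of z] pos[of z] by (simp add: F'_def max_def zero_ereal_def[symmetric])
  define G G' where "G = {i \<in> J. A i \<inter> fst ` supp F' \<noteq> {}} \<union> E"
    and "G' = {j \<in> J'. A' j \<inter> snd ` supp F' \<noteq> {}} \<union> E'"
  have G: "finite G" "G \<subseteq> J" "finite G'" "G' \<subseteq> J'"
    using finite_rectangle[OF F'(1)] E by (auto simp: G_def G'_def)
  have nn: "0 \<le> tensor (\<mu> i) (\<mu>' j) F'" if "i \<in> J" "j \<in> J'" for i j
    by (rule Cc_positive_nonneg[OF tensor_family_positive[OF \<mu> \<mu>' that] F'(2)])
  have "(\<Sum>(i, j)\<in>E \<times> E'. tensor (\<mu> i) (\<mu>' j) F) \<le> (\<Sum>(i, j)\<in>E \<times> E'. tensor (\<mu> i) (\<mu>' j) F')"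
    by (rule Cc_positive_mono[OF mutual_plus_measure_sum_rectangle(1)[OF E] F(1) F'(1,3)])
  also have "\<dots> \<le> (\<Sum>(i, j)\<in>G \<times> G'. tensor (\<mu> i) (\<mu>' j) F')"
    using G nn by (intro sum_mono2) (auto simp: G_def G'_def)
  also have "\<dots> = tensor (measure_sum J \<mu>) (measure_sum J' \<mu>') F'"
    using G by (intro tensor_measure_sum[OF \<mu> \<mu>' F'(1), symmetric]) (auto simp: G_def G'_def)
  finally have "ereal (\<Sum>(i, j)\<in>E \<times> E'. tensor (\<mu> i) (\<mu>' j) F)
      \<le> ereal (tensor (measure_sum J \<mu>) (measure_sum J' \<mu>') F')" by simp
  also have "\<dots> \<le> mutual_plus (measure_sum J \<mu>) (measure_sum J' \<mu>')"
    unfolding mutual_plus_def by (rule integral_plus_upper[OF F'(1) F'\<kappa>])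
  finally show "ereal (\<Sum>(i, j)\<in>E \<times> E'. tensor (\<mu> i) (\<mu>' j) F)
      \<le> mutual_plus (measure_sum J \<mu>) (measure_sum J' \<mu>')" .
qed

end

lemma finite_subset_rectangle:
  assumes "finite G" "G \<subseteq> J \<times> J'"
  shows "finite (fst ` G)" "fst ` G \<subseteq> J" "finite (snd ` G)" "snd ` G \<subseteq> J'" "G \<subseteq> fst ` G \<times> snd ` G"
  using assms by force+

text \<open>The energy of a component is a diagonal term of the energy of the sum. In a finite sum
  with finite value no term is \<infinity>; for a nonnegative kernel the 1 by 1 rectangle gives the
  bound.\<close>

lemma measure_sum_energy_plus_component:
  assumes \<mu>: "measure_family A J \<mu>" and dich: "(\<forall>z. 0 \<le> \<kappa> z) \<or> finite J"
    and E: "measure_sum J \<mu> \<in> \<E>" and i: "i \<in> J"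
  shows "\<mu> i \<in> \<E>"
proof -
  have fin: "mutual_plus (measure_sum J \<mu>) (measure_sum J \<mu>) \<noteq> \<infinity>" using E by (simp add: energy_plus_iff)
  have "mutual_plus (\<mu> i) (\<mu> i) \<noteq> \<infinity>"
  proof (cases "finite J")
    case True
    then have "(\<Sum>(i, j)\<in>J \<times> J. mutual_plus (\<mu> i) (\<mu> j)) \<noteq> \<infinity>"
      using fin mutual_plus_measure_sum_finite[OF \<mu> \<mu>] by simp
    then show ?thesis
      using True i sum_Pinfty[of "\<lambda>(i, j). mutual_plus (\<mu> i) (\<mu> j)" "J \<times> J"] by auto
  next
    case False
    then show ?thesis
      using mutual_plus_measure_sum_ge[OF \<mu> \<mu>, of "{i}" "{i}"] dich i fin by auto
  qed
  then show ?thesis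
    using measure_family_radon_plus_UNIV[OF \<mu> i] by (simp add: energy_plus_iff)
qed

lemma measure_sum_energy_plusI:
  assumes lc: "locally_compact_space (euclidean :: 'a topology)"
    and \<mu>: "measure_family A J \<mu>" and E: "\<And>i. i \<in> J \<Longrightarrow> \<mu> i \<in> \<E>"
    and summ: "(\<lambda>(i, j). energy_form (\<mu> i) (\<mu> j)) summable_on J \<times> J"
  shows "measure_sum J \<mu> \<in> \<E>"
proof -
  have abs: "(\<lambda>p. \<bar>case p of (i, j) \<Rightarrow> energy_form (\<mu> i) (\<mu> j)\<bar>) summable_on J \<times> J"
    using summ summable_on_iff_abs_summable_on_real by (metis (no_types, lifting) real_norm_def summable_on_cong)
  let ?c = "\<Sum>\<^sub>\<infinity>p\<in>J \<times> J. \<bar>case p of (i, j) \<Rightarrow> energy_form (\<mu> i) (\<mu> j)\<bar>"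
  have "mutual_plus (measure_sum J \<mu>) (measure_sum J \<mu>) \<le> ereal ?c"
  proof (rule mutual_plus_measure_sum_le[OF \<mu> \<mu>])
    fix K K' assume K: "finite K" "K \<subseteq> J" "finite K'" "K' \<subseteq> J"
    have "(\<Sum>(i, j)\<in>K \<times> K'. mutual_plus (\<mu> i) (\<mu> j)) = (\<Sum>(i, j)\<in>K \<times> K'. ereal (energy_form (\<mu> i) (\<mu> j)))"
      using K E by (intro sum.cong refl) (auto simp: mutual_plus_eq subset_iff)
    also have "\<dots> = ereal (\<Sum>(i, j)\<in>K \<times> K'. energy_form (\<mu> i) (\<mu> j))"
      by (simp add: case_prod_unfold)
    also have "(\<Sum>(i, j)\<in>K \<times> K'. energy_form (\<mu> i) (\<mu> j))
        \<le> (\<Sum>p\<in>K \<times> K'. \<bar>case p of (i, j) \<Rightarrow> energy_form (\<mu> i) (\<mu> j)\<bar>)"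
      by (intro sum_mono) auto
    also have "\<dots> \<le> ?c" using K by (intro finite_sum_le_infsum abs) auto
    finally show "(\<Sum>(i, j)\<in>K \<times> K'. mutual_plus (\<mu> i) (\<mu> j)) \<le> ereal ?c" by simp
  qed
  then show ?thesis using measure_sum_radon_plus[OF lc \<mu>] by (auto simp: energy_plus_iff)
qed

text \<open>For finite families this is an identity of finite sums. Otherwise the kernel is
  nonnegative: every finite partial sum fits into a rectangle and is bounded by the energy of the
  sums, and conversely that energy is bounded by the total of the series.\<close>

lemma energy_form_measure_sum:
  assumes \<mu>: "measure_family A J \<mu>" and \<mu>': "measure_family A' J' \<mu>'"
    and dich: "(\<forall>z. 0 \<le> \<kappa> z) \<or> finite J \<and> finite J'"
    and E: "measure_sum J \<mu> \<in> \<E>" "measure_sum J' \<mu>' \<in> \<E>"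
  shows "((\<lambda>(i, j). energy_form (\<mu> i) (\<mu>' j)) has_sum
    energy_form (measure_sum J \<mu>) (measure_sum J' \<mu>')) (J \<times> J')"
proof -
  have comp: "\<mu> i \<in> \<E>" "\<mu>' j \<in> \<E>" if "i \<in> J" "j \<in> J'" for i j
    using measure_sum_energy_plus_component[OF \<mu> _ E(1) that(1)]
      measure_sum_energy_plus_component[OF \<mu>' _ E(2) that(2)] dich by auto
  have me: "(\<Sum>(i, j)\<in>G. mutual_plus (\<mu> i) (\<mu>' j)) = ereal (\<Sum>(i, j)\<in>G. energy_form (\<mu> i) (\<mu>' j))"
    if "G \<subseteq> J \<times> J'" for G
  proof -
    have "(\<Sum>(i, j)\<in>G. mutual_plus (\<mu> i) (\<mu>' j)) = (\<Sum>(i, j)\<in>G. ereal (energy_form (\<mu> i) (\<mu>' j)))"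
      using that comp by (intro sum.cong refl) (auto simp: mutual_plus_eq)
    then show ?thesis by (simp add: case_prod_unfold)
  qed
  show ?thesis
  proof (cases "finite J \<and> finite J'")
    case True
    then have "energy_form (measure_sum J \<mu>) (measure_sum J' \<mu>') = (\<Sum>(i, j)\<in>J \<times> J'. energy_form (\<mu> i) (\<mu>' j))"
      using mutual_plus_measure_sum_finite[OF \<mu> \<mu>'] me[of "J \<times> J'"] mutual_plus_eq[OF E] by simp
    then show ?thesis using True by simp
  next
    case False
    with dich have pos: "\<And>z. 0 \<le> \<kappa> z" by blast
    let ?v = "energy_form (measure_sum J \<mu>) (measure_sum J' \<mu>')"
    have nn: "0 \<le> energy_form (\<mu> i) (\<mu>' j)" if "i \<in> J" "j \<in> J'" for i j
    proof -
      have "ereal (tensor (\<mu> i) (\<mu>' j) (\<lambda>_. 0)) \<le> mutual_plus (\<mu> i) (\<mu>' j)"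
        unfolding mutual_plus_def using pos
        by (intro integral_plus_upper Cc_zero) (simp flip: zero_ereal_def)
      moreover have "tensor (\<mu> i) (\<mu>' j) (\<lambda>_. 0) = 0"
        by (rule Cc_linear_zero[OF Cc_positive_linear[OF tensor_family_positive[OF \<mu> \<mu>' that]]])
      ultimately show ?thesis using mutual_plus_eq[OF comp[OF that]] by simp
    qed
    have rect: "(\<Sum>(i, j)\<in>K \<times> K'. energy_form (\<mu> i) (\<mu>' j)) \<le> ?v"
      if K: "finite K" "K \<subseteq> J" "finite K'" "K' \<subseteq> J'" for K K'
    proof -
      have "K \<times> K' \<subseteq> J \<times> J'" using K by blast
      then show ?thesis
        using mutual_plus_measure_sum_ge[OF \<mu> \<mu>' pos K] mutual_plus_eq[OF E] by (simp add: me)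
    qed
    have le: "(\<Sum>(i, j)\<in>G. energy_form (\<mu> i) (\<mu>' j)) \<le> ?v" if G: "finite G" "G \<subseteq> J \<times> J'" for G
    proof -
      note R = finite_subset_rectangle[OF G]
      have "(\<Sum>(i, j)\<in>G. energy_form (\<mu> i) (\<mu>' j)) \<le> (\<Sum>(i, j)\<in>fst ` G \<times> snd ` G. energy_form (\<mu> i) (\<mu>' j))"
        using R(1,3,5) R(2,4)[THEN subsetD] by (intro sum_mono2) (auto intro!: nn)
      also have "\<dots> \<le> ?v" by (rule rect[OF R(1-4)])
      finally show ?thesis .
    qed
    have summ: "(\<lambda>(i, j). energy_form (\<mu> i) (\<mu>' j)) summable_on J \<times> J'"
      using nn le by (intro nonneg_bdd_above_summable_on bdd_aboveI[of _ ?v]) auto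
    let ?s = "\<Sum>\<^sub>\<infinity>(i, j)\<in>J \<times> J'. energy_form (\<mu> i) (\<mu>' j)"
    have "?s \<le> ?v" by (rule infsum_le_finite_sums[OF summ]) (rule le)
    moreover have "mutual_plus (measure_sum J \<mu>) (measure_sum J' \<mu>') \<le> ereal ?s"
    proof (rule mutual_plus_measure_sum_le[OF \<mu> \<mu>'])
      fix K K' assume K: "finite K" "K \<subseteq> J" "finite K'" "K' \<subseteq> J'"
      then have "K \<times> K' \<subseteq> J \<times> J'" by blast
      moreover have "(\<Sum>(i, j)\<in>K \<times> K'. energy_form (\<mu> i) (\<mu>' j)) \<le> ?s"
        using K nn by (intro finite_sum_le_infsum summ) auto
      ultimately show "(\<Sum>(i, j)\<in>K \<times> K'. mutual_plus (\<mu> i) (\<mu>' j)) \<le> ereal ?s" by (simp add: me)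
    qed
    ultimately have "?v = ?s" using mutual_plus_eq[OF E] by simp
    then show ?thesis using has_sum_infsum[OF summ] by simp
  qed
qed

end

section \<open>Vector measures on a condenser\<close>

text \<open>Testing on functions at most \<open>c\<close> on \<open>A\<close> shows that the mass is
  at most \<open>a / c\<close>. Scaling a slice of \<open>F\<close> by \<open>c' / M\<close> bounds
  its inner integral by \<open>M * a' / c'\<close> on \<open>A\<close>; a second scaling brings that
  function of \<open>x\<close> below \<open>c\<close>, where the outer constraint applies.\<close>

lemma (in pd_kernel) mutual_plus_bounded_measures:
  assumes \<mu>: "\<mu> \<in> bounded_measures A g a" and \<mu>': "\<mu>' \<in> bounded_measures A' g' a'"
    and g: "\<And>x. x \<in> A \<Longrightarrow> c \<le> g x" "\<And>y. y \<in> A' \<Longrightarrow> c' \<le> g' y"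
    and pos: "0 < c" "0 < c'" "0 < a'" "0 < M"
    and M: "\<And>x y. x \<in> A \<Longrightarrow> y \<in> A' \<Longrightarrow> \<kappa> (x, y) \<le> ereal M"
  shows "mutual_plus \<mu> \<mu>' \<le> ereal (M * ((a / c) * (a' / c')))"
  unfolding mutual_plus_def
proof (rule integral_plus_least)
  fix F assume F: "F \<in> Cc" "\<And>z. ereal (F z) \<le> \<kappa> z"
  have lin: "Cc_linear \<mu>" "Cc_linear \<mu>'" and rad: "\<mu>' \<in> radon"
    using \<mu> \<mu>' by (auto simp: bounded_measures_def intro: Cc_positive_linear radon_plus_positive radon_plus_radon)
  have le: "\<mu> f \<le> a" if "f \<in> Cc" "\<And>x. x \<in> A \<Longrightarrow> f x \<le> c" for f
    using \<mu> that g(1) unfolding bounded_measures_def by (blast intro: order_trans)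
  have le': "\<mu>' f \<le> a'" if "f \<in> Cc" "\<And>y. y \<in> A' \<Longrightarrow> f y \<le> c'" for f
    using \<mu>' that g(2) unfolding bounded_measures_def by (blast intro: order_trans)
  have FM: "F (x, y) \<le> M" if "x \<in> A" "y \<in> A'" for x y
    using order_trans[OF F(2)[of "(x, y)"] M[OF that]] by simp
  define u where "u = (\<lambda>x. \<mu>' (\<lambda>y. F (x, y)))"
  have u: "u \<in> Cc" unfolding u_def by (rule Cc_partial_integral[OF F(1) rad])
  have uA: "u x \<le> M * a' / c'" if x: "x \<in> A" for x
  proof -
    have "\<mu>' (\<lambda>y. c' / M * F (x, y)) \<le> a'"
    proof (rule le'[OF Cc_cmult[OF Cc_slice[OF F(1)]]])
      show "c' / M * F (x, y) \<le> c'" if "y \<in> A'" for y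
        using FM[OF x that] pos by (simp add: field_simps)
    qed
    then show ?thesis
      unfolding Cc_linear_cmult[OF lin(2) Cc_slice[OF F(1)]] u_def using pos by (simp add: field_simps)
  qed
  have "\<mu> (\<lambda>x. c * c' / (M * a') * u x) \<le> a"
  proof (rule le[OF Cc_cmult[OF u]])
    fix x assume "x \<in> A"
    have "c * c' / (M * a') * u x \<le> c * c' / (M * a') * (M * a' / c')"
      using pos by (intro mult_left_mono uA[OF \<open>x \<in> A\<close>]) auto
    then show "c * c' / (M * a') * u x \<le> c" using pos by simp
  qed
  then have "\<mu> u \<le> M * ((a / c) * (a' / c'))"
    unfolding Cc_linear_cmult[OF lin(1) u] using pos by (simp add: field_simps)
  then show "ereal (tensor \<mu> \<mu>' F) \<le> ereal (M * ((a / c) * (a' / c')))"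
    by (simp add: tensor_def F(1) u_def)
qed

locale condenser_kernel = pd_kernel \<kappa> for \<kappa> :: "'a::t2_space \<times> 'a \<Rightarrow> ereal" +
  fixes Ipos Ineg :: "nat set" and A :: "nat \<Rightarrow> 'a set"
  assumes lc: "locally_compact_space (euclidean :: 'a topology)"
    and cond: "condenser Ipos Ineg A"
begin

abbreviation "idx \<equiv> Ipos \<union> Ineg"

abbreviation "vmeasures \<equiv> vector_measures Ipos Ineg A"

abbreviation "vvague \<equiv> vector_vague_topology Ipos Ineg A"

abbreviation "vdist \<equiv> vector_dist \<kappa> Ipos Ineg"

abbreviation "pos_sum \<equiv> measure_sum Ipos"

abbreviation "neg_sum \<equiv> measure_sum Ineg"

definition resultant :: "(nat \<Rightarrow> 'a functional) \<Rightarrow> 'a functional" where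
  "resultant \<mu> = (\<lambda>f. pos_sum \<mu> f - neg_sum \<mu> f)"

lemma disjoint_signs: "Ipos \<inter> Ineg = {}"
  and closed_plate: "i \<in> idx \<Longrightarrow> closed (A i)"
  and nonempty_plate: "i \<in> idx \<Longrightarrow> A i \<noteq> {}"
  and finite_plates: "compact K \<Longrightarrow> finite {i \<in> idx. A i \<inter> K \<noteq> {}}"
  using cond by (auto simp: condenser_def)

text \<open>Negative values are allowed in \<open>Phi\<close> only if the product space is compact.
  Then so is its projection, the whole space, which every nonempty plate meets, and local finiteness
  leaves finitely many plates.\<close>

lemma kernel_nonneg_or_finite: "(\<forall>z. 0 \<le> \<kappa> z) \<or> finite idx"
proof (cases "\<forall>z. 0 \<le> \<kappa> z")
  case False
  then have "compact (UNIV :: ('a \<times> 'a) set)" using Phi by (auto simp: Phi_def)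
  then have "compact (fst ` (UNIV :: ('a \<times> 'a) set))"
    by (intro compact_continuous_image continuous_intros)
  then have "finite {i \<in> idx. A i \<inter> UNIV \<noteq> {}}" by (intro finite_plates) (simp add: fst_image_times[of UNIV UNIV, simplified])
  moreover have "{i \<in> idx. A i \<inter> UNIV \<noteq> {}} = idx" using nonempty_plate by auto
  ultimately show ?thesis by simp
qed simp

lemma vector_measures_family:
  assumes "\<mu> \<in> vmeasures" "J \<subseteq> idx"
  shows "measure_family A J \<mu>"
proof -
  have "measure_family A idx \<mu>"
    using assms(1) finite_plates by (auto simp: measure_family_def vector_measures_def)
  then show ?thesis using assms(2) by (rule measure_family_subset)
qed

lemma vector_measures_sum_radon_plus:
  assumes "\<mu> \<in> vmeasures"
  shows "pos_sum \<mu> \<in> \<M>" "neg_sum \<mu> \<in> \<M>"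
  using measure_sum_radon_plus[OF lc vector_measures_family[OF assms]] by auto

text \<open>The working form of \<open>vector_energy_space\<close> (see
  \<open>vector_energy_space_iff\<close>): two energies of positive measures in place of an
  absolutely convergent double series.\<close>

definition finite_energy :: "(nat \<Rightarrow> 'a functional) \<Rightarrow> bool" where
  "finite_energy \<mu> \<longleftrightarrow> \<mu> \<in> vmeasures \<and>
     pos_sum \<mu> \<in> \<E> \<and> neg_sum \<mu> \<in> \<E>"

lemma resultant_energy_diff: "finite_energy \<mu> \<Longrightarrow> resultant \<mu> \<in> energy_diff"
  unfolding finite_energy_def resultant_def by (blast intro: energy_diffI)

lemma finite_energy_component:
  assumes "finite_energy \<mu>" "i \<in> idx"
  shows "\<mu> i \<in> \<E>"
proof -
  have \<mu>: "\<mu> \<in> vmeasures" using assms(1) by (simp add: finite_energy_def)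
  have "(\<forall>z. 0 \<le> \<kappa> z) \<or> finite Ipos" "(\<forall>z. 0 \<le> \<kappa> z) \<or> finite Ineg"
    using kernel_nonneg_or_finite by auto
  then show ?thesis
    using assms measure_sum_energy_plus_component[OF vector_measures_family[OF \<mu>]]
    by (auto simp: finite_energy_def)
qed

text \<open>On each of the four blocks of positive and negative indices the product of signs is
  constant, so \<open>energy_form_measure_sum\<close> applies blockwise; the four sums recombine by
  \<open>energy_form_diff\<close>.\<close>

lemma energy_form_resultant:
  assumes fe: "finite_energy \<mu>" "finite_energy \<nu>"
  shows "((\<lambda>(i, j). csign Ineg i * csign Ineg j * energy_form (\<mu> i) (\<nu> j)) has_sum
    energy_form (resultant \<mu>) (resultant \<nu>)) (idx \<times> idx)"
proof -
  have M: "\<mu> \<in> vmeasures" "\<nu> \<in> vmeasures"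
    and E: "pos_sum \<mu> \<in> \<E>" "neg_sum \<mu> \<in> \<E>"
      "pos_sum \<nu> \<in> \<E>" "neg_sum \<nu> \<in> \<E>"
    using fe by (auto simp: finite_energy_def)
  let ?t = "\<lambda>(i, j). csign Ineg i * csign Ineg j * energy_form (\<mu> i) (\<nu> j)"
  have block: "(?t has_sum s * s' * energy_form (measure_sum J \<mu>) (measure_sum J' \<nu>)) (J \<times> J')"
    if J: "J \<subseteq> idx" "J' \<subseteq> idx"
      and e: "measure_sum J \<mu> \<in> \<E>" "measure_sum J' \<nu> \<in> \<E>"
      and s: "\<And>i. i \<in> J \<Longrightarrow> csign Ineg i = s" "\<And>j. j \<in> J' \<Longrightarrow> csign Ineg j = s'" for J J' s s'
  proof -
    have "(\<forall>z. 0 \<le> \<kappa> z) \<or> finite J \<and> finite J'"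
      using kernel_nonneg_or_finite J finite_subset by blast
    from has_sum_cmult_right[OF energy_form_measure_sum[OF vector_measures_family[OF M(1) J(1)]
        vector_measures_family[OF M(2) J(2)] this e], of "s * s'"]
    show ?thesis by (rule has_sum_cong[THEN iffD1, rotated]) (use s in auto)
  qed
  have s: "csign Ineg i = 1" if "i \<in> Ipos" for i using that disjoint_signs by (auto simp: csign_def)
  have s': "csign Ineg i = -1" if "i \<in> Ineg" for i using that by (simp add: csign_def)
  have 1: "(?t has_sum (1 * 1 * energy_form (pos_sum \<mu>) (pos_sum \<nu>)
        + 1 * -1 * energy_form (pos_sum \<mu>) (neg_sum \<nu>))
      + (-1 * 1 * energy_form (neg_sum \<mu>) (pos_sum \<nu>)
        + -1 * -1 * energy_form (neg_sum \<mu>) (neg_sum \<nu>)))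
      ((Ipos \<times> Ipos \<union> Ipos \<times> Ineg) \<union> (Ineg \<times> Ipos \<union> Ineg \<times> Ineg))"
    using disjoint_signs by (intro has_sum_Un_disjoint block E s s') auto
  have 2: "(Ipos \<times> Ipos \<union> Ipos \<times> Ineg) \<union> (Ineg \<times> Ipos \<union> Ineg \<times> Ineg)
      = idx \<times> idx" by blast
  have 3: "energy_form (resultant \<mu>) (resultant \<nu>)
      = (1 * 1 * energy_form (pos_sum \<mu>) (pos_sum \<nu>)
        + 1 * -1 * energy_form (pos_sum \<mu>) (neg_sum \<nu>))
      + (-1 * 1 * energy_form (neg_sum \<mu>) (pos_sum \<nu>)
        + -1 * -1 * energy_form (neg_sum \<mu>) (neg_sum \<nu>))"
    unfolding resultant_def energy_form_diff(3)[OF E] by simp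
  show ?thesis using 1 unfolding 2 3 .
qed

text \<open>Signs disappear under absolute values, and a real family is summable exactly when it is
  absolutely summable. Restricting the series to a square of index sets gives finite energy of the
  partial sums; conversely \<open>energy_form_resultant\<close> supplies the summability.\<close>

lemma vector_energy_space_iff: "\<mu> \<in> vector_energy_space \<kappa> Ipos Ineg A \<longleftrightarrow> finite_energy \<mu>"
proof
  assume \<mu>: "\<mu> \<in> vector_energy_space \<kappa> Ipos Ineg A"
  then have M: "\<mu> \<in> vmeasures"
    and fin: "\<And>i. i \<in> idx \<Longrightarrow> \<bar>mutual \<kappa> (\<mu> i) (\<mu> i)\<bar> < \<infinity>"
    and summ: "(\<lambda>(i, j). \<bar>csign Ineg i * csign Ineg j * real_of_ereal (mutual \<kappa> (\<mu> i) (\<mu> j))\<bar>)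
       summable_on idx \<times> idx"
    by (auto simp: vector_energy_space_def)
  have E: "\<mu> i \<in> \<E>" if "i \<in> idx" for i
    using fin[OF that] measure_family_radon_plus_UNIV[OF vector_measures_family[OF M order_refl] that]
    by (auto simp: energy_plus_iff mutual_positive)
  have "\<bar>csign Ineg i * csign Ineg j * x\<bar> = \<bar>x\<bar>" for i j x by (simp add: csign_def)
  then have "(\<lambda>p. norm (case p of (i, j) \<Rightarrow> energy_form (\<mu> i) (\<mu> j)))
      summable_on idx \<times> idx"
    using summ by (simp add: case_prod_unfold energy_form_def)
  then have "(\<lambda>(i, j). energy_form (\<mu> i) (\<mu> j)) summable_on idx \<times> idx"
    by (rule summable_on_iff_abs_summable_on_real[THEN iffD2])
  then have "measure_sum J \<mu> \<in> \<E>" if "J \<subseteq> idx" for J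
    using that E by (intro measure_sum_energy_plusI[OF lc vector_measures_family[OF M]])
      (auto intro: summable_on_subset)
  then show "finite_energy \<mu>" using M by (simp add: finite_energy_def)
next
  assume fe: "finite_energy \<mu>"
  have E: "\<mu> i \<in> \<E>" if "i \<in> idx" for i
    by (rule finite_energy_component[OF fe that])
  have "mutual_defined \<kappa> (\<mu> i) (\<mu> j) \<and> \<bar>mutual \<kappa> (\<mu> i) (\<mu> j)\<bar> < \<infinity>"
    if "i \<in> idx" "j \<in> idx" for i j
    using E[OF that(1)] E[OF that(2)] by (simp add: mutual_positive energy_plus_radon_plus mutual_plus_eq)
  moreover have "(\<lambda>(i, j). \<bar>csign Ineg i * csign Ineg j * real_of_ereal (mutual \<kappa> (\<mu> i) (\<mu> j))\<bar>)
       summable_on idx \<times> idx"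
    using summable_on_iff_abs_summable_on_real[THEN iffD1,
        OF has_sum_imp_summable[OF energy_form_resultant[OF fe fe]]]
    by (simp add: case_prod_unfold energy_form_def)
  ultimately show "\<mu> \<in> vector_energy_space \<kappa> Ipos Ineg A"
    using fe by (simp add: vector_energy_space_def finite_energy_def)
qed

text \<open>Each term expands into four energies of positive measures whose double series are summed
  by \<open>energy_form_resultant\<close>; the same expansion for the resultants reassembles the
  four sums.\<close>

lemma vector_dist_eq:
  assumes fe: "finite_energy \<mu>" "finite_energy \<nu>"
  shows "vdist \<mu> \<nu> = edist (resultant \<mu>) (resultant \<nu>)"
proof -
  let ?R = resultant and ?I = "idx"
  let ?t = "\<lambda>\<mu> \<nu>. \<lambda>(i, j). csign Ineg i * csign Ineg j * energy_form (\<mu> i) (\<nu> j)"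
  have "((\<lambda>p. (?t \<mu> \<mu> p + ?t \<nu> \<nu> p) + (- ?t \<mu> \<nu> p + - ?t \<nu> \<mu> p)) has_sum
      (energy_form (?R \<mu>) (?R \<mu>) + energy_form (?R \<nu>) (?R \<nu>))
        + (- energy_form (?R \<mu>) (?R \<nu>) + - energy_form (?R \<nu>) (?R \<mu>))) (?I \<times> ?I)"
    by (intro has_sum_add has_sum_uminusI energy_form_resultant fe)
  also have "?this \<longleftrightarrow> ((\<lambda>(i, j). csign Ineg i * csign Ineg j
      * real_of_ereal (mutual \<kappa> (\<mu> i - \<nu> i) (\<mu> j - \<nu> j))) has_sum
      (energy_form (?R \<mu>) (?R \<mu>) + energy_form (?R \<nu>) (?R \<nu>))
        + (- energy_form (?R \<mu>) (?R \<nu>) + - energy_form (?R \<nu>) (?R \<mu>))) (?I \<times> ?I)"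
  proof (rule has_sum_cong)
    fix p assume "p \<in> ?I \<times> ?I"
    then obtain i j where p: "p = (i, j)" "i \<in> ?I" "j \<in> ?I" by blast
    have expand: "real_of_ereal (mutual \<kappa> (\<mu> i - \<nu> i) (\<mu> j - \<nu> j))
        = energy_form (\<mu> i) (\<mu> j) + energy_form (\<nu> i) (\<nu> j) - energy_form (\<mu> i) (\<nu> j) - energy_form (\<nu> i) (\<mu> j)"
      unfolding fun_diff_def energy_form_def[symmetric] using p fe
      by (intro energy_form_diff(3) finite_energy_component)
    show "(?t \<mu> \<mu> p + ?t \<nu> \<nu> p) + (- ?t \<mu> \<nu> p + - ?t \<nu> \<mu> p)
        = (case p of (i, j) \<Rightarrow> csign Ineg i * csign Ineg j
          * real_of_ereal (mutual \<kappa> (\<mu> i - \<nu> i) (\<mu> j - \<nu> j)))"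
      unfolding p(1) prod.case expand by (simp add: algebra_simps)
  qed
  finally have s: "(\<Sum>\<^sub>\<infinity>(i, j)\<in>?I \<times> ?I. csign Ineg i * csign Ineg j
      * real_of_ereal (mutual \<kappa> (\<mu> i - \<nu> i) (\<mu> j - \<nu> j)))
      = (energy_form (?R \<mu>) (?R \<mu>) + energy_form (?R \<nu>) (?R \<nu>))
        + (- energy_form (?R \<mu>) (?R \<nu>) + - energy_form (?R \<nu>) (?R \<mu>))"
    by (rule infsumI)
  have "energy_form (\<lambda>f. ?R \<mu> f - ?R \<nu> f) (\<lambda>f. ?R \<mu> f - ?R \<nu> f)
      = (energy_form (?R \<mu>) (?R \<mu>) + energy_form (?R \<nu>) (?R \<nu>))
        + (- energy_form (?R \<mu>) (?R \<nu>) + - energy_form (?R \<nu>) (?R \<mu>))"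
    using energy_form_comb[OF resultant_energy_diff[OF fe(1)] resultant_energy_diff[OF fe(2)], of 1 "-1"]
    by (simp add: algebra_simps)
  then show ?thesis unfolding vector_dist_def energy_dist_eq energy_norm_eq s by simp
qed

text \<open>Only finitely many plates meet the support of a test function. Disjointness permits a
  cutoff equal to 1 near \<open>A i\<close> on that support and supported off the other plates met,
  so the resultant of the cut-off function is the value of the i-th component up to its
  sign.\<close>

lemma resultant_inject:
  assumes dis: "disjoint_family_on A idx"
    and M: "\<mu> \<in> vmeasures" "\<nu> \<in> vmeasures"
    and eq: "resultant \<mu> = resultant \<nu>"
  shows "\<mu> = \<nu>"
proof -
  let ?I = "idx"
  have "\<mu> i f = \<nu> i f" if i: "i \<in> ?I" and f: "f \<in> Cc" for i f
  proof -
    define K where "K = supp f"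
    have K: "compact K" unfolding K_def by (rule Cc_compact_support[OF f])
    define B where "B = (\<Union>j\<in>{j \<in> ?I. A j \<inter> K \<noteq> {}} - {i}. A j)"
    have "closed B" unfolding B_def using finite_plates[OF K] by (intro closed_UN) (auto intro: closed_plate)
    then have U: "open (- B)" by (rule open_Compl)
    have "A i \<inter> K \<subseteq> - B" using dis i by (fastforce simp: B_def disjoint_family_on_def)
    moreover have "compact (A i \<inter> K)" using K closed_plate[OF i] by (metis compact_Int_closed inf_commute)
    ultimately obtain \<eta> V where \<eta>: "\<eta> \<in> Cc" "supp \<eta> \<subseteq> - B"
        "open V" "A i \<inter> K \<subseteq> V" "\<forall>y\<in>V. \<eta> y = 1"
      using Urysohn_Cc[OF lc _ U, of "A i \<inter> K"] by blast
    define h where "h = (\<lambda>y. \<eta> y * f y)"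
    have h: "h \<in> Cc" unfolding h_def by (rule Cc_mult_left[OF f Cc_continuous[OF \<eta>(1)]])
    have "{y. h y \<noteq> 0} \<subseteq> {y. f y \<noteq> 0}" "{y. h y \<noteq> 0} \<subseteq> {y. \<eta> y \<noteq> 0}" by (auto simp: h_def)
    then have sh: "supp h \<subseteq> K" "supp h \<subseteq> - B"
      using closure_mono \<eta>(2) unfolding K_def by blast+
    have "closure {y. f y - h y \<noteq> 0} \<subseteq> K \<inter> - V"
    proof (rule closure_minimal)
      have "f y = 0" if "y \<notin> K" for y using zero_off_support[of y f] that by (simp add: K_def)
      then show "{y. f y - h y \<noteq> 0} \<subseteq> K \<inter> - V" using \<eta>(5) by (auto simp: h_def)
      show "closed (K \<inter> - V)" using K \<eta>(3) by (intro closed_Int compact_imp_closed closed_Compl)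
    qed
    then have off: "closure {y. f y - h y \<noteq> 0} \<inter> A i = {}" using \<eta>(4) by blast
    have res: "resultant \<rho> h = csign Ineg i * \<rho> i f" if \<rho>: "\<rho> \<in> vmeasures" for \<rho>
    proof -
      have \<rho>A: "\<rho> j \<in> radon_plus (A j)" if "j \<in> ?I" for j using \<rho> that by (auto simp: vector_measures_def)
      have "\<rho> i (\<lambda>y. f y - h y) = 0" by (rule radon_plus_off_support[OF \<rho>A[OF i] Cc_diff[OF f h] off])
      then have fh: "\<rho> i f = \<rho> i h"
        using Cc_linear_diff[OF radon_linear[OF radon_plus_radon[OF \<rho>A[OF i]]] f h] by simp
      have z: "\<rho> j h = 0" if "j \<in> ?I" "j \<noteq> i" for j
      proof (rule radon_plus_off_support[OF \<rho>A[OF that(1)] h])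
        show "supp h \<inter> A j = {}"
          using sh that by (cases "A j \<inter> K = {}") (auto simp: B_def)
      qed
      have ms: "measure_sum J \<rho> h = (if i \<in> J then \<rho> i h else 0)" if "J \<subseteq> ?I" for J
      proof -
        have "measure_sum J \<rho> h = (\<Sum>\<^sub>\<infinity>j\<in>J \<inter> {i}. \<rho> j h)"
          unfolding measure_sum_def using z that by (intro infsum_cong_neutral) auto
        then show ?thesis by auto
      qed
      show ?thesis
        using i disjoint_signs by (auto simp: resultant_def ms fh csign_def)
    qed
    have "csign Ineg i \<noteq> 0" by (simp add: csign_def)
    then show ?thesis using res[OF M(1)] res[OF M(2)] eq by simp
  qed
  moreover have "\<mu> i f = \<nu> i f" if "i \<in> ?I" "f \<notin> Cc" for i f
    using M that by (auto simp: vector_measures_def radon_plus_def radon_def PiE_iff)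
  ultimately have "\<mu> i = \<nu> i" if "i \<in> ?I" for i using that by blast
  then show ?thesis
    using M unfolding vector_measures_def by (intro PiE_ext[of \<mu> ?I "\<lambda>i. radon_plus (A i)" \<nu>])
qed

end

section \<open>Strong completeness\<close>

lemma openin_Collect_Ball_finite:
  assumes "finite I" "\<And>i. i \<in> I \<Longrightarrow> openin X {x \<in> topspace X. Q i x}"
  shows "openin X {x \<in> topspace X. \<forall>i\<in>I. Q i x}"
  using assms
proof (induction I)
  case (insert i I)
  have "{x \<in> topspace X. \<forall>j\<in>insert i I. Q j x}
      = {x \<in> topspace X. Q i x} \<inter> {x \<in> topspace X. \<forall>j\<in>I. Q j x}" by auto
  then show ?case using insert by (simp add: openin_Int)
qed simp

context condenser_kernel
begin

lemma topspace_vector_vague: "topspace (vvague) = vmeasures"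
proof -
  have "radon \<inter> radon_plus (A i) = radon_plus (A i)" for i using radon_plus_radon by blast
  then show ?thesis
    by (simp add: vector_vague_topology_def vector_measures_def topspace_vague)
qed

lemma continuous_map_vector_eval:
  assumes "i \<in> idx"
  shows "continuous_map (vvague) euclideanreal (\<lambda>\<mu>. \<mu> i f)"
proof -
  have "continuous_map (vvague)
      (subtopology vague_topology (radon_plus (A i))) (\<lambda>\<mu>. \<mu> i)"
    unfolding vector_vague_topology_def using assms by (rule continuous_map_product_projection)
  then have "continuous_map (vvague) vague_topology (\<lambda>\<mu>. \<mu> i)"
    by (rule continuous_map_into_fulltopology)
  then have "continuous_map (vvague) euclideanreal ((\<lambda>\<nu>. \<nu> f) \<circ> (\<lambda>\<mu>. \<mu> i))"
    using continuous_map_vague_eval by (rule continuous_map_compose)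
  then show ?thesis by (simp add: o_def)
qed

text \<open>The finitely many plates meeting the support of \<open>f\<close> do not depend on the
  vector measure, so the sum is one fixed finite sum of evaluations.\<close>

lemma continuous_map_measure_sum:
  assumes f: "f \<in> Cc" and J: "J \<subseteq> idx"
  shows "continuous_map (vvague) euclideanreal (\<lambda>\<mu>. measure_sum J \<mu> f)"
proof -
  define E where "E = {i \<in> idx. A i \<inter> supp f \<noteq> {}} \<inter> J"
  have E: "finite E" "{i \<in> J. A i \<inter> supp f \<noteq> {}} \<subseteq> E" "E \<subseteq> J"
    using finite_plates[OF Cc_compact_support[OF f]] J by (auto simp: E_def)
  have "continuous_map (vvague) euclideanreal (\<lambda>\<mu>. \<Sum>i\<in>E. \<mu> i f)"
    using E J by (intro continuous_map_sum continuous_map_vector_eval) auto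
  then show ?thesis
  proof (rule continuous_map_eq)
    fix \<mu> assume "\<mu> \<in> topspace (vvague)"
    then have "\<mu> \<in> vmeasures" by (simp add: topspace_vector_vague)
    then have "measure_sum J \<mu> f = (\<Sum>i\<in>E. \<mu> i f)"
    proof (rule measure_sum_eq[OF vector_measures_family[OF _ J] f _ closed_closure E])
      show "f y = 0" if "y \<notin> supp f" for y by (rule zero_off_support[OF that])
    qed
    then show "(\<Sum>i\<in>E. \<mu> i f) = measure_sum J \<mu> f" by simp
  qed
qed

end

locale constrained_condenser = condenser_kernel \<kappa> Ipos Ineg A
  for \<kappa> :: "'a::t2_space \<times> 'a \<Rightarrow> ereal" and Ipos Ineg A +
  fixes a :: "nat \<Rightarrow> real" and g :: "nat \<Rightarrow> 'a \<Rightarrow> real"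
  assumes cons: "consistent \<kappa>"
    and a_pos: "i \<in> Ipos \<union> Ineg \<Longrightarrow> 0 < a i"
    and g_cont: "i \<in> Ipos \<union> Ineg \<Longrightarrow> continuous_on (A i) (g i)"
    and g_pos: "i \<in> Ipos \<union> Ineg \<Longrightarrow> x \<in> A i \<Longrightarrow> 0 < g i x"
    and bound: "Ineg = {} \<or>
         (\<Sum>\<^sub>\<infinity>i\<in>Ipos \<union> Ineg. ennreal (a i) * inverse (ennreal (INF x\<in>A i. g i x))) < \<infinity> \<and>
         (SUP (x, y)\<in>(\<Union>i\<in>Ipos. A i) \<times> (\<Union>j\<in>Ineg. A j). \<kappa> (x, y)) < \<infinity>"
begin

section \<open>Uniform bounds for admissible vector measures\<close>

abbreviation "plate_measures i \<equiv> bounded_measures (A i) (g i) (a i)"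

abbreviation "admissible \<equiv> vector_energy_le \<kappa> Ipos Ineg A a g"

lemma admissible_iff:
  "\<mu> \<in> admissible \<longleftrightarrow>
    finite_energy \<mu> \<and> (\<forall>i\<in>idx. \<mu> i \<in> plate_measures i)"
proof -
  have "integral_on (A i) (g i) (\<mu> i) \<le> ereal (a i) \<longleftrightarrow> \<mu> i \<in> plate_measures i"
    if "finite_energy \<mu>" "i \<in> idx" for i
  proof -
    have "\<mu> i \<in> radon_plus (A i)" using that by (auto simp: finite_energy_def vector_measures_def)
    then show ?thesis
      using integral_on_le_iff[OF lc _ closed_plate[OF that(2)] g_cont[OF that(2)] g_pos[OF that(2)], of "\<mu> i" "a i"]
      by (simp add: bounded_measures_def)
  qed
  then show ?thesis by (auto simp: vector_energy_le_def vector_energy_space_iff)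
qed

lemma total_mass_bound:
  assumes "Ineg \<noteq> {}"
  obtains L where "0 \<le> L" "\<And>i. i \<in> idx \<Longrightarrow> 0 < (INF x\<in>A i. g i x)"
    "\<And>E. finite E \<Longrightarrow> E \<subseteq> idx \<Longrightarrow> (\<Sum>i\<in>E. a i / (INF x\<in>A i. g i x)) \<le> L"
proof -
  let ?c = "\<lambda>i. INF x\<in>A i. g i x" and ?I = "idx"
  let ?m = "\<lambda>i. ennreal (a i) * inverse (ennreal (?c i))"
  let ?s = "\<Sum>\<^sub>\<infinity>i\<in>?I. ?m i"
  have fin: "?s < \<infinity>" using bound assms by simp
  have le: "sum ?m E \<le> ?s" if "finite E" "E \<subseteq> ?I" for E
    using that by (subst nonneg_infsum_complete) (auto intro!: SUP_upper)
  have c: "0 < ?c i" if i: "i \<in> ?I" for i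
  proof (rule ccontr)
    assume "\<not> 0 < ?c i"
    \<comment> \<open>\<open>ennreal\<close> sends a nonpositive infimum to 0, whose inverse is
      \<infinity>; as \<open>a i\<close> is positive, the whole term would be infinite. Convergence
      of the series thus contains positivity of every infimum.\<close>
    then have "ennreal (?c i) = 0" by (simp add: ennreal_neg not_less)
    then have "?m i = \<infinity>" using a_pos[OF i] by (simp add: ennreal_mult_eq_top_iff)
    moreover have "?m i \<le> ?s" using le[of "{i}"] i by simp
    ultimately show False using fin by simp
  qed
  have m: "?m i = ennreal (a i / ?c i)" if "i \<in> ?I" for i
    using a_pos[OF that] c[OF that] by (simp add: inverse_ennreal ennreal_mult[symmetric] divide_inverse)
  have "(\<Sum>i\<in>E. a i / ?c i) \<le> enn2real ?s" if E: "finite E" "E \<subseteq> ?I" for E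
  proof -
    have nn: "0 \<le> a i / ?c i" if "i \<in> E" for i
      using that E(2) a_pos c by (intro divide_nonneg_nonneg) (auto intro: less_imp_le)
    have "ennreal (\<Sum>i\<in>E. a i / ?c i) = (\<Sum>i\<in>E. ennreal (a i / ?c i))"
      by (rule sum_ennreal[OF nn, symmetric])
    also have "\<dots> = sum ?m E" using E(2) by (intro sum.cong refl m[symmetric]) auto
    also have "\<dots> \<le> ?s" by (rule le[OF E])
    finally have "enn2real (ennreal (\<Sum>i\<in>E. a i / ?c i)) \<le> enn2real ?s"
      using fin by (intro enn2real_mono) auto
    then show ?thesis using nn by (simp add: sum_nonneg)
  qed
  then show ?thesis using c by (intro that[of "enn2real ?s"]) auto
qed

lemma mutual_energy_bound:
  obtains C where "\<And>\<mu>. \<mu> \<in> admissible \<Longrightarrow> energy_form (pos_sum \<mu>) (neg_sum \<mu>) \<le> C"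
    "\<And>\<mu>. \<mu> \<in> admissible \<Longrightarrow> energy_form (neg_sum \<mu>) (pos_sum \<mu>) \<le> C"
proof (cases "Ineg = {}")
  case True
  \<comment> \<open>Without negative plates \<open>neg_sum\<close> gives the zero functional, that
    is 0 times \<open>\<sigma>\<close>, so homogeneity makes the cross energies vanish.\<close>
  have "energy_form \<sigma> (neg_sum \<mu>) = 0 \<and> energy_form (neg_sum \<mu>) \<sigma> = 0"
    if "\<sigma> \<in> \<E>" for \<sigma> \<mu>
    using energy_form_cmult_left[OF energy_plus_subset_diff[OF that] energy_plus_subset_diff[OF that], of 0]
      energy_form_cmult_right[OF energy_plus_subset_diff[OF that] energy_plus_subset_diff[OF that], of 0]
    by (simp add: True measure_sum_def)
  then show ?thesis by (intro that[of 0]) (auto simp: admissible_iff finite_energy_def)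
next
  case False
  let ?c = "\<lambda>i. INF x\<in>A i. g i x" and ?I = "idx"
  obtain L where L: "0 \<le> L" "\<And>i. i \<in> ?I \<Longrightarrow> 0 < ?c i"
    "\<And>E. finite E \<Longrightarrow> E \<subseteq> ?I \<Longrightarrow> (\<Sum>i\<in>E. a i / ?c i) \<le> L"
    using total_mass_bound[OF False] by blast
  let ?S = "SUP (x, y)\<in>(\<Union>i\<in>Ipos. A i) \<times> (\<Union>j\<in>Ineg. A j). \<kappa> (x, y)"
  have "?S < \<infinity>" using bound False by simp
  \<comment> \<open>The maximum with 1 is positive whatever the supremum is; the latter may be
    negative, or -\<infinity> when there are no positive plates.\<close>
  define M where "M = max 1 (real_of_ereal ?S)"
  have M: "0 < M" "?S \<le> ereal M" using \<open>?S < \<infinity>\<close> by (cases ?S; simp add: M_def)+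
  have \<kappa>M: "\<kappa> (x, y) \<le> ereal M" if "x \<in> A i" "y \<in> A j" "i \<in> Ipos" "j \<in> Ineg" for x y i j
  proof -
    have "\<kappa> (x, y) \<le> ?S" using that by (intro SUP_upper2[of "(x, y)"]) auto
    then show ?thesis using M(2) by (rule order_trans)
  qed
  have sym: "\<kappa> (x, y) = \<kappa> (y, x)" for x y using pd by (simp add: positive_definite_def)
  have gc: "?c i \<le> g i x" if "i \<in> ?I" "x \<in> A i" for i x
    using that g_pos by (intro cINF_lower bdd_belowI[of _ 0]) (auto intro: less_imp_le)
  have key: "energy_form (measure_sum J \<mu>) (measure_sum J' \<mu>) \<le> M * (L * L)"
    if \<mu>: "\<mu> \<in> admissible" and J: "J \<subseteq> ?I" "J' \<subseteq> ?I"
      and \<kappa>J: "\<And>i j x y. i \<in> J \<Longrightarrow> j \<in> J' \<Longrightarrow> x \<in> A i \<Longrightarrow> y \<in> A j \<Longrightarrow> \<kappa> (x, y) \<le> ereal M"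
      and e: "measure_sum J \<mu> \<in> \<E>" "measure_sum J' \<mu> \<in> \<E>" for \<mu> J J'
  proof -
    have V: "\<mu> \<in> vmeasures" and b: "\<And>i. i \<in> ?I \<Longrightarrow> \<mu> i \<in> plate_measures i"
      using \<mu> by (auto simp: admissible_iff finite_energy_def)
    have "mutual_plus (measure_sum J \<mu>) (measure_sum J' \<mu>) \<le> ereal (M * (L * L))"
    proof (rule mutual_plus_measure_sum_le[OF vector_measures_family[OF V J(1)] vector_measures_family[OF V J(2)]])
      fix E E' assume E: "finite E" "E \<subseteq> J" "finite E'" "E' \<subseteq> J'"
      have "(\<Sum>(i, j)\<in>E \<times> E'. mutual_plus (\<mu> i) (\<mu> j))
          \<le> (\<Sum>(i, j)\<in>E \<times> E'. ereal (M * ((a i / ?c i) * (a j / ?c j))))"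
      proof (rule sum_mono)
        fix p assume "p \<in> E \<times> E'"
        then obtain i j where p: "p = (i, j)" "i \<in> J" "j \<in> J'" using E by blast
        then have ij: "i \<in> ?I" "j \<in> ?I" using J by auto
        have "mutual_plus (\<mu> i) (\<mu> j) \<le> ereal (M * ((a i / ?c i) * (a j / ?c j)))"
          by (rule mutual_plus_bounded_measures[OF b[OF ij(1)] b[OF ij(2)] gc[OF ij(1)] gc[OF ij(2)]
                L(2)[OF ij(1)] L(2)[OF ij(2)] a_pos[OF ij(2)] M(1) \<kappa>J[OF p(2,3)]])
        then show "(case p of (i, j) \<Rightarrow> mutual_plus (\<mu> i) (\<mu> j))
            \<le> (case p of (i, j) \<Rightarrow> ereal (M * ((a i / ?c i) * (a j / ?c j))))" by (simp add: p(1))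
      qed
      also have "\<dots> = ereal (\<Sum>(i, j)\<in>E \<times> E'. M * ((a i / ?c i) * (a j / ?c j)))"
        by (simp only: case_prod_unfold sum_ereal)
      also have "(\<Sum>(i, j)\<in>E \<times> E'. M * (m i * m j)) = M * (sum m E * sum m E')" for m :: "nat \<Rightarrow> real"
        by (subst sum_product, subst sum.cartesian_product, subst sum_distrib_left)
          (simp add: case_prod_unfold)
      also have "(\<Sum>i\<in>E. a i / ?c i) * (\<Sum>j\<in>E'. a j / ?c j) \<le> L * L"
      proof (rule mult_mono[OF L(3) L(3) L(1)])
        show "0 \<le> (\<Sum>j\<in>E'. a j / ?c j)"
        proof (rule sum_nonneg)
          fix j assume "j \<in> E'"
          then have "j \<in> ?I" using E(4) J(2) by blast
          then show "0 \<le> a j / ?c j" using a_pos[of j] L(2)[of j] by simp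
        qed
      qed (use E J in auto)
      finally show "(\<Sum>(i, j)\<in>E \<times> E'. mutual_plus (\<mu> i) (\<mu> j)) \<le> ereal (M * (L * L))"
        using M(1) by (simp add: mult_left_mono)
    qed
    then show ?thesis using mutual_plus_eq[OF e] by simp
  qed
  show ?thesis
  proof (rule that[of "M * (L * L)"])
    fix \<mu> assume \<mu>: "\<mu> \<in> admissible"
    then have e: "pos_sum \<mu> \<in> \<E>" "neg_sum \<mu> \<in> \<E>"
      by (auto simp: admissible_iff finite_energy_def)
    show "energy_form (pos_sum \<mu>) (neg_sum \<mu>) \<le> M * (L * L)"
      by (rule key[OF \<mu> _ _ _ e]) (auto intro: \<kappa>M)
    show "energy_form (neg_sum \<mu>) (pos_sum \<mu>) \<le> M * (L * L)"
    proof (rule key[OF \<mu> _ _ _ e(2,1)])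
      show "\<kappa> (x, y) \<le> ereal M" if "i \<in> Ineg" "j \<in> Ipos" "x \<in> A i" "y \<in> A j" for i j x y
        using \<kappa>M[OF that(4,3,2,1)] sym by simp
    qed auto
  qed
qed

section \<open>Vague cluster points of strong Cauchy nets\<close>

lemma cluster_point_exists:
  fixes S :: "'s set"
  assumes dir: "directed_set S le" and x: "x \<in> S \<rightarrow> admissible"
  shows "\<exists>\<mu>. net_cluster_point (vvague) S le x \<mu>"
proof -
  let ?K = "\<Pi>\<^sub>E i\<in>idx. plate_measures i"
  have "compactin (vvague) ?K"
    unfolding vector_vague_topology_def compactin_PiE compactin_subtopology
  proof (intro disjI2 ballI conjI)
    fix i assume i: "i \<in> idx"
    show "compactin vague_topology (plate_measures i)"
      using g_pos[OF i] by (intro compactin_bounded_measures[OF lc closed_plate[OF i] g_cont[OF i]])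
  qed (auto simp: bounded_measures_def)
  moreover have "x \<in> S \<rightarrow> ?K"
  proof
    fix s assume "s \<in> S"
    then have "x s \<in> admissible" using x by blast
    then show "x s \<in> ?K" by (auto simp: admissible_iff finite_energy_def vector_measures_def PiE_iff)
  qed
  ultimately show ?thesis using compactin_net_cluster_point[OF _ dir] by blast
qed

text \<open>Violation of the constraint would show on one test function, hence on a vague
  neighbourhood of \<open>\<mu>\<close>, which the net visits although all its members obey the
  constraint.\<close>

lemma cluster_point_bounded_measures:
  assumes x: "x \<in> S \<rightarrow> admissible" and dir: "directed_set S le"
    and cl: "net_cluster_point (vvague) S le x \<mu>" and i: "i \<in> idx"
  shows "\<mu> i \<in> plate_measures i"
proof -
  let ?T = "vvague"
  have M: "\<mu> \<in> topspace ?T" using cl by (simp add: net_cluster_point_def)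
  obtain s0 where s0: "s0 \<in> S" using dir unfolding directed_set_def by blast
  have "\<mu> i f \<le> a i" if f: "f \<in> Cc" "\<forall>x\<in>A i. f x \<le> g i x" for f
  proof (rule ccontr)
    assume "\<not> \<mu> i f \<le> a i"
    define U where "U = {\<nu> \<in> topspace ?T. \<nu> i f \<in> {a i<..}}"
    have "openin ?T U" unfolding U_def
      by (rule openin_continuous_map_preimage[OF continuous_map_vector_eval[OF i]]) simp
    moreover have "\<mu> \<in> U" using M \<open>\<not> \<mu> i f \<le> a i\<close> by (simp add: U_def)
    ultimately obtain t where t: "t \<in> S" "x t \<in> U"
      using cl s0 unfolding net_cluster_point_def by meson
    have "x t \<in> admissible" using x t(1) by blast
    then have "x t i \<in> plate_measures i" using i by (simp add: admissible_iff)
    then have "x t i f \<le> a i" using f by (simp add: bounded_measures_def)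
    then show False using t(2) by (simp add: U_def)
  qed
  moreover have "\<mu> i \<in> radon_plus (A i)"
    using M i by (auto simp: topspace_vector_vague vector_measures_def)
  ultimately show ?thesis by (simp add: bounded_measures_def)
qed

lemma admissible_finite_energy: "\<mu> \<in> admissible \<Longrightarrow> finite_energy \<mu>"
  by (simp add: admissible_iff)

theorem cluster_point_limit:
  fixes S :: "'s set"
  assumes dir: "directed_set S le" and x: "x \<in> S \<rightarrow> admissible"
    and cau: "Cauchy_net (vdist) S le x"
    and cl: "net_cluster_point (vvague) S le x \<mu>"
  shows "\<mu> \<in> admissible" "((\<lambda>s. vdist (x s) \<mu>) \<longlongrightarrow> 0) (net_filter S le)"
proof -
  let ?T = "vvague"
  have M: "\<mu> \<in> topspace ?T" using cl by (simp add: net_cluster_point_def)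
  then have VM: "\<mu> \<in> vmeasures" by (simp add: topspace_vector_vague)
  have adm: "x s \<in> admissible" if "s \<in> S" for s using x that by blast
  have fe: "finite_energy (x s)" if "s \<in> S" for s using adm[OF that] by (rule admissible_finite_energy)
  have E: "pos_sum (x s) \<in> \<E>" "neg_sum (x s) \<in> \<E>" if "s \<in> S" for s
    using fe[OF that] by (auto simp: finite_energy_def)
  have V: "resultant (x s) \<in> energy_diff" if "s \<in> S" for s
    by (rule resultant_energy_diff[OF fe[OF that]])
  have near: "\<exists>s0\<in>S. \<forall>s\<in>S. \<forall>t\<in>S. le s0 s \<longrightarrow> le s0 t \<longrightarrow>
      edist (resultant (x s)) (resultant (x t)) < e" if "e > 0" for e
    using cau[unfolded Cauchy_net_def, rule_format, OF that] vector_dist_eq[OF fe fe] by simp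
  then have cauR: "Cauchy_net (edist) S le (\<lambda>s f. pos_sum (x s) f - neg_sum (x s) f)"
    unfolding Cauchy_net_def resultant_def by blast
  obtain s1 where s1: "s1 \<in> S" "\<And>s t. s \<in> S \<Longrightarrow> t \<in> S \<Longrightarrow> le s1 s \<Longrightarrow> le s1 t \<Longrightarrow>
      edist (resultant (x s)) (resultant (x t)) < 1"
    using near[of 1] by auto
  obtain C where C: "\<And>\<mu>. \<mu> \<in> admissible \<Longrightarrow> energy_form (pos_sum \<mu>) (neg_sum \<mu>) \<le> C"
    "\<And>\<mu>. \<mu> \<in> admissible \<Longrightarrow> energy_form (neg_sum \<mu>) (pos_sum \<mu>) \<le> C"
    using mutual_energy_bound by blast
  \<comment> \<open>Beyond \<open>s1\<close> the resultants are within distance 1 of that of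
    \<open>x s1\<close>, so \<open>B\<close> bounds their norms. Adding the two cross energies, each
    at most \<open>C\<close>, bounds the separate norms, whence
    \<open>B\<^sup>2 + 2 * C\<close>.\<close>
  define B where "B = nrm (resultant (x s1)) + 1"
  have bd: "(nrm (pos_sum (x t)))\<^sup>2 + (nrm (neg_sum (x t)))\<^sup>2 \<le> B\<^sup>2 + 2 * C"
    if t: "t \<in> S" "le s1 t" for t
  proof -
    have "le s1 s1" using dir s1(1) unfolding directed_set_def by blast
    then have "nrm (\<lambda>f. resultant (x t) f - resultant (x s1) f) < 1"
      using s1(2)[OF t(1) s1(1) t(2)] by (simp add: energy_dist_eq)
    moreover have "nrm (\<lambda>f. (resultant (x t) f - resultant (x s1) f) + resultant (x s1) f)
        \<le> nrm (\<lambda>f. resultant (x t) f - resultant (x s1) f) + nrm (resultant (x s1))"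
      by (intro energy_norm_triangle energy_diff_diff V t(1) s1(1))
    ultimately have "nrm (resultant (x t)) \<le> B" by (simp add: B_def)
    then have "(nrm (resultant (x t)))\<^sup>2 \<le> B\<^sup>2"
      using energy_norm_nonneg[OF V[OF t(1)]] by (rule power_mono)
    moreover have "(nrm (resultant (x t)))\<^sup>2
        = (nrm (pos_sum (x t)))\<^sup>2 + (nrm (neg_sum (x t)))\<^sup>2
          - energy_form (pos_sum (x t)) (neg_sum (x t)) - energy_form (neg_sum (x t)) (pos_sum (x t))"
      using energy_form_diff(3)[OF E[OF t(1)] E[OF t(1)]] V[OF t(1)] E[OF t(1)]
      by (simp add: energy_norm_square energy_plus_subset_diff resultant_def)
    ultimately show ?thesis using C[OF adm[OF t(1)]] by linarith
  qed
  \<comment> \<open>The net merely clusters, so the positive and the negative sum must be caught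
    near their targets at the same index; \<open>U\<close> combines both conditions for all of
    \<open>F\<close>.\<close>
  have clu: "\<exists>t\<in>S. le s t \<and> (\<forall>f\<in>F. \<bar>pos_sum (x t) f - pos_sum \<mu> f\<bar> < \<delta> \<and> \<bar>neg_sum (x t) f - neg_sum \<mu> f\<bar> < \<delta>)"
    if s: "s \<in> S" and F: "finite F" "F \<subseteq> Cc" and \<delta>: "0 < \<delta>" for s F \<delta>
  proof -
    define U where "U = {\<nu> \<in> topspace ?T. \<forall>f\<in>F.
        \<bar>pos_sum \<nu> f - pos_sum \<mu> f\<bar> < \<delta> \<and> \<bar>neg_sum \<nu> f - neg_sum \<mu> f\<bar> < \<delta>}"
    have op: "openin ?T {\<nu> \<in> topspace ?T. \<bar>measure_sum J \<nu> f - measure_sum J \<mu> f\<bar> < \<delta>}"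
      if "f \<in> F" "J \<subseteq> idx" for f J
    proof -
      have "continuous_map ?T euclideanreal (\<lambda>\<nu>. \<bar>measure_sum J \<nu> f - measure_sum J \<mu> f\<bar>)"
        using that F(2) by (intro continuous_intros continuous_map_measure_sum) auto
      from openin_continuous_map_preimage[OF this, of "{..<\<delta>}"] show ?thesis by simp
    qed
    have "openin ?T U"
      unfolding U_def
    proof (rule openin_Collect_Ball_finite[OF F(1)])
      fix f assume f: "f \<in> F"
      have "{\<nu> \<in> topspace ?T. \<bar>pos_sum \<nu> f - pos_sum \<mu> f\<bar> < \<delta> \<and> \<bar>neg_sum \<nu> f - neg_sum \<mu> f\<bar> < \<delta>}
          = {\<nu> \<in> topspace ?T. \<bar>pos_sum \<nu> f - pos_sum \<mu> f\<bar> < \<delta>} \<inter> {\<nu> \<in> topspace ?T. \<bar>neg_sum \<nu> f - neg_sum \<mu> f\<bar> < \<delta>}"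
        by blast
      then show "openin ?T {\<nu> \<in> topspace ?T. \<bar>pos_sum \<nu> f - pos_sum \<mu> f\<bar> < \<delta> \<and> \<bar>neg_sum \<nu> f - neg_sum \<mu> f\<bar> < \<delta>}"
        using op[OF f] by (simp add: openin_Int)
    qed
    moreover have "\<mu> \<in> U" using M \<delta> by (simp add: U_def)
    ultimately obtain t where "t \<in> S" "le s t" "x t \<in> U"
      using cl s unfolding net_cluster_point_def by meson
    then show ?thesis by (auto simp: U_def)
  qed
  have PN: "(\<lambda>s. pos_sum (x s)) \<in> S \<rightarrow> \<E>" "(\<lambda>s. neg_sum (x s)) \<in> S \<rightarrow> \<E>"
    using E by blast+
  note lim = consistent_diff_limit[OF cons dir PN vector_measures_sum_radon_plus[OF VM] s1(1) bd cauR clu]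
  have fe\<mu>: "finite_energy \<mu>" using lim(1,2) VM by (simp add: finite_energy_def)
  then show "\<mu> \<in> admissible"
    using cluster_point_bounded_measures[OF x dir cl] by (simp add: admissible_iff)
  have "\<forall>\<^sub>F s in net_filter S le. edist (\<lambda>f. pos_sum (x s) f - neg_sum (x s) f) (\<lambda>f. pos_sum \<mu> f - neg_sum \<mu> f)
      = vdist (x s) \<mu>"
    unfolding eventually_net_filter[OF dir]
    using vector_dist_eq[OF fe fe\<mu>] s1(1) by (auto simp: resultant_def)
  then show "((\<lambda>s. vdist (x s) \<mu>) \<longlongrightarrow> 0) (net_filter S le)"
    using lim(3) by (rule Lim_transform_eventually[rotated])
qed

section \<open>From strong to vague convergence\<close>

lemma strong_limit_Cauchy:
  fixes S :: "'s set"
  assumes dir: "directed_set S le" and x: "x \<in> S \<rightarrow> admissible" and \<mu>0: "finite_energy \<mu>0"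
    and lim: "((\<lambda>s. vdist (x s) \<mu>0) \<longlongrightarrow> 0) (net_filter S le)"
  shows "Cauchy_net (vdist) S le x"
  unfolding Cauchy_net_def
proof (intro allI impI)
  fix e :: real assume "e > 0"
  then have "\<forall>\<^sub>F s in net_filter S le. dist (vdist (x s) \<mu>0) 0 < e / 2"
    using lim unfolding tendsto_iff by (meson half_gt_zero)
  then obtain s0 where s0: "s0 \<in> S"
    "\<And>t. t \<in> S \<Longrightarrow> le s0 t \<Longrightarrow> dist (vdist (x t) \<mu>0) 0 < e / 2"
    unfolding eventually_net_filter[OF dir] by blast
  have fe: "finite_energy (x s)" if "s \<in> S" for s using x that admissible_finite_energy by blast
  have "vdist (x s) (x t) < e" if st: "s \<in> S" "t \<in> S" "le s0 s" "le s0 t" for s t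
  proof -
    note R = resultant_energy_diff[OF fe[OF st(1)]] resultant_energy_diff[OF \<mu>0]
      resultant_energy_diff[OF fe[OF st(2)]]
    have "nrm (\<lambda>f. resultant (x s) f - resultant \<mu>0 f) < e / 2"
      "nrm (\<lambda>f. resultant (x t) f - resultant \<mu>0 f) < e / 2"
      using s0(2)[OF st(1,3)] s0(2)[OF st(2,4)]
      by (auto simp: vector_dist_eq fe st \<mu>0 energy_dist_eq)
    then show ?thesis
      using energy_norm_diff_triangle[OF R] energy_norm_minus_commute[OF R(3,2)]
      by (simp add: vector_dist_eq fe st energy_dist_eq)
  qed
  then show "\<exists>s0\<in>S. \<forall>s\<in>S. \<forall>t\<in>S. le s0 s \<longrightarrow> le s0 t \<longrightarrow> vdist (x s) (x t) < e"
    using s0(1) by blast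
qed

lemma strong_limit_unique:
  fixes S :: "'s set"
  assumes strict: "strictly_positive_definite \<kappa>" and dis: "disjoint_family_on A idx"
    and dir: "directed_set S le" and x: "x \<in> S \<rightarrow> admissible"
    and fe: "finite_energy \<mu>" "finite_energy \<nu>"
    and lim: "((\<lambda>s. vdist (x s) \<mu>) \<longlongrightarrow> 0) (net_filter S le)"
      "((\<lambda>s. vdist (x s) \<nu>) \<longlongrightarrow> 0) (net_filter S le)"
  shows "\<mu> = \<nu>"
proof -
  let ?R = resultant
  have R: "?R \<mu> \<in> energy_diff" "?R \<nu> \<in> energy_diff" using fe resultant_energy_diff by auto
  have D: "(\<lambda>f. ?R \<mu> f - ?R \<nu> f) \<in> energy_diff" by (rule energy_diff_diff[OF R])
  have "nrm (\<lambda>f. ?R \<mu> f - ?R \<nu> f) \<le> 0 + e" if "e > 0" for e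
  proof -
    have "e / 2 > 0" using that by simp
    then have "\<forall>\<^sub>F s in net_filter S le. dist (vdist (x s) \<mu>) 0 < e / 2 \<and>
        dist (vdist (x s) \<nu>) 0 < e / 2"
      using lim unfolding tendsto_iff by (intro eventually_conj) blast+
    then obtain s where s: "s \<in> S" "dist (vdist (x s) \<mu>) 0 < e / 2"
      "dist (vdist (x s) \<nu>) 0 < e / 2"
      unfolding eventually_net_filter[OF dir] using dir unfolding directed_set_def by blast
    have fes: "finite_energy (x s)" using x s(1) admissible_finite_energy by blast
    note Rs = resultant_energy_diff[OF fes]
    have "nrm (\<lambda>f. ?R (x s) f - ?R \<mu> f) < e / 2" "nrm (\<lambda>f. ?R (x s) f - ?R \<nu> f) < e / 2"
      using s(2,3) by (auto simp: vector_dist_eq fes fe energy_dist_eq)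
    then show ?thesis
      using energy_norm_diff_triangle[OF R(1) Rs R(2)] energy_norm_minus_commute[OF R(1) Rs] by linarith
  qed
  then have "nrm (\<lambda>f. ?R \<mu> f - ?R \<nu> f) \<le> 0" by (rule field_le_epsilon)
  then have "nrm (\<lambda>f. ?R \<mu> f - ?R \<nu> f) = 0" using energy_norm_nonneg[OF D] by simp
  then have "(\<lambda>f. ?R \<mu> f - ?R \<nu> f) = (\<lambda>_. 0)"
    using strict energy_diff_subset_energy_space[OF D] by (simp add: strictly_positive_definite_def)
  then have "?R \<mu> = ?R \<nu>" by (simp add: fun_eq_iff)
  then show ?thesis using fe by (intro resultant_inject[OF dis]) (auto simp: finite_energy_def)
qed

text \<open>If the net were to leave a neighbourhood of \<open>\<mu>0\<close> frequently, the corresponding subnet would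
  have a cluster point; by uniqueness of strong limits it would be \<open>\<mu>0\<close> itself.\<close>

theorem strong_limit_vague_limit:
  fixes S :: "'s set"
  assumes strict: "strictly_positive_definite \<kappa>" and dis: "disjoint_family_on A idx"
    and dir: "directed_set S le" and x: "x \<in> S \<rightarrow> admissible" and \<mu>0: "finite_energy \<mu>0"
    and lim: "((\<lambda>s. vdist (x s) \<mu>0) \<longlongrightarrow> 0) (net_filter S le)"
  shows "\<mu>0 \<in> admissible" "limitin (vvague) x \<mu>0 (net_filter S le)"
proof -
  let ?T = "vvague"
  \<comment> \<open>Formulated for any index set, since it is applied to \<open>S\<close> and to the
    set of indices at which the net is outside a neighbourhood.\<close>
  have main: "net_cluster_point ?T S' le x \<mu>0 \<and> \<mu>0 \<in> admissible"
    if S': "directed_set S' le" "x \<in> S' \<rightarrow> admissible"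
      "((\<lambda>s. vdist (x s) \<mu>0) \<longlongrightarrow> 0) (net_filter S' le)" for S'
  proof -
    obtain \<mu> where cl: "net_cluster_point ?T S' le x \<mu>" using cluster_point_exists[OF S'(1,2)] by blast
    note l = cluster_point_limit[OF S'(1,2) strong_limit_Cauchy[OF S'(1,2) \<mu>0 S'(3)] cl]
    have "\<mu> = \<mu>0"
      by (rule strong_limit_unique[OF strict dis S'(1,2) admissible_finite_energy[OF l(1)] \<mu>0 l(2) S'(3)])
    then show ?thesis using cl l(1) by simp
  qed
  show "\<mu>0 \<in> admissible" using main[OF dir x lim] by blast
  show "limitin ?T x \<mu>0 (net_filter S le)"
    unfolding limitin_def
  proof (intro conjI allI impI)
    show "\<mu>0 \<in> topspace ?T" using \<mu>0 by (simp add: topspace_vector_vague finite_energy_def)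
    fix U assume U: "openin ?T U \<and> \<mu>0 \<in> U"
    show "\<forall>\<^sub>F s in net_filter S le. x s \<in> U"
    proof (rule ccontr)
      assume no: "\<not> ?thesis"
      \<comment> \<open>As the net is not eventually in \<open>U\<close>, these indices are cofinal;
        so they are directed by the same relation and the strong limit is inherited.\<close>
      define S' where "S' = {s \<in> S. x s \<notin> U}"
      have sub: "S' \<subseteq> S" by (auto simp: S'_def)
      have cof: "\<exists>t\<in>S'. le s t" if "s \<in> S" for s
        using no that unfolding eventually_net_filter[OF dir] S'_def by blast
      have refl: "le s s" if "s \<in> S" for s using dir that unfolding directed_set_def by blast
      have trans: "le s u" if "s \<in> S" "t \<in> S" "u \<in> S" "le s t" "le t u" for s t u
        using dir that unfolding directed_set_def by blast
      have "\<exists>u\<in>S'. le s u \<and> le t u" if st: "s \<in> S'" "t \<in> S'" for s t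
      proof -
        obtain u where u: "u \<in> S" "le s u" "le t u"
          using dir st sub unfolding directed_set_def by blast
        obtain v where v: "v \<in> S'" "le u v" using cof[OF u(1)] by blast
        then show ?thesis using trans[of s u v] trans[of t u v] st sub u by blast
      qed
      moreover have "S' \<noteq> {}" using cof dir unfolding directed_set_def by blast
      ultimately have dir': "directed_set S' le"
        unfolding directed_set_def using refl trans sub by (meson subsetD)
      have x': "x \<in> S' \<rightarrow> admissible" using x sub by blast
      have "((\<lambda>s. vdist (x s) \<mu>0) \<longlongrightarrow> 0) (net_filter S' le)"
        unfolding tendsto_iff
      proof (intro allI impI)
        fix e :: real assume "e > 0"
        then have "\<forall>\<^sub>F s in net_filter S le. dist (vdist (x s) \<mu>0) 0 < e"
          using lim unfolding tendsto_iff by blast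
        then obtain s0 where s0: "s0 \<in> S"
          "\<And>t. t \<in> S \<Longrightarrow> le s0 t \<Longrightarrow> dist (vdist (x t) \<mu>0) 0 < e"
          unfolding eventually_net_filter[OF dir] by blast
        obtain s' where s': "s' \<in> S'" "le s0 s'" using cof[OF s0(1)] by blast
        have "dist (vdist (x t) \<mu>0) 0 < e" if "t \<in> S'" "le s' t" for t
          using s0(2)[of t] trans[of s0 s' t] s0(1) s' that sub by blast
        then show "\<forall>\<^sub>F s in net_filter S' le. dist (vdist (x s) \<mu>0) 0 < e"
          unfolding eventually_net_filter[OF dir'] using s'(1) by blast
      qed
      then have "net_cluster_point ?T S' le x \<mu>0" using main[OF dir' x'] by blast
      then obtain t where "t \<in> S'" "x t \<in> U"
        using U \<open>S' \<noteq> {}\<close> unfolding net_cluster_point_def by blast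
      then show False by (simp add: S'_def)
    qed
  qed
qed

end

theorem theorem9p1:
  fixes \<kappa> :: "'a::t2_space \<times> 'a \<Rightarrow> ereal"
    and Ipos Ineg :: "nat set"
    and A :: "nat \<Rightarrow> 'a set"
    and a :: "nat \<Rightarrow> real"
    and g :: "nat \<Rightarrow> 'a \<Rightarrow> real"
  assumes "locally_compact_space (euclidean :: 'a topology)"
    and "\<kappa> \<in> Phi"
    and "positive_definite \<kappa>"
    and "consistent \<kappa>"
    and "condenser Ipos Ineg A"
    and "\<forall>i\<in>Ipos \<union> Ineg. 0 < a i"
    and "\<forall>i\<in>Ipos \<union> Ineg. continuous_on (A i) (g i) \<and> (\<forall>x\<in>A i. 0 < g i x)"
    and "Ineg = {} \<or>
         (\<Sum>\<^sub>\<infinity>i\<in>Ipos \<union> Ineg. ennreal (a i) * inverse (ennreal (INF x\<in>A i. g i x))) < \<infinity> \<and>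
         (SUP (x, y)\<in>(\<Union>i\<in>Ipos. A i) \<times> (\<Union>j\<in>Ineg. A j). \<kappa> (x, y)) < \<infinity>"
    and "\<exists>\<mu>\<in>vector_energy_space \<kappa> Ipos Ineg A.
           \<forall>i\<in>Ipos \<union> Ineg. integral_on (A i) (g i) (\<mu> i) = ereal (a i)"
  shows
    "(\<forall>(S :: 's set) le \<mu>s.
       directed_set S le \<longrightarrow> \<mu>s \<in> S \<rightarrow> vector_energy_le \<kappa> Ipos Ineg A a g \<longrightarrow>
       Cauchy_net (vector_dist \<kappa> Ipos Ineg) S le \<mu>s \<longrightarrow>
       (\<exists>\<mu>\<in>vector_energy_le \<kappa> Ipos Ineg A a g.
          ((\<lambda>s. vector_dist \<kappa> Ipos Ineg (\<mu>s s) \<mu>) \<longlongrightarrow> 0) (net_filter S le))) \<and>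
     (\<forall>(S :: 's set) le \<mu>s.
       directed_set S le \<longrightarrow> \<mu>s \<in> S \<rightarrow> vector_energy_le \<kappa> Ipos Ineg A a g \<longrightarrow>
       Cauchy_net (vector_dist \<kappa> Ipos Ineg) S le \<mu>s \<longrightarrow>
       (\<exists>\<mu>. net_cluster_point (vector_vague_topology Ipos Ineg A) S le \<mu>s \<mu>) \<and>
       (\<forall>\<mu>. net_cluster_point (vector_vague_topology Ipos Ineg A) S le \<mu>s \<mu> \<longrightarrow>
          \<mu> \<in> vector_energy_le \<kappa> Ipos Ineg A a g \<and>
          ((\<lambda>s. (vector_dist \<kappa> Ipos Ineg (\<mu>s s) \<mu>)\<^sup>2) \<longlongrightarrow> 0) (net_filter S le))) \<and>
     (strictly_positive_definite \<kappa> \<and> disjoint_family_on A (Ipos \<union> Ineg) \<longrightarrow>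
     (\<forall>(S :: 's set) le \<mu>s.
        directed_set S le \<longrightarrow> \<mu>s \<in> S \<rightarrow> vector_energy_le \<kappa> Ipos Ineg A a g \<longrightarrow>
        (\<forall>\<mu>0\<in>vector_energy_space \<kappa> Ipos Ineg A.
          ((\<lambda>s. vector_dist \<kappa> Ipos Ineg (\<mu>s s) \<mu>0) \<longlongrightarrow> 0) (net_filter S le) \<longrightarrow>
          \<mu>0 \<in> vector_energy_le \<kappa> Ipos Ineg A a g \<and>
          limitin (vector_vague_topology Ipos Ineg A) \<mu>s \<mu>0 (net_filter S le))))"
proof -
  interpret constrained_condenser \<kappa> Ipos Ineg A a g
    using assms by unfold_locales auto
  show ?thesis
  proof (intro conjI allI impI ballI)
    fix S :: "'s set" and le \<mu>s
    assume dir: "directed_set S le" and x: "\<mu>s \<in> S \<rightarrow> admissible"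
      and cau: "Cauchy_net (vector_dist \<kappa> Ipos Ineg) S le \<mu>s"
    show ex: "\<exists>\<mu>. net_cluster_point (vector_vague_topology Ipos Ineg A) S le \<mu>s \<mu>"
      by (rule cluster_point_exists[OF dir x])
    then show "\<exists>\<mu>\<in>admissible. ((\<lambda>s. vector_dist \<kappa> Ipos Ineg (\<mu>s s) \<mu>) \<longlongrightarrow> 0) (net_filter S le)"
      using cluster_point_limit[OF dir x cau] by blast
    fix \<mu> assume cl: "net_cluster_point (vector_vague_topology Ipos Ineg A) S le \<mu>s \<mu>"
    show "\<mu> \<in> admissible" by (rule cluster_point_limit(1)[OF dir x cau cl])
    show "((\<lambda>s. (vector_dist \<kappa> Ipos Ineg (\<mu>s s) \<mu>)\<^sup>2) \<longlongrightarrow> 0) (net_filter S le)"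
      using tendsto_power[OF cluster_point_limit(2)[OF dir x cau cl], of 2] by simp
  next
    fix S :: "'s set" and le \<mu>s \<mu>0
    assume "strictly_positive_definite \<kappa> \<and> disjoint_family_on A (Ipos \<union> Ineg)"
      and "directed_set S le" "\<mu>s \<in> S \<rightarrow> admissible" "\<mu>0 \<in> vector_energy_space \<kappa> Ipos Ineg A"
      and "((\<lambda>s. vector_dist \<kappa> Ipos Ineg (\<mu>s s) \<mu>0) \<longlongrightarrow> 0) (net_filter S le)"
    then show "\<mu>0 \<in> admissible" "limitin (vector_vague_topology Ipos Ineg A) \<mu>s \<mu>0 (net_filter S le)"
      using strong_limit_vague_limit by (auto simp: vector_energy_space_iff)
  qed
qed

end
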